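(* Let $g$ be a light-line-complete pseudo-Riemannian metric of indefinite signature on a closed connected $n$-dimensional manifold $M^n$. Then the cone $(\hat M, \hat g)$ over $(M^n,g)$ is not decomposable.
   Context: All objects are smooth. A closed manifold is a compact manifold without boundary. The metric $g$ has indefinite signature if for no constant $c$ the metric $c\cdot g$ is Riemannian. A light-line geodesic is an affinely parametrized geodesic $\gamma$ with $g(\dot\gamma,\dot\gamma)=0$; $g$ is light-line-complete if every light-line geodesic can be extended to be defined on all of $\mathbb{R}$. The cone over $(M^n,g)$ is the pseudo-Riemannian manifold $(\hat M^{n+1},\hat g)$ with $\hat M=\mathbb{R}_{>0}\times M$ and $\hat g=(dx_0)^2+x_0^2\cdot\left(\sum_{i,j=1}^n g_{ij}(x_1,\dots,x_n)\,dx_i\,dx_j\right)$, where $x_0$ is the standard coordinate on $\mathbb{R}_{>0}$ and $x_1,\dots,x_n$ are local coordinates on $M^n$. The cone is decomposable if for a point $p\in\hat M$ there exists a proper (nonzero and not the whole space) nondegenerate subspace $U\subset T_p\hat M$ (i.e., $\hat g|_U$ is nondegenerate) that is invariant with respect to the holonomy group of $(\hat M,\hat g)$ at $p$. *)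

theory Defs
  imports "HOL-Analysis.Analysis" "HOL-Library.Function_Algebras"
begin

section \<open>Smooth maps between Euclidean spaces\<close>

text \<open>For open \<open>U\<close>, this says that \<open>f\<close> is of class \<open>C\<^sup>k\<close> on \<open>U\<close>: all iterated directional
  derivatives of order at most \<open>k\<close> exist and are continuous.\<close>

primrec Ck_on :: "nat \<Rightarrow> ('a::euclidean_space \<Rightarrow> 'b::real_normed_vector) \<Rightarrow> 'a set \<Rightarrow> bool" where
  "Ck_on 0 f U \<longleftrightarrow> continuous_on U f"
| "Ck_on (Suc k) f U \<longleftrightarrow>
     (\<forall>x\<in>U. f differentiable (at x)) \<and>
     (\<forall>v. Ck_on k (\<lambda>x. frechet_derivative f (at x) v) U)"

text \<open>Smoothness on an arbitrary set: local extendability to a smooth map on an open set.\<close>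

definition smooth_on :: "'a::euclidean_space set \<Rightarrow> ('a \<Rightarrow> 'b::real_normed_vector) \<Rightarrow> bool" where
  "smooth_on S f \<longleftrightarrow>
     (\<forall>x\<in>S. \<exists>U h. open U \<and> x \<in> U \<and> (\<forall>k. Ck_on k h U) \<and> (\<forall>y\<in>U \<inter> S. h y = f y))"


section \<open>Smooth manifolds\<close>

text \<open>The atlas is given as an indexed family of charts; the charts take values in the Euclidean
  space \<open>'e\<close>, so the dimension of the manifold is \<open>DIM('e)\<close>.\<close>

record ('a, 'i, 'e) atlas =
  mtop :: "'a topology"
  idx :: "'i set"
  cdom :: "'i \<Rightarrow> 'a set"
  cmap :: "'i \<Rightarrow> 'a \<Rightarrow> 'e"

definition cinv :: "('a, 'i, 'e) atlas \<Rightarrow> 'i \<Rightarrow> 'e \<Rightarrow> 'a" where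
  "cinv M i = inv_into (cdom M i) (cmap M i)"

definition transition :: "('a, 'i, 'e) atlas \<Rightarrow> 'i \<Rightarrow> 'i \<Rightarrow> 'e \<Rightarrow> 'e" where
  "transition M i j = cmap M j \<circ> cinv M i"

definition charts_at :: "('a, 'i, 'e) atlas \<Rightarrow> 'a \<Rightarrow> 'i set" where
  "charts_at M p = {i \<in> idx M. p \<in> cdom M i}"

definition smooth_manifold :: "('a, 'i, 'e::euclidean_space) atlas \<Rightarrow> bool" where
  "smooth_manifold M \<longleftrightarrow>
     Hausdorff_space (mtop M) \<and> second_countable (mtop M) \<and>
     (\<Union>i\<in>idx M. cdom M i) = topspace (mtop M) \<and>
     (\<forall>i\<in>idx M. openin (mtop M) (cdom M i) \<and> open (cmap M i ` cdom M i) \<and>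
        homeomorphic_map (subtopology (mtop M) (cdom M i))
          (top_of_set (cmap M i ` cdom M i)) (cmap M i)) \<and>
     (\<forall>i\<in>idx M. \<forall>j\<in>idx M.
        smooth_on (cmap M i ` (cdom M i \<inter> cdom M j)) (transition M i j))"


section \<open>Tangent spaces\<close>

text \<open>A tangent vector at \<open>p\<close> is the family of its coordinate representations in the charts
  around \<open>p\<close>, related by the differentials of the transition maps. Components at all other
  indices are \<open>0\<close>, so that addition and scaling are pointwise.\<close>

type_synonym ('i, 'e) tvec = "'i \<Rightarrow> 'e"

definition tscale :: "real \<Rightarrow> ('i, 'e::real_vector) tvec \<Rightarrow> ('i, 'e) tvec" where
  "tscale r v = (\<lambda>i. r *\<^sub>R v i)"

lemma vector_space_tscale: "vector_space (tscale :: real \<Rightarrow> ('i, 'e::real_vector) tvec \<Rightarrow> _)"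
  by unfold_locales (auto simp: tscale_def fun_eq_iff algebra_simps)

definition tangent_space ::
    "('a, 'i, 'e::euclidean_space) atlas \<Rightarrow> 'a \<Rightarrow> ('i, 'e) tvec set" where
  "tangent_space M p =
     {v. (\<forall>i\<in>charts_at M p. \<forall>j\<in>charts_at M p.
            v j = frechet_derivative (transition M i j) (at (cmap M i p)) (v i)) \<and>
         (\<forall>i. i \<notin> charts_at M p \<longrightarrow> v i = 0)}"

text \<open>The tangent vector at \<open>p\<close> whose representation in chart \<open>i\<close> is \<open>a\<close>.\<close>

definition of_coords ::
    "('a, 'i, 'e::euclidean_space) atlas \<Rightarrow> 'i \<Rightarrow> 'a \<Rightarrow> 'e \<Rightarrow> ('i, 'e) tvec" where
  "of_coords M i p a =
     (\<lambda>j. if j \<in> charts_at M p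
          then frechet_derivative (transition M i j) (at (cmap M i p)) a else 0)"


section \<open>Pseudo-Riemannian metrics\<close>

type_synonym ('a, 'i, 'e) metric = "'a \<Rightarrow> ('i, 'e) tvec \<Rightarrow> ('i, 'e) tvec \<Rightarrow> real"

text \<open>\<open>metric_comp M g i x a b\<close> is \<open>\<Sum>k l. g\<^sub>k\<^sub>l(x) a\<^sub>k b\<^sub>l\<close> in the coordinates of chart \<open>i\<close>.\<close>

definition metric_comp ::
    "('a, 'i, 'e::euclidean_space) atlas \<Rightarrow> ('a, 'i, 'e) metric \<Rightarrow> 'i \<Rightarrow> 'e \<Rightarrow> 'e \<Rightarrow> 'e \<Rightarrow> real" where
  "metric_comp M g i x a b =
     g (cinv M i x) (of_coords M i (cinv M i x) a) (of_coords M i (cinv M i x) b)"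

definition nondegenerate_on ::
    "(('i, 'e::real_vector) tvec \<Rightarrow> ('i, 'e) tvec \<Rightarrow> real) \<Rightarrow> ('i, 'e) tvec set \<Rightarrow> bool" where
  "nondegenerate_on b U \<longleftrightarrow> (\<forall>u\<in>U. (\<forall>v\<in>U. b u v = 0) \<longrightarrow> u = 0)"

definition pseudo_riemannian ::
    "('a, 'i, 'e::euclidean_space) atlas \<Rightarrow> ('a, 'i, 'e) metric \<Rightarrow> bool" where
  "pseudo_riemannian M g \<longleftrightarrow>
     (\<forall>p\<in>topspace (mtop M).
        (\<forall>u\<in>tangent_space M p. \<forall>v\<in>tangent_space M p. g p u v = g p v u) \<and>
        (\<forall>u\<in>tangent_space M p. \<forall>v\<in>tangent_space M p. \<forall>w\<in>tangent_space M p.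
           g p (u + v) w = g p u w + g p v w) \<and>
        (\<forall>r. \<forall>u\<in>tangent_space M p. \<forall>v\<in>tangent_space M p. g p (tscale r u) v = r * g p u v) \<and>
        nondegenerate_on (g p) (tangent_space M p)) \<and>
     (\<forall>i\<in>idx M. \<forall>a b. smooth_on (cmap M i ` cdom M i) (\<lambda>x. metric_comp M g i x a b))"

definition riemannian ::
    "('a, 'i, 'e::euclidean_space) atlas \<Rightarrow> ('a, 'i, 'e) metric \<Rightarrow> bool" where
  "riemannian M g \<longleftrightarrow> pseudo_riemannian M g \<and>
     (\<forall>p\<in>topspace (mtop M). \<forall>v\<in>tangent_space M p. v \<noteq> 0 \<longrightarrow> g p v v > 0)"

definition indefinite ::
    "('a, 'i, 'e::euclidean_space) atlas \<Rightarrow> ('a, 'i, 'e) metric \<Rightarrow> bool" where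
  "indefinite M g \<longleftrightarrow> \<not> (\<exists>c. riemannian M (\<lambda>p u v. c * g p u v))"


section \<open>Levi-Civita connection along curves, geodesics\<close>

text \<open>The Christoffel symbols in chart \<open>i\<close> as a bilinear map: the \<open>k\<close>-th coordinate of
  \<open>christoffel M g i x a b\<close> is \<open>\<Sum>l m. \<Gamma>\<^sup>k\<^sub>l\<^sub>m(x) a\<^sub>l b\<^sub>m\<close>. The defining equation is
  \<open>g\<^sub>s\<^sub>k \<Gamma>\<^sup>s\<^sub>l\<^sub>m = (\<partial>\<^sub>l g\<^sub>m\<^sub>k + \<partial>\<^sub>m g\<^sub>l\<^sub>k - \<partial>\<^sub>k g\<^sub>l\<^sub>m) / 2\<close>; it has a unique solution as \<open>g\<close> is
  nondegenerate.\<close>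

definition christoffel ::
    "('a, 'i, 'e::euclidean_space) atlas \<Rightarrow> ('a, 'i, 'e) metric \<Rightarrow> 'i \<Rightarrow> 'e \<Rightarrow> 'e \<Rightarrow> 'e \<Rightarrow> 'e" where
  "christoffel M g i x a b =
     (THE w. \<forall>z. metric_comp M g i x w z =
        (frechet_derivative (\<lambda>y. metric_comp M g i y b z) (at x) a
         + frechet_derivative (\<lambda>y. metric_comp M g i y a z) (at x) b
         - frechet_derivative (\<lambda>y. metric_comp M g i y a b) (at x) z) / 2)"

definition smooth_curve ::
    "('a, 'i, 'e::euclidean_space) atlas \<Rightarrow> real set \<Rightarrow> (real \<Rightarrow> 'a) \<Rightarrow> bool" where
  "smooth_curve M J \<gamma> \<longleftrightarrow> continuous_map (top_of_set J) (mtop M) \<gamma> \<and>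
     (\<forall>i\<in>idx M. smooth_on {t \<in> J. \<gamma> t \<in> cdom M i} (cmap M i \<circ> \<gamma>))"

definition velocity ::
    "('a, 'i, 'e::euclidean_space) atlas \<Rightarrow> (real \<Rightarrow> 'a) \<Rightarrow> real \<Rightarrow> ('i, 'e) tvec" where
  "velocity M \<gamma> t =
     (\<lambda>i. if i \<in> charts_at M (\<gamma> t) then vector_derivative (cmap M i \<circ> \<gamma>) (at t) else 0)"

text \<open>The covariant derivative of the vector field \<open>V\<close> along \<open>\<gamma>\<close> exists and vanishes at \<open>t\<close>.\<close>

definition parallel_at ::
    "('a, 'i, 'e::euclidean_space) atlas \<Rightarrow> ('a, 'i, 'e) metric \<Rightarrow> (real \<Rightarrow> 'a)
       \<Rightarrow> (real \<Rightarrow> ('i, 'e) tvec) \<Rightarrow> real \<Rightarrow> bool" where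
  "parallel_at M g \<gamma> V t \<longleftrightarrow>
     (\<forall>i\<in>charts_at M (\<gamma> t).
        ((\<lambda>s. V s i) has_vector_derivative
           - christoffel M g i (cmap M i (\<gamma> t)) (velocity M \<gamma> t i) (V t i)) (at t))"

definition geodesic ::
    "('a, 'i, 'e::euclidean_space) atlas \<Rightarrow> ('a, 'i, 'e) metric \<Rightarrow> real set \<Rightarrow> (real \<Rightarrow> 'a) \<Rightarrow> bool" where
  "geodesic M g J \<gamma> \<longleftrightarrow> open J \<and> is_interval J \<and> J \<noteq> {} \<and> smooth_curve M J \<gamma> \<and>
     (\<forall>t\<in>J. parallel_at M g \<gamma> (velocity M \<gamma>) t)"

definition light_line_geodesic ::
    "('a, 'i, 'e::euclidean_space) atlas \<Rightarrow> ('a, 'i, 'e) metric \<Rightarrow> real set \<Rightarrow> (real \<Rightarrow> 'a) \<Rightarrow> bool" where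
  "light_line_geodesic M g J \<gamma> \<longleftrightarrow> geodesic M g J \<gamma> \<and>
     (\<forall>t\<in>J. g (\<gamma> t) (velocity M \<gamma> t) (velocity M \<gamma> t) = 0)"

definition light_line_complete ::
    "('a, 'i, 'e::euclidean_space) atlas \<Rightarrow> ('a, 'i, 'e) metric \<Rightarrow> bool" where
  "light_line_complete M g \<longleftrightarrow>
     (\<forall>J \<gamma>. light_line_geodesic M g J \<gamma> \<longrightarrow>
        (\<exists>\<delta>. light_line_geodesic M g UNIV \<delta> \<and> (\<forall>t\<in>J. \<delta> t = \<gamma> t)))"


section \<open>Holonomy and decomposability\<close>

definition piecewise_smooth_path ::
    "('a, 'i, 'e::euclidean_space) atlas \<Rightarrow> (real \<Rightarrow> 'a) \<Rightarrow> bool" where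
  "piecewise_smooth_path M \<gamma> \<longleftrightarrow> pathin (mtop M) \<gamma> \<and>
     (\<exists>S. finite S \<and>
        (\<forall>a b. 0 \<le> a \<and> a < b \<and> b \<le> 1 \<and> {a<..<b} \<inter> S = {} \<longrightarrow> smooth_curve M {a..b} \<gamma>))"

text \<open>Continuous vector fields along a piecewise smooth path that are parallel away from
  finitely many parameters, which may include the break points and the end points of the path.\<close>

definition parallel_along ::
    "('a, 'i, 'e::euclidean_space) atlas \<Rightarrow> ('a, 'i, 'e) metric \<Rightarrow> (real \<Rightarrow> 'a)
       \<Rightarrow> (real \<Rightarrow> ('i, 'e) tvec) \<Rightarrow> bool" where
  "parallel_along M g \<gamma> V \<longleftrightarrow>
     (\<forall>t\<in>{0..1}. V t \<in> tangent_space M (\<gamma> t)) \<and>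
     (\<forall>i\<in>idx M. continuous_on {t \<in> {0..1}. \<gamma> t \<in> cdom M i} (\<lambda>t. V t i)) \<and>
     (\<exists>S. finite S \<and> (\<forall>t\<in>{0<..<1} - S. parallel_at M g \<gamma> V t))"

text \<open>Parallel transports along loops at \<open>p\<close>, as maps on the tangent space
  (with value \<open>undefined\<close> outside it).\<close>

definition holonomy_group ::
    "('a, 'i, 'e::euclidean_space) atlas \<Rightarrow> ('a, 'i, 'e) metric \<Rightarrow> 'a
       \<Rightarrow> (('i, 'e) tvec \<Rightarrow> ('i, 'e) tvec) set" where
  "holonomy_group M g p =
     {P \<in> tangent_space M p \<rightarrow>\<^sub>E tangent_space M p.
        \<exists>\<gamma>. piecewise_smooth_path M \<gamma> \<and> \<gamma> 0 = p \<and> \<gamma> 1 = p \<and>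
          (\<forall>v\<in>tangent_space M p. \<exists>V. parallel_along M g \<gamma> V \<and> V 0 = v \<and> V 1 = P v)}"

definition decomposable ::
    "('a, 'i, 'e::euclidean_space) atlas \<Rightarrow> ('a, 'i, 'e) metric \<Rightarrow> bool" where
  "decomposable M g \<longleftrightarrow>
     (\<exists>p\<in>topspace (mtop M). \<exists>U.
        module.subspace tscale U \<and> U \<subseteq> tangent_space M p \<and>
        U \<noteq> {0} \<and> U \<noteq> tangent_space M p \<and>
        nondegenerate_on (g p) U \<and>
        (\<forall>P\<in>holonomy_group M g p. P ` U \<subseteq> U))"


section \<open>The cone\<close>

definition cone_manifold :: "('a, 'i, 'e) atlas \<Rightarrow> (real \<times> 'a, 'i, real \<times> 'e) atlas" where
  "cone_manifold M = \<lparr> mtop = prod_topology (top_of_set {0<..}) (mtop M), idx = idx M,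
     cdom = (\<lambda>i. {0<..} \<times> cdom M i), cmap = (\<lambda>i (r, p). (r, cmap M i p)) \<rparr>"

text \<open>For a tangent vector \<open>u\<close> of the cone at \<open>(r, p)\<close>, \<open>dx\<^sub>0(u)\<close> is the first component of
  \<open>u\<close> in any chart of the cone around \<open>(r, p)\<close>; the second components of \<open>u\<close> form the
  projection of \<open>u\<close> to the tangent space of \<open>M\<close> at \<open>p\<close>.\<close>

definition dx0 :: "('a, 'i, 'e) atlas \<Rightarrow> 'a \<Rightarrow> ('i, real \<times> 'e) tvec \<Rightarrow> real" where
  "dx0 M p u = fst (u (SOME i. i \<in> charts_at M p))"

definition base_part :: "('i, real \<times> 'e) tvec \<Rightarrow> ('i, 'e) tvec" where
  "base_part u = snd \<circ> u"

definition cone_metric ::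
    "('a, 'i, 'e) atlas \<Rightarrow> ('a, 'i, 'e) metric \<Rightarrow> (real \<times> 'a, 'i, real \<times> 'e) metric" where
  "cone_metric M g = (\<lambda>(r, p) u v.
     dx0 M p u * dx0 M p v + r\<^sup>2 * g p (base_part u) (base_part v))"

end

theory Submission
  imports Defs
begin

text \<open>Let \<open>U\<close> be a nondegenerate holonomy-invariant subspace; then the orthogonal projection \<open>L\<close> onto
  its parallel translates is a well-defined parallel field of endomorphisms on the cone. If
  \<open>\<delta>\<close> is a light-like geodesic of \<open>M\<close> and \<open>\<xi>\<close> the radial field of the cone, then \<open>\<delta>'\<close> and
  \<open>\<xi> - t \<delta>'\<close> are parallel along \<open>\<delta>\<close>, so \<open>\<langle>L \<xi>, \<xi>\<rangle>\<close> is a quadratic polynomial of \<open>t\<close>. By completeness it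
  is defined for all \<open>t\<close>, and by compactness of \<open>M\<close> it does not tend to infinity; hence its linear
  coefficient \<open>2 \<langle>L \<xi>, \<delta>'\<rangle>\<close> vanishes. As \<open>g\<close> is indefinite, light-like vectors span the tangent
  space of \<open>M\<close>, so \<open>L \<xi>\<close> is a multiple of \<open>\<xi>\<close>, that is, \<open>\<xi>\<close> lies in \<open>U\<close> or in its orthogonal
  complement. Since this holds at all points of \<open>\<delta>\<close>, the initial velocity of \<open>\<delta>\<close> lies in the same
  summand as \<open>\<xi>\<close>, and this summand is the whole tangent space.\<close>

section \<open>Calculus of \<open>C\<^sup>k\<close> maps\<close>

text \<open>The endomorphism field \<open>L\<close> is never formed. Its value at the end of a path
  \<open>\<gamma>\<close> is the projection onto the subspace of transports of \<open>U\<close>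
  along \<open>\<gamma>\<close>, and only such subspaces and projections of single vectors occur.
  This leaves the boundedness of \<langle>L \<xi>, \<xi>\<rangle>, which continuity of
  \<open>L\<close> on the compact set {r} x M would give, to be obtained differently. By the
  pigeonhole principle infinitely many integer times bring \<delta> into one coordinate ball so
  small that transport along coordinate segments at most doubles coordinate norms. The radial vector
  has coordinates (r, 0) in every chart, so after transport along such a segment to one fixed point
  its norm stays below a fixed bound, and there a single projection, a bounded operator, is applied.
  Linearity and uniqueness of transport come from preservation of the nondegenerate metric.
  Indefiniteness is a global condition (no constant multiple of \<open>g\<close> is Riemannian);
  connectedness turns it into vectors of both signs in each tangent space.\<close>

lemma has_derivative_cong_open:
  assumes "open U" "x \<in> U" "\<And>y. y \<in> U \<Longrightarrow> f y = h y"
  shows "(f has_derivative D) (at x) \<longleftrightarrow> (h has_derivative D) (at x)"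
  using has_derivative_transform_within_open[OF _ assms(1,2)] assms(3) by metis

lemma frechet_derivative_cong_open:
  assumes "open U" "x \<in> U" "\<And>y. y \<in> U \<Longrightarrow> f y = h y"
  shows "frechet_derivative f (at x) = frechet_derivative h (at x)"
  unfolding frechet_derivative_def using has_derivative_cong_open[OF assms] by simp

lemma Ck_on_cong:
  assumes "open U" "\<And>x. x \<in> U \<Longrightarrow> f x = h x"
  shows "Ck_on k f U \<longleftrightarrow> Ck_on k h U"
  using assms(2)
proof (induction k arbitrary: f h)
  case 0
  then have "continuous_on U f \<longleftrightarrow> continuous_on U h" by (intro continuous_on_cong) auto
  then show ?case by simp
next
  case (Suc k)
  have "frechet_derivative f (at x) = frechet_derivative h (at x)" if "x \<in> U" for x
    using frechet_derivative_cong_open[of U x f h] assms(1) that Suc.prems by blast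
  then have "Ck_on k (\<lambda>x. frechet_derivative f (at x) v) U \<longleftrightarrow> Ck_on k (\<lambda>x. frechet_derivative h (at x) v) U" for v
    by (intro Suc.IH) simp
  moreover have "f differentiable (at x) \<longleftrightarrow> h differentiable (at x)" if "x \<in> U" for x
    using has_derivative_cong_open[of U x f h] assms(1) that Suc.prems unfolding differentiable_def by blast
  ultimately show ?case by simp
qed

text \<open>\<open>Ck_on\<close> speaks of \<open>frechet_derivative\<close>, so a known derivative
  \<open>D\<close> has to be identified with it. The two agree only on \<open>U\<close>, and passing
  to their derivatives requires \<open>U\<close> to be open.\<close>

lemma Ck_on_SucI:
  assumes "\<And>x. x \<in> U \<Longrightarrow> (f has_derivative D x) (at x)" "\<And>v. Ck_on k (\<lambda>x. D x v) U" "open U"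
  shows "Ck_on (Suc k) f U"
proof -
  have "frechet_derivative f (at x) = D x" if "x \<in> U" for x
    using frechet_derivative_at[OF assms(1)[OF that]] by simp
  then have "Ck_on k (\<lambda>x. frechet_derivative f (at x) v) U \<longleftrightarrow> Ck_on k (\<lambda>x. D x v) U" for v
    by (intro Ck_on_cong assms(3)) simp
  moreover have "f differentiable (at x)" if "x \<in> U" for x using assms(1)[OF that] by (auto simp: differentiable_def)
  ultimately show ?thesis using assms(2) by simp
qed

lemma Ck_on_SucD:
  assumes "Ck_on (Suc k) f U" "x \<in> U"
  shows "(f has_derivative frechet_derivative f (at x)) (at x)"
  using assms frechet_derivative_works by auto

lemma Ck_on_Suc_imp: "Ck_on (Suc k) f U \<Longrightarrow> Ck_on k f U"
proof (induction k arbitrary: f)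
  case 0
  then show ?case
    by (auto intro!: continuous_at_imp_continuous_on differentiable_imp_continuous_within)
next
  case (Suc k)
  then show ?case using Ck_on.simps(2) by metis
qed

lemma Ck_on_le: "Ck_on k f U \<Longrightarrow> j \<le> k \<Longrightarrow> Ck_on j f U"
  by (induction k) (auto simp: le_Suc_eq dest: Ck_on_Suc_imp simp del: Ck_on.simps(2))

lemma Ck_on_subset: "Ck_on k f U \<Longrightarrow> V \<subseteq> U \<Longrightarrow> Ck_on k f V"
  by (induction k arbitrary: f) (auto intro: continuous_on_subset)

lemma Ck_on_continuous: "Ck_on k f U \<Longrightarrow> continuous_on U f"
  using Ck_on_le[of k f U 0] by simp

lemma Ck_on_local:
  assumes "\<And>x. x \<in> U \<Longrightarrow> \<exists>V. open V \<and> x \<in> V \<and> Ck_on k f V"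
  shows "Ck_on k f U"
  using assms
proof (induction k arbitrary: f)
  case 0
  then show ?case
    by (auto intro!: continuous_at_imp_continuous_on) (metis continuous_on_eq_continuous_at)
next
  case (Suc k)
  have "f differentiable (at x)" if "x \<in> U" for x using Suc.prems[OF that] by auto
  moreover have "Ck_on k (\<lambda>x. frechet_derivative f (at x) v) U" for v
    by (rule Suc.IH) (use Suc.prems in force)
  ultimately show ?case by simp
qed

text \<open>A local extension \<open>h\<close> from \<open>smooth_on\<close> agrees with
  \<open>f\<close> on the open set \<open>U \<inter> S\<close>, so it has the same derivatives
  there.\<close>

lemma smooth_on_open:
  assumes "open S"
  shows "smooth_on S f \<longleftrightarrow> (\<forall>k. Ck_on k f S)"
proof
  assume sm: "smooth_on S f"
  show "\<forall>k. Ck_on k f S"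
  proof (intro allI Ck_on_local)
    fix k x assume "x \<in> S"
    with sm obtain U h where U: "open U" "x \<in> U" "\<forall>k. Ck_on k h U" "\<forall>y\<in>U \<inter> S. h y = f y"
      unfolding smooth_on_def by blast
    then have "Ck_on k f (U \<inter> S)"
      using Ck_on_subset[of k h U "U \<inter> S"] Ck_on_cong[of "U \<inter> S" h f k] assms by auto
    then show "\<exists>V. open V \<and> x \<in> V \<and> Ck_on k f V" using U assms \<open>x \<in> S\<close> by blast
  qed
next
  assume "\<forall>k. Ck_on k f S"
  with assms show "smooth_on S f" unfolding smooth_on_def by blast
qed

lemma Ck_on_const [simp]: "Ck_on k (\<lambda>x. c) U"
  by (induction k arbitrary: c) auto

lemma Ck_on_bounded_linear:
  assumes "bounded_linear L" "open U" shows "Ck_on k L U"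
proof (cases k)
  case 0 then show ?thesis using assms by (simp add: linear_continuous_on)
next
  case (Suc j)
  show ?thesis unfolding Suc
    by (rule Ck_on_SucI[where D="\<lambda>x. L"])
      (use assms in \<open>auto intro: bounded_linear_imp_has_derivative\<close>)
qed

lemma Ck_on_compose_linear:
  assumes "bounded_linear L" "Ck_on k f U" "open U"
  shows "Ck_on k (\<lambda>x. L (f x)) U"
  using assms(2)
proof (induction k arbitrary: f)
  case 0
  then show ?case using assms(1) by (simp add: bounded_linear.continuous_on)
next
  case (Suc k)
  show ?case
    by (rule Ck_on_SucI[where D="\<lambda>x v. L (frechet_derivative f (at x) v)"])
      (use Suc assms Ck_on_SucD[OF Suc.prems] in \<open>auto intro: bounded_linear.has_derivative\<close>)
qed

lemma Ck_on_add:
  assumes "Ck_on k f U" "Ck_on k h U" "open U"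
  shows "Ck_on k (\<lambda>x. f x + h x) U"
  using assms(1,2)
proof (induction k arbitrary: f h)
  case 0
  then show ?case by (auto intro: continuous_on_add)
next
  case (Suc k)
  show ?case
  proof (rule Ck_on_SucI)
    show "((\<lambda>x. f x + h x) has_derivative
        (\<lambda>v. frechet_derivative f (at x) v + frechet_derivative h (at x) v)) (at x)" if "x \<in> U" for x
      by (rule has_derivative_add[OF Ck_on_SucD[OF Suc.prems(1) that] Ck_on_SucD[OF Suc.prems(2) that]])
    show "Ck_on k (\<lambda>x. frechet_derivative f (at x) v + frechet_derivative h (at x) v) U" for v
      using Suc by simp
  qed fact
qed

lemma Ck_on_bilinear:
  assumes "bounded_bilinear B" "Ck_on k f U" "Ck_on k h U" "open U"
  shows "Ck_on k (\<lambda>x. B (f x) (h x)) U"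
  using assms(2,3)
proof (induction k arbitrary: f h)
  case 0
  then show ?case using bounded_bilinear.continuous_on[OF assms(1)] by simp
next
  case (Suc k)
  show ?case
  proof (rule Ck_on_SucI)
    show "((\<lambda>x. B (f x) (h x)) has_derivative
        (\<lambda>v. B (f x) (frechet_derivative h (at x) v) + B (frechet_derivative f (at x) v) (h x))) (at x)"
      if "x \<in> U" for x
      by (rule bounded_bilinear.FDERIV[OF assms(1) Ck_on_SucD[OF Suc.prems(1) that] Ck_on_SucD[OF Suc.prems(2) that]])
    show "Ck_on k (\<lambda>x. B (f x) (frechet_derivative h (at x) v) + B (frechet_derivative f (at x) v) (h x)) U" for v
      using Suc.prems Ck_on_Suc_imp[OF Suc.prems(1)] Ck_on_Suc_imp[OF Suc.prems(2)]
      by (intro Ck_on_add Suc.IH assms(4)) simp_all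
  qed fact
qed

lemmas Ck_on_scaleR = Ck_on_bilinear[OF bounded_bilinear_scaleR]
lemmas Ck_on_mult = Ck_on_bilinear[OF bounded_bilinear_mult]
lemmas Ck_on_inner = Ck_on_bilinear[OF bounded_bilinear_inner]

lemma Ck_on_minus:
  assumes "Ck_on k f U" "open U" shows "Ck_on k (\<lambda>x. - f x) U"
  using Ck_on_compose_linear[OF bounded_linear_minus[OF bounded_linear_ident] assms] .

lemma Ck_on_diff:
  assumes "Ck_on k f U" "Ck_on k h U" "open U"
  shows "Ck_on k (\<lambda>x. f x - h x) U"
  using Ck_on_add[OF assms(1) Ck_on_minus[OF assms(2,3)] assms(3)] by simp

lemma Ck_on_sum:
  assumes "\<And>i. i \<in> I \<Longrightarrow> Ck_on k (f i) U" "open U"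
  shows "Ck_on k (\<lambda>x. \<Sum>i\<in>I. f i x) U"
  using assms(1)
  by (induction I rule: infinite_finite_induct) (auto intro!: Ck_on_add assms(2))

lemma Ck_on_Pair:
  assumes "Ck_on k f U" "Ck_on k h U" "open U"
  shows "Ck_on k (\<lambda>x. (f x, h x)) U"
proof -
  have "Ck_on k (\<lambda>x. (f x, 0) + (0, h x)) U"
    by (intro Ck_on_add Ck_on_compose_linear[OF _ assms(1)] Ck_on_compose_linear[OF _ assms(2)] assms(3)
      bounded_linear_Pair bounded_linear_ident bounded_linear_zero)
  then show ?thesis by simp
qed

text \<open>Removes joint regularity in point and direction: for a map that is linear in
  \<open>v\<close>, only the finitely many functions with \<open>v\<close> in \<open>Basis\<close>
  have to be examined. It is used in this way for Frechet derivatives, Christoffel symbols and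
  differentials of transition maps.\<close>

lemma linear_expand:
  fixes D :: "'b::euclidean_space \<Rightarrow> 'c::real_vector"
  assumes "linear D"
  shows "D v = (\<Sum>b\<in>Basis. (v \<bullet> b) *\<^sub>R D b)"
proof -
  have "D (\<Sum>b\<in>Basis. (v \<bullet> b) *\<^sub>R b) = (\<Sum>b\<in>Basis. D ((v \<bullet> b) *\<^sub>R b))"
    by (rule linear_sum[OF assms])
  also have "\<dots> = (\<Sum>b\<in>Basis. (v \<bullet> b) *\<^sub>R D b)"
    by (intro sum.cong refl linear_scale[OF assms])
  finally show ?thesis unfolding euclidean_representation .
qed

text \<open>In the chain rule the direction \<open>frechet_derivative y (at x) v\<close> moves with
  \<open>x\<close>, while the induction hypothesis covers derivatives of \<open>f\<close> in fixed
  directions. Expanding the direction in \<open>Basis\<close> separates the two.\<close>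

lemma Ck_on_compose:
  fixes f :: "'b::euclidean_space \<Rightarrow> 'c::real_normed_vector" and y :: "'a::euclidean_space \<Rightarrow> 'b"
  assumes "Ck_on k f V" "Ck_on k y U" "y ` U \<subseteq> V" "open U"
  shows "Ck_on k (\<lambda>x. f (y x)) U"
  using assms(1,2)
proof (induction k arbitrary: f)
  case 0
  then show ?case using assms(3) by (auto intro: continuous_on_compose2)
next
  case (Suc k)
  show ?case
  proof (rule Ck_on_SucI)
    fix x assume "x \<in> U"
    have Df: "(f has_derivative frechet_derivative f (at (y x))) (at (y x))"
      using Ck_on_SucD[OF Suc.prems(1)] \<open>x \<in> U\<close> assms(3) by blast
    have "((\<lambda>x. f (y x)) has_derivative (\<lambda>v. frechet_derivative f (at (y x)) (frechet_derivative y (at x) v))) (at x)"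
      by (rule has_derivative_compose[OF Ck_on_SucD[OF Suc.prems(2) \<open>x \<in> U\<close>] Df])
    then show "((\<lambda>x. f (y x)) has_derivative
        (\<lambda>v. \<Sum>b\<in>Basis. (frechet_derivative y (at x) v \<bullet> b) *\<^sub>R frechet_derivative f (at (y x)) b)) (at x)"
      by (rule has_derivative_eq_rhs) (rule ext, rule linear_expand[OF has_derivative_linear[OF Df]])
  next
    show "Ck_on k (\<lambda>x. \<Sum>b\<in>Basis. (frechet_derivative y (at x) v \<bullet> b) *\<^sub>R frechet_derivative f (at (y x)) b) U" for v
      using Suc.prems Ck_on_Suc_imp[OF Suc.prems(2)] assms(4)
      by (intro Ck_on_sum Ck_on_scaleR Ck_on_inner Suc.IH assms(4) Ck_on_const) simp_all
  qed fact
qed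

text \<open>\<open>F y\<close> is O(|y - x|) and \<open>s y\<close> tends to 0, so the product is
  o(|y - x|). As \<open>s\<close> is merely continuous, this applies to a solution of a linear
  system whose differentiability is still to be shown.\<close>

lemma has_derivative_scaleR_zero:
  assumes "isCont s x" "s x = 0" "(F has_derivative F') (at x)" "F x = 0"
  shows "((\<lambda>y. s y *\<^sub>R F y) has_derivative (\<lambda>v. 0)) (at x)"
proof -
  have bl: "bounded_linear F'" using assms(3) has_derivative_bounded_linear by blast
  then obtain K where K: "\<And>v. norm (F' v) \<le> norm v * K" using bounded_linear.bounded by blast
  have lim: "((\<lambda>y. norm (F y - F x - F' (y - x)) / norm (y - x)) \<longlongrightarrow> 0) (at x)"
    using assms(3) by (simp add: has_derivative_iff_norm)
  have s: "(s \<longlongrightarrow> 0) (at x)" using assms(1,2) by (simp add: isCont_def)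
  have "((\<lambda>y. \<bar>s y\<bar> * (norm (F y - F x - F' (y - x)) / norm (y - x) + K)) \<longlongrightarrow> \<bar>0\<bar> * (0 + K)) (at x)"
    by (intro tendsto_intros lim s)
  then have L: "((\<lambda>y. \<bar>s y\<bar> * (norm (F y - F x - F' (y - x)) / norm (y - x) + K)) \<longlongrightarrow> 0) (at x)" by simp
  have "((\<lambda>y. norm (s y *\<^sub>R F y - s x *\<^sub>R F x - 0) / norm (y - x)) \<longlongrightarrow> 0) (at x)"
  proof (rule Lim_null_comparison[OF _ L], unfold eventually_at, intro exI[of _ 1] conjI ballI impI)
    fix y assume y: "y \<noteq> x \<and> dist y x < 1"
    have "norm (F y) \<le> norm (F y - F x - F' (y - x)) + norm (F' (y - x))"
      using norm_triangle_ineq[of "F y - F x - F' (y - x)" "F' (y-x)"] assms(4) by simp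
    also have "\<dots> \<le> norm (F y - F x - F' (y - x)) + norm (y - x) * K" using K by simp
    finally have "norm (F y) / norm (y - x) \<le> norm (F y - F x - F' (y - x)) / norm (y - x) + K"
      using y by (simp add: field_simps)
    then have "\<bar>s y\<bar> * (norm (F y) / norm (y - x)) \<le> \<bar>s y\<bar> * (norm (F y - F x - F' (y - x)) / norm (y - x) + K)"
      by (rule mult_left_mono) simp
    then show "norm (norm (s y *\<^sub>R F y - s x *\<^sub>R F x - 0) / norm (y - x)) \<le> \<bar>s y\<bar> * (norm (F y - F x - F' (y - x)) / norm (y - x) + K)"
      using assms(4) by simp
  qed simp
  then show ?thesis by (simp add: has_derivative_iff_norm)
qed

text \<open>Smooth dependence of the solution \<open>w\<close> of a regular linear system, without an explicit
  formula for the inverse: a solution of class \<open>C\<^sup>k\<close> has derivatives solving a system with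
  \<open>C\<^sup>k\<close> right-hand side.\<close>

lemma Ck_on_linear_solution:
  fixes G :: "'a::euclidean_space \<Rightarrow> 'b::euclidean_space \<Rightarrow> 'c::euclidean_space"
  assumes "open U" "\<And>x. x \<in> U \<Longrightarrow> linear (G x)" "\<And>x. x \<in> U \<Longrightarrow> inj (G x)"
    and dim: "DIM('b) = DIM('c)"
    and "\<And>b. Ck_on k (\<lambda>x. G x b) U" "Ck_on k h U"
    and "\<And>x. x \<in> U \<Longrightarrow> G x (w x) = h x"
  shows "Ck_on k w U"
  using assms(5-7)
proof (induction k arbitrary: w h)
  case 0
  have "continuous (at x) w" if x: "x \<in> U" for x
  proof -
    obtain c where c: "c > 0" "\<And>u. norm (G x u) \<ge> c * norm u"
      using linear_inj_bounded_below_pos[OF assms(2)[OF x] assms(3)[OF x]] by (metis mult.commute)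
    have cG: "continuous (at x) (\<lambda>y. G y u)" for u
      using 0(1) x \<open>open U\<close> by (simp add: continuous_on_eq_continuous_at)
    have "continuous (at x) h" using 0(2) x \<open>open U\<close> by (simp add: continuous_on_eq_continuous_at)
    then have "((\<lambda>y. (2/c) * norm (h y - G y (w x))) \<longlongrightarrow> (2/c) * norm (h x - G x (w x))) (at x)"
      using cG[of "w x"] by (intro tendsto_intros) (auto simp: isCont_def)
    then have lim: "((\<lambda>y. (2/c) * norm (h y - G y (w x))) \<longlongrightarrow> 0) (at x)" using 0(3)[OF x] by simp
    have "((\<lambda>y. \<Sum>b\<in>Basis. norm (G y b - G x b)) \<longlongrightarrow> (\<Sum>b\<in>Basis. norm (G x b - G x b))) (at x)"
      using cG by (intro tendsto_intros) (auto simp: isCont_def)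
    then have "((\<lambda>y. \<Sum>b\<in>Basis. norm (G y b - G x b)) \<longlongrightarrow> 0) (at x)" by simp
    then have ev: "\<forall>\<^sub>F y in at x. (\<Sum>b\<in>Basis. norm (G y b - G x b)) < c / 2"
      using c(1) by (intro order_tendstoD) auto
    have evU: "\<forall>\<^sub>F y in at x. y \<in> U" using x \<open>open U\<close> eventually_at_topological by blast
    have "((\<lambda>y. w y - w x) \<longlongrightarrow> 0) (at x)"
    proof (rule Lim_null_comparison[OF _ lim], rule eventually_mono[OF eventually_conj[OF ev evU]])
      fix y assume y: "(\<Sum>b\<in>Basis. norm (G y b - G x b)) < c / 2 \<and> y \<in> U"
      define u where "u = w y - w x"
      have "linear (\<lambda>u. G y u - G x u)" using assms(2) x y by (intro linear_compose_sub) auto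
      then have "norm (G y u - G x u) = norm (\<Sum>b\<in>Basis. (u \<bullet> b) *\<^sub>R (G y b - G x b))"
        using linear_expand[of "\<lambda>u. G y u - G x u" u] by simp
      also have "\<dots> \<le> (\<Sum>b\<in>Basis. norm ((u \<bullet> b) *\<^sub>R (G y b - G x b)))" by (rule norm_sum)
      also have "\<dots> \<le> (\<Sum>b\<in>Basis. norm u * norm (G y b - G x b))"
        by (intro sum_mono) (simp add: mult_right_mono Basis_le_norm)
      also have "\<dots> = norm u * (\<Sum>b\<in>Basis. norm (G y b - G x b))" by (rule sum_distrib_left[symmetric])
      also have "\<dots> \<le> norm u * (c/2)" using y by (intro mult_left_mono) auto
      finally have "c * norm u \<le> norm (G y u) + norm u * (c/2)"
        using c(2)[of u] norm_triangle_ineq2[of "G x u" "G y u"] by (simp add: norm_minus_commute)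
      then have "norm u \<le> (2/c) * norm (G y u)" using c(1) by (simp add: field_simps)
      moreover have "G y u = h y - G y (w x)"
        using assms(2)[of y] 0(3)[of y] y by (simp add: u_def linear_diff)
      ultimately show "norm (w y - w x) \<le> (2/c) * norm (h y - G y (w x))" by (simp add: u_def)
    qed
    then show ?thesis by (simp add: isCont_def Lim_null[of w])
  qed
  then show ?case by (simp add: continuous_at_imp_continuous_on)
next
  case (Suc k)
  have wk: "Ck_on k w U"
    using Suc.IH[of h w] Suc.prems Ck_on_Suc_imp by blast
  then have wc: "isCont w x" if "x \<in> U" for x
    using Ck_on_continuous that \<open>open U\<close> continuous_on_eq_continuous_at by blast
  define DG where "DG x b = frechet_derivative (\<lambda>y. G y b) (at x)" for x b
  \<comment> \<open>Differentiating \<open>G x (w x) = h x\<close> in direction \<open>v\<close>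
    shows that the derivative of \<open>w\<close> must be sent to \<open>E x v\<close> by
    \<open>G x\<close>. It is again the solution of a system with coefficients \<open>G\<close>,
    which is what the induction exploits.\<close>
  define E where "E x v = frechet_derivative h (at x) v - (\<Sum>b\<in>Basis. (w x \<bullet> b) *\<^sub>R DG x b v)" for x v
  have "\<exists>I. linear I \<and> (\<forall>u. I (G x u) = u) \<and> (\<forall>u. G x (I u) = u)" if x: "x \<in> U" for x
  proof -
    obtain I where I: "linear I" "I \<circ> G x = id"
      using linear_injective_left_inverse[OF assms(2)[OF x] assms(3)[OF x]] by blast
    have "surj (G x)"
      using linear_injective_imp_surjective[OF assms(2)[OF that] assms(3)[OF that]] dim by simp
    then have "G x (I u) = u" for u using I(2) by (metis comp_apply id_apply surjD)
    with I show ?thesis by (metis comp_apply id_apply)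
  qed
  then obtain I where linI: "\<And>x. x \<in> U \<Longrightarrow> linear (I x)"
    and IG: "\<And>x u. x \<in> U \<Longrightarrow> I x (G x u) = u" and GI: "\<And>x u. x \<in> U \<Longrightarrow> G x (I x u) = u"
    by metis
  show ?case
  proof (rule Ck_on_SucI[where D="\<lambda>x v. I x (E x v)"])
    fix x assume x: "x \<in> U"
    have dG: "((\<lambda>y. G y b) has_derivative DG x b) (at x)" for b
      using Ck_on_SucD[OF Suc.prems(1) x] unfolding DG_def .
    have bl: "bounded_linear (I x)" using linI[OF x] by (rule linear_linear[THEN iffD2])
    have d1: "((\<lambda>y. h y - (\<Sum>b\<in>Basis. (w x \<bullet> b) *\<^sub>R G y b)) has_derivative E x) (at x)"
      unfolding E_def by (intro has_derivative_diff has_derivative_sum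
        bounded_linear.has_derivative[OF bounded_linear_scaleR_right dG] Ck_on_SucD[OF Suc.prems(2) x])
    have d2: "((\<lambda>y. \<Sum>b\<in>Basis. ((w y - w x) \<bullet> b) *\<^sub>R (G y b - G x b)) has_derivative (\<lambda>v. \<Sum>b\<in>(Basis::'b set). 0)) (at x)"
      using has_derivative_diff[OF dG has_derivative_const]
      by (intro has_derivative_sum has_derivative_scaleR_zero[where F="\<lambda>y. G y _ - G x _"])
        (use wc[OF x] in \<open>auto intro!: continuous_intros\<close>)
    \<comment> \<open>This expression is \<open>w y\<close> rewritten so that \<open>w\<close>
      enters only through the components of \<open>w y - w x\<close>, each multiplied by
      \<open>G y b - G x b\<close>; such products have derivative zero at \<open>x\<close>.\<close>
    have "((\<lambda>y. w x + I x ((h y - (\<Sum>b\<in>Basis. (w x \<bullet> b) *\<^sub>R G y b)) -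
        (\<Sum>b\<in>Basis. ((w y - w x) \<bullet> b) *\<^sub>R (G y b - G x b)))) has_derivative (\<lambda>v. 0 + I x (E x v - (\<Sum>b\<in>(Basis::'b set). 0)))) (at x)"
      by (intro has_derivative_add has_derivative_const bounded_linear.has_derivative[OF bl] has_derivative_diff[OF d1 d2])
    then have "((\<lambda>y. w x + I x ((h y - (\<Sum>b\<in>Basis. (w x \<bullet> b) *\<^sub>R G y b)) -
        (\<Sum>b\<in>Basis. ((w y - w x) \<bullet> b) *\<^sub>R (G y b - G x b)))) has_derivative (\<lambda>v. I x (E x v))) (at x)" by simp
    then show "(w has_derivative (\<lambda>v. I x (E x v))) (at x)"
    proof (rule has_derivative_transform_within_open[OF _ \<open>open U\<close> x])
      fix y assume y: "y \<in> U"
      have "(\<Sum>b\<in>Basis. (w x \<bullet> b) *\<^sub>R G y b) = G y (w x)"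
        by (rule linear_expand[OF assms(2)[OF y], symmetric])
      moreover have "(\<Sum>b\<in>Basis. ((w y - w x) \<bullet> b) *\<^sub>R (G y b - G x b)) = G y (w y - w x) - G x (w y - w x)"
        using linear_expand[OF linear_compose_sub[OF assms(2)[OF y] assms(2)[OF x]], of "w y - w x"] by simp
      moreover have "G y (w y - w x) = h y - G y (w x)"
        using linear_diff[OF assms(2)[OF y]] Suc.prems(3)[OF y] by simp
      ultimately show "w x + I x ((h y - (\<Sum>b\<in>Basis. (w x \<bullet> b) *\<^sub>R G y b)) -
        (\<Sum>b\<in>Basis. ((w y - w x) \<bullet> b) *\<^sub>R (G y b - G x b))) = w y"
        using IG[OF x] by simp
    qed
  next
    fix v
    have "Ck_on k (\<lambda>x. E x v) U"
      unfolding E_def DG_def using wk Suc.prems assms(1)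
      by (intro Ck_on_diff Ck_on_sum Ck_on_scaleR Ck_on_inner Ck_on_const) simp_all
    moreover have "Ck_on k (\<lambda>x. G x b) U" for b using Suc.prems(1) Ck_on_Suc_imp by blast
    ultimately show "Ck_on k (\<lambda>x. I x (E x v)) U"
      using Suc.IH[of "\<lambda>x. E x v" "\<lambda>x. I x (E x v)"] GI by blast
  qed fact
qed

text \<open>The second difference is the increment over \<open>[0, h]\<close> of a first difference
  in direction \<open>w\<close>, taken as a function of the step along \<open>v\<close>. The mean
  value theorem is applied to it and then to the derivative along \<open>v\<close>. The bound on
  \<open>h\<close> keeps the parallelogram inside the ball.\<close>

lemma second_difference_mvt:
  fixes f :: "'a::euclidean_space \<Rightarrow> real"
  assumes "Ck_on (Suc (Suc 0)) f (ball x r)" and h: "0 < h" "h * (norm v + norm w) < r"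
  obtains y where "dist x y < r"
    "f (x + h *\<^sub>R v + h *\<^sub>R w) - f (x + h *\<^sub>R v) - (f (x + h *\<^sub>R w) - f x)
       = h * (h * frechet_derivative (\<lambda>y. frechet_derivative f (at y) v) (at y) w)"
proof -
  define D where "D y = frechet_derivative f (at y)" for y
  define D2 where "D2 y = frechet_derivative (\<lambda>y. D y v) (at y)" for y
  have D: "(f has_derivative D y) (at y)" if "y \<in> ball x r" for y
    using Ck_on_SucD[OF assms(1) that] unfolding D_def .
  have "Ck_on (Suc 0) (\<lambda>y. D y v) (ball x r)" using assms(1) unfolding D_def by simp
  from Ck_on_SucD[OF this] have D2: "((\<lambda>y. D y v) has_derivative D2 y) (at y)" if "y \<in> ball x r" for y
    using that unfolding D2_def .
  have inb: "x + s *\<^sub>R v + t *\<^sub>R w \<in> ball x r" if "0 \<le> s" "s \<le> h" "0 \<le> t" "t \<le> h" for s t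
  proof -
    have "norm (s *\<^sub>R v + t *\<^sub>R w) \<le> s * norm v + t * norm w"
      using norm_triangle_ineq[of "s *\<^sub>R v" "t *\<^sub>R w"] that by simp
    also have "\<dots> \<le> h * norm v + h * norm w" using that by (intro add_mono mult_right_mono) auto
    finally have "norm (s *\<^sub>R v + t *\<^sub>R w) < r" using h by (simp add: algebra_simps)
    moreover have "dist x (x + s *\<^sub>R v + t *\<^sub>R w) = norm (s *\<^sub>R v + t *\<^sub>R w)"
      using dist_add_cancel[of x 0 "s *\<^sub>R v + t *\<^sub>R w"] by (simp add: add.assoc)
    ultimately show ?thesis by simp
  qed
  have derv: "DERIV (\<lambda>s. f (x + s *\<^sub>R v + t *\<^sub>R w)) s :> D (x + s *\<^sub>R v + t *\<^sub>R w) v"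
    if "0 \<le> s" "s \<le> h" "0 \<le> t" "t \<le> h" for s t
  proof -
    have "((\<lambda>s. x + s *\<^sub>R v + t *\<^sub>R w) has_derivative (\<lambda>s. s *\<^sub>R v)) (at s)"
      by (auto intro!: derivative_eq_intros)
    from has_derivative_compose[OF this D[OF inb[OF that]]]
    show ?thesis
      using linear_scale[OF has_derivative_linear[OF D[OF inb[OF that]]]]
      by (simp add: has_field_derivative_def mult_commute_abs)
  qed
  have "DERIV (\<lambda>s. f (x + s *\<^sub>R v + h *\<^sub>R w) - f (x + s *\<^sub>R v + 0 *\<^sub>R w)) s
     :> D (x + s *\<^sub>R v + h *\<^sub>R w) v - D (x + s *\<^sub>R v + 0 *\<^sub>R w) v" if "0 \<le> s" "s \<le> h" for s
    by (intro DERIV_diff derv) (use that h in auto)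
  from MVT2[OF h(1) this] obtain s where s: "0 < s" "s < h"
    and eq1: "f (x + h *\<^sub>R v + h *\<^sub>R w) - f (x + h *\<^sub>R v) - (f (x + h *\<^sub>R w) - f x)
      = h * (D (x + s *\<^sub>R v + h *\<^sub>R w) v - D (x + s *\<^sub>R v) v)" by auto
  have "DERIV (\<lambda>t. D (x + s *\<^sub>R v + t *\<^sub>R w) v) t :> D2 (x + s *\<^sub>R v + t *\<^sub>R w) w"
    if "0 \<le> t" "t \<le> h" for t
  proof -
    have inb': "x + s *\<^sub>R v + t *\<^sub>R w \<in> ball x r" using that s by (intro inb) auto
    have "((\<lambda>t. x + s *\<^sub>R v + t *\<^sub>R w) has_derivative (\<lambda>t. t *\<^sub>R w)) (at t)"
      by (auto intro!: derivative_eq_intros)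
    from has_derivative_compose[OF this D2[OF inb']]
    show ?thesis
      using linear_scale[OF has_derivative_linear[OF D2[OF inb']]]
      by (simp add: has_field_derivative_def mult_commute_abs)
  qed
  from MVT2[OF h(1) this] obtain t where t: "0 < t" "t < h"
    and eq2: "D (x + s *\<^sub>R v + h *\<^sub>R w) v - D (x + s *\<^sub>R v) v = h * D2 (x + s *\<^sub>R v + t *\<^sub>R w) w" by auto
  show ?thesis
    by (rule that[of "x + s *\<^sub>R v + t *\<^sub>R w"])
      (use inb[of s t] s t eq1 eq2 in \<open>auto simp: D2_def D_def\<close>)
qed

text \<open>The second difference is symmetric in \<open>v\<close> and \<open>w\<close>, so in each
  small parallelogram the two mixed derivatives take a common value, at two possibly different
  points. Continuity carries the equality to \<open>x\<close>.\<close>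

lemma symmetric_second_derivative_real:
  fixes f :: "'a::euclidean_space \<Rightarrow> real"
  assumes "Ck_on (Suc (Suc 0)) f U" "open U" "x \<in> U"
  shows "frechet_derivative (\<lambda>y. frechet_derivative f (at y) v) (at x) w
       = frechet_derivative (\<lambda>y. frechet_derivative f (at y) w) (at x) v"
proof -
  define H where "H v w y = frechet_derivative (\<lambda>y. frechet_derivative f (at y) v) (at y) w" for v w y
  have cont: "isCont (H v w) x" for v w
    using assms continuous_on_eq_continuous_at[OF assms(2), of "H v w"] by (simp add: H_def)
  have "\<bar>H v w x - H w v x\<bar> < 2 * e" if "e > 0" for e
  proof -
    obtain d1 where d1: "d1 > 0" "\<And>y. dist y x < d1 \<Longrightarrow> \<bar>H v w y - H v w x\<bar> < e"
      using cont[of v w] \<open>e > 0\<close> unfolding continuous_at_eps_delta dist_real_def by meson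
    obtain d2 where d2: "d2 > 0" "\<And>y. dist y x < d2 \<Longrightarrow> \<bar>H w v y - H w v x\<bar> < e"
      using cont[of w v] \<open>e > 0\<close> unfolding continuous_at_eps_delta dist_real_def by meson
    obtain d3 where d3: "d3 > 0" "ball x d3 \<subseteq> U" using assms(2,3) openE by blast
    define r where "r = min d1 (min d2 d3)"
    have r: "r > 0" "ball x r \<subseteq> U" using d1 d2 d3 by (auto simp: r_def)
    \<comment> \<open>The summand 1 keeps the denominator positive when \<open>v\<close> and
      \<open>w\<close> both vanish.\<close>
    define h where "h = r / (2 * (norm v + norm w + 1))"
    have N: "norm v + norm w + 1 > 0" using norm_ge_zero[of v] norm_ge_zero[of w] by linarith
    have h: "h > 0" using r N by (simp add: h_def)
    have "h * (norm v + norm w) \<le> h * (norm v + norm w + 1)" using h by (intro mult_left_mono) auto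
    also have "\<dots> = r / 2" using N unfolding h_def by (simp only: times_divide_eq_left) (simp add: divide_simps)
    finally have hr: "h * (norm v + norm w) < r" using r by simp
    have C: "Ck_on (Suc (Suc 0)) f (ball x r)" using Ck_on_subset[OF assms(1) r(2)] .
    obtain y1 where y1: "dist x y1 < r"
      "f (x + h *\<^sub>R v + h *\<^sub>R w) - f (x + h *\<^sub>R v) - (f (x + h *\<^sub>R w) - f x) = h * (h * H v w y1)"
      using second_difference_mvt[OF C h hr] unfolding H_def by blast
    have hr': "h * (norm w + norm v) < r" using hr by (simp add: add.commute)
    obtain y2 where y2: "dist x y2 < r"
      "f (x + h *\<^sub>R w + h *\<^sub>R v) - f (x + h *\<^sub>R w) - (f (x + h *\<^sub>R v) - f x) = h * (h * H w v y2)"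
      using second_difference_mvt[OF C h hr'] unfolding H_def by blast
    have "x + h *\<^sub>R w + h *\<^sub>R v = x + h *\<^sub>R v + h *\<^sub>R w" by simp
    with y1(2) y2(2) have "h * (h * H v w y1) = h * (h * H w v y2)" by (simp add: algebra_simps)
    then have "H v w y1 = H w v y2" using h by simp
    moreover have "\<bar>H v w y1 - H v w x\<bar> < e" "\<bar>H w v y2 - H w v x\<bar> < e"
      using y1(1) y2(1) by (auto intro!: d1(2) d2(2) simp: r_def dist_commute)
    ultimately show ?thesis by linarith
  qed
  then have "\<bar>H v w x - H w v x\<bar> \<le> 0 + e" if "e > 0" for e
    using that[THEN half_gt_zero] by fastforce
  then have "\<bar>H v w x - H w v x\<bar> \<le> 0" by (rule field_le_epsilon)
  then show ?thesis by (simp add: H_def)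
qed

lemma frechet_derivative_inner:
  assumes "f differentiable (at x)"
  shows "frechet_derivative (\<lambda>y. f y \<bullet> b) (at x) v = frechet_derivative f (at x) v \<bullet> b"
  using frechet_derivative_at[OF has_derivative_inner_left[OF frechet_derivative_works[THEN iffD1, OF assms]], of b]
  by metis

lemma symmetric_second_derivative:
  fixes f :: "'a::euclidean_space \<Rightarrow> 'b::euclidean_space"
  assumes "Ck_on (Suc (Suc 0)) f U" "open U" "x \<in> U"
  shows "frechet_derivative (\<lambda>y. frechet_derivative f (at y) v) (at x) w
       = frechet_derivative (\<lambda>y. frechet_derivative f (at y) w) (at x) v"
proof (rule euclidean_eqI)
  fix b :: 'b assume "b \<in> Basis"
  have d: "f differentiable (at y)" "(\<lambda>y. frechet_derivative f (at y) v) differentiable (at y)" if "y \<in> U" for y v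
    using assms(1) that by auto
  have "frechet_derivative (\<lambda>y. frechet_derivative (\<lambda>y. f y \<bullet> b) (at y) v) (at x) w
      = frechet_derivative (\<lambda>y. frechet_derivative f (at y) v) (at x) w \<bullet> b" for v w
    using frechet_derivative_cong_open[OF assms(2,3), of "\<lambda>y. frechet_derivative (\<lambda>y. f y \<bullet> b) (at y) v"
        "\<lambda>y. frechet_derivative f (at y) v \<bullet> b"]
    by (simp add: d frechet_derivative_inner assms(3))
  moreover have "Ck_on (Suc (Suc 0)) (\<lambda>y. f y \<bullet> b) U"
    by (intro Ck_on_inner assms Ck_on_const)
  ultimately show "frechet_derivative (\<lambda>y. frechet_derivative f (at y) v) (at x) w \<bullet> b
       = frechet_derivative (\<lambda>y. frechet_derivative f (at y) w) (at x) v \<bullet> b"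
    using symmetric_second_derivative_real[of "\<lambda>y. f y \<bullet> b" U x v w] assms by simp
qed

section \<open>Ordinary differential equations\<close>

text \<open>The upper limits may be in either order, so that the Picard operator can start at any
  point of the interval.\<close>

lemma integral_increment_bound:
  fixes h :: "real \<Rightarrow> 'a::euclidean_space"
  assumes "continuous_on {a..b} h" "\<And>s. s \<in> {a..b} \<Longrightarrow> norm (h s) \<le> B" "p \<in> {a..b}" "q \<in> {a..b}"
  shows "norm (integral {a..p} h - integral {a..q} h) \<le> B * \<bar>p - q\<bar>"
proof -
  have "norm (integral {a..p} h - integral {a..q} h) \<le> B * norm (p - q)"
  proof (rule differentiable_bound[where S="{a..b}" and f'="\<lambda>s r. r *\<^sub>R h s"])
    show "((\<lambda>u. integral {a..u} h) has_derivative (\<lambda>r. r *\<^sub>R h s)) (at s within {a..b})"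
      if "s \<in> {a..b}" for s
      using integral_has_vector_derivative[OF assms(1) that] by (simp add: has_vector_derivative_def)
    show "onorm (\<lambda>r. r *\<^sub>R h s) \<le> B" if "s \<in> {a..b}" for s
      using assms(2)[OF that] by (intro onorm_le) (simp add: mult.commute[of B] mult_left_mono)
  qed (use assms in auto)
  then show ?thesis by simp
qed

text \<open>Banach's fixed point theorem on the closed set of bounded continuous functions with
  values in the ball: \<open>B * (b - a) \<le> R\<close> keeps the Picard operator inside this set,
  and \<open>L * (b - a) < 1\<close> makes it a contraction.\<close>

lemma picard:
  fixes f :: "real \<Rightarrow> 'a::euclidean_space \<Rightarrow> 'a"
  assumes t0: "t0 \<in> {a..b}"
    and cont: "continuous_on ({a..b} \<times> cball x0 R) (\<lambda>(t, x). f t x)"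
    and lip: "\<And>t x y. t \<in> {a..b} \<Longrightarrow> x \<in> cball x0 R \<Longrightarrow> y \<in> cball x0 R \<Longrightarrow> norm (f t x - f t y) \<le> L * norm (x - y)"
    and bd: "\<And>t x. t \<in> {a..b} \<Longrightarrow> x \<in> cball x0 R \<Longrightarrow> norm (f t x) \<le> B"
    and R: "0 \<le> R" "B * (b - a) \<le> R" and L: "0 \<le> L" "L * (b - a) < 1"
  obtains x where "x t0 = x0" "\<And>t. t \<in> {a..b} \<Longrightarrow> x t \<in> cball x0 R"
    "\<And>t. t \<in> {a..b} \<Longrightarrow> (x has_vector_derivative f t (x t)) (at t within {a..b})"
proof -
  have ab: "a \<le> b" using t0 by simp
  have "norm (f t0 x0) \<le> B" using bd[OF t0, of x0] R(1) by simp
  then have B0: "0 \<le> B" by (rule order_trans[OF norm_ge_zero])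
  \<comment> \<open>Bounded continuous functions live on the whole line; clamping time to
    \<open>[a, b]\<close> continues each iterate by its boundary values.\<close>
  define cl where "cl t = max a (min b t)" for t
  have cl: "cl t \<in> {a..b}" "t \<in> {a..b} \<Longrightarrow> cl t = t" for t using ab by (auto simp: cl_def)
  have clc: "continuous_on UNIV cl" unfolding cl_def by (intro continuous_intros)
  define X where "X = PiC (UNIV :: real set) (\<lambda>_. cball x0 R)"
  have X: "x \<in> X \<longleftrightarrow> (\<forall>t. apply_bcontfun x t \<in> cball x0 R)" for x
    unfolding X_def by (auto simp: mem_PiC_iff)
  define g where "g x s = f s (apply_bcontfun x s)" for x :: "real \<Rightarrow>\<^sub>C 'a" and s
  have gc: "continuous_on {a..b} (g x)" if "x \<in> X" for x
  proof -
    have "continuous_on {a..b} (\<lambda>s. (s, apply_bcontfun x s))"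
      by (intro continuous_intros continuous_on_apply_bcontfun)
    moreover have "(\<lambda>s. (s, apply_bcontfun x s)) ` {a..b} \<subseteq> {a..b} \<times> cball x0 R" using that X by auto
    ultimately show ?thesis using continuous_on_compose2[OF cont] unfolding g_def by fastforce
  qed
  \<comment> \<open>The integral from \<open>t0\<close>, written as a difference of integrals from
    \<open>a\<close> so that it makes sense on both sides of \<open>t0\<close>.\<close>
  define F where "F x t = x0 + (integral {a..cl t} (g x) - integral {a..t0} (g x))" for x t
  have Fbd: "norm (F x t - x0) \<le> R" if "x \<in> X" for x t
  proof -
    have "norm (F x t - x0) \<le> B * \<bar>cl t - t0\<bar>"
      unfolding F_def using integral_increment_bound[OF gc[OF that] _ cl(1) t0, of B] bd that X by (auto simp: g_def)
    also have "\<dots> \<le> B * (b - a)" using cl(1)[of t] t0 B0 by (intro mult_left_mono) auto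
    finally show ?thesis using R by simp
  qed
  have Fc: "continuous_on UNIV (F x)" if "x \<in> X" for x
  proof -
    have "continuous_on {a..b} (\<lambda>u. integral {a..u} (g x))"
      by (intro indefinite_integral_continuous_1 integrable_continuous_real gc that)
    then have "continuous_on UNIV (\<lambda>t. integral {a..cl t} (g x))"
      using continuous_on_compose2[OF _ clc] cl by blast
    then show ?thesis unfolding F_def by (intro continuous_intros)
  qed
  have FX: "apply_bcontfun (Bcontfun (F x)) = F x" if "x \<in> X" for x
  proof (rule Bcontfun_inverse)
    have "norm (F x t) \<le> norm x0 + R" for t
      using norm_triangle_ineq[of "F x t - x0" x0] Fbd[OF that, of t] by simp
    then show "F x \<in> bcontfun" using Fc[OF that] by (intro bcontfun_normI) auto
  qed
  have lipF: "dist (F x t) (F y t) \<le> L * (b - a) * dist x y" if xy: "x \<in> X" "y \<in> X" for x y t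
  proof -
    have "F x t - F y t = (integral {a..cl t} (g x) - integral {a..cl t} (g y)) - (integral {a..t0} (g x) - integral {a..t0} (g y))"
      by (simp add: F_def)
    also have "\<dots> = integral {a..cl t} (\<lambda>s. g x s - g y s) - integral {a..t0} (\<lambda>s. g x s - g y s)"
      using cl(1)[of t] t0 gc[OF xy(1)] gc[OF xy(2)]
      by (subst (1 2) integral_diff) (auto intro!: integrable_continuous_real intro: continuous_on_subset)
    also have "norm \<dots> \<le> (L * dist x y) * \<bar>cl t - t0\<bar>"
    proof (rule integral_increment_bound[where b=b])
      show "continuous_on {a..b} (\<lambda>s. g x s - g y s)" by (intro continuous_intros gc xy)
      fix s assume "s \<in> {a..b}"
      then have "norm (g x s - g y s) \<le> L * dist (apply_bcontfun x s) (apply_bcontfun y s)"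
        using lip xy X by (auto simp: g_def dist_norm)
      also have "\<dots> \<le> L * dist x y" by (intro mult_left_mono dist_bounded L)
      finally show "norm (g x s - g y s) \<le> L * dist x y" .
    qed (use cl t0 in auto)
    also have "\<dots> \<le> (L * dist x y) * (b - a)" using cl(1)[of t] t0 L by (intro mult_left_mono) auto
    finally show ?thesis by (simp add: dist_norm mult_ac)
  qed
  have "\<exists>!x\<in>X. Bcontfun (F x) = x"
  proof (rule Banach_fix)
    have "closed X" unfolding X_def by (rule closed_PiC) simp
    then show "complete X" by (simp add: complete_eq_closed)
    have "const_bcontfun x0 \<in> X" using R by (simp add: X)
    then show "X \<noteq> {}" by blast
    show "(\<lambda>x. Bcontfun (F x)) ` X \<subseteq> X" using Fbd by (auto simp: X FX dist_norm norm_minus_commute)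
    show "dist (Bcontfun (F x)) (Bcontfun (F y)) \<le> L * (b - a) * dist x y" if "x \<in> X" "y \<in> X" for x y
      by (rule dist_bound) (simp add: FX that lipF)
    show "0 \<le> L * (b - a)" using L ab by simp
  qed fact
  then obtain x where x: "x \<in> X" "Bcontfun (F x) = x" by blast
  then have fixp: "apply_bcontfun x t = F x t" for t using FX by metis
  show ?thesis
  proof (rule that[of "apply_bcontfun x"])
    show "apply_bcontfun x t0 = x0" using cl t0 by (simp add: fixp F_def)
    show "apply_bcontfun x t \<in> cball x0 R" for t using x X by blast
    fix t assume t: "t \<in> {a..b}"
    have "((\<lambda>u. x0 + (integral {a..u} (g x) - integral {a..t0} (g x))) has_vector_derivative (0 + (g x t - 0))) (at t within {a..b})"
      by (intro has_vector_derivative_add has_vector_derivative_diff has_vector_derivative_const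
        integral_has_vector_derivative gc x t)
    then have "((\<lambda>u. x0 + (integral {a..u} (g x) - integral {a..t0} (g x))) has_vector_derivative g x t) (at t within {a..b})"
      by simp
    then show "(apply_bcontfun x has_vector_derivative f t (apply_bcontfun x t)) (at t within {a..b})"
      unfolding g_def[symmetric]
      by (rule has_vector_derivative_transform[OF t, rotated]) (use cl in \<open>auto simp: fixp F_def\<close>)
  qed
qed

text \<open>On the ball of radius \<open>norm x0\<close> around \<open>x0\<close> vectors have norm
  at most \<open>2 * norm x0\<close>, so the right-hand side is at most
  \<open>K * (2 * norm x0)\<close>; the hypothesis \<open>K * (b - a) \<le> 1 / 2\<close> is then
  exactly what keeps the solution in the ball. The resulting factor 2 is the source of the uniform
  bounds on parallel transport.\<close>

lemma linear_ode:
  fixes A :: "real \<Rightarrow> 'a::euclidean_space \<Rightarrow> 'a"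
  assumes t0: "t0 \<in> {a..b}" and lin: "\<And>t. t \<in> {a..b} \<Longrightarrow> linear (A t)"
    and cont: "\<And>v. v \<in> Basis \<Longrightarrow> continuous_on {a..b} (\<lambda>t. A t v)"
    and K: "\<And>t v. t \<in> {a..b} \<Longrightarrow> norm (A t v) \<le> K * norm v" "K * (b - a) \<le> 1 / 2" "0 \<le> K"
  obtains x where "x t0 = x0" "\<And>t. t \<in> {a..b} \<Longrightarrow> norm (x t) \<le> 2 * norm x0"
    "\<And>t. t \<in> {a..b} \<Longrightarrow> (x has_vector_derivative A t (x t)) (at t within {a..b})"
proof (rule picard[OF t0, of x0 "norm x0" A K "K * (2 * norm x0)"])
  have "continuous_on ({a..b} \<times> cball x0 (norm x0)) (\<lambda>z. \<Sum>v\<in>Basis. (snd z \<bullet> v) *\<^sub>R A (fst z) v)"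
    by (intro continuous_intros continuous_on_compose2[OF cont]) auto
  then show "continuous_on ({a..b} \<times> cball x0 (norm x0)) (\<lambda>(t, x). A t x)"
    by (rule continuous_on_cong[THEN iffD1, OF refl, rotated])
      (auto simp: linear_expand[OF lin, symmetric])
  have nb: "norm x \<le> 2 * norm x0" if "x \<in> cball x0 (norm x0)" for x
    using that norm_triangle_ineq2[of x x0] by (simp add: dist_norm norm_minus_commute)
  show "norm (A t x - A t y) \<le> K * norm (x - y)" if "t \<in> {a..b}" for t x y
    using K(1)[OF that, of "x - y"] by (simp add: linear_diff[OF lin[OF that]])
  show "norm (A t x) \<le> K * (2 * norm x0)" if "t \<in> {a..b}" "x \<in> cball x0 (norm x0)" for t x
    using K(1)[OF that(1), of x] mult_left_mono[OF nb[OF that(2)] K(3)] by linarith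
  show "K * (2 * norm x0) * (b - a) \<le> norm x0"
    using mult_right_mono[OF K(2), of "2 * norm x0"] by (simp add: mult_ac)
  show "0 \<le> K" by fact
  show "K * (b - a) < 1" using K(2) by simp
  fix x assume *: "x t0 = x0" "\<And>t. t \<in> {a..b} \<Longrightarrow> x t \<in> cball x0 (norm x0)"
    "\<And>t. t \<in> {a..b} \<Longrightarrow> (x has_vector_derivative A t (x t)) (at t within {a..b})"
  show thesis by (rule that[of x]) (use * nb in auto)
qed auto

text \<open>The Lipschitz constant comes from the derivative on a closed ball. Smoothness is
  bootstrapped from the equation: if \<open>x\<close> is of class C^k then so is its derivative
  \<open>F (x t)\<close>, and \<open>x\<close> is of class C^(k+1).\<close>

lemma autonomous_ode:
  fixes F :: "'a::euclidean_space \<Rightarrow> 'a"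
  assumes "open U" "x0 \<in> U" and smooth: "\<And>k. Ck_on k F U"
  obtains e x where "e > 0" "x 0 = x0" "\<And>t. t \<in> {-e<..<e} \<Longrightarrow> x t \<in> U"
    "\<And>t. t \<in> {-e<..<e} \<Longrightarrow> (x has_vector_derivative F (x t)) (at t)"
    "\<And>k. Ck_on k x {-e<..<e}"
proof -
  obtain R where R: "R > 0" "cball x0 R \<subseteq> U" using assms(1,2) open_contains_cball by blast
  define DF where "DF x = frechet_derivative F (at x)" for x
  have D: "(F has_derivative DF x) (at x)" if "x \<in> U" for x
    using Ck_on_SucD[OF smooth that] unfolding DF_def .
  have DFc: "continuous_on (cball x0 R) (\<lambda>x. DF x b)" for b
    using smooth[of "Suc 0"] by (intro continuous_on_subset[OF _ R(2)]) (simp add: DF_def)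
  have "compact (F ` cball x0 R)"
    by (intro compact_continuous_image continuous_on_subset[OF Ck_on_continuous[OF smooth] R(2)]) auto
  then obtain B where B: "B > 0" "\<And>x. x \<in> cball x0 R \<Longrightarrow> norm (F x) \<le> B"
    using compact_imp_bounded[of "F ` cball x0 R"] unfolding bounded_pos by blast
  have "continuous_on (cball x0 R) (\<lambda>x. \<Sum>b\<in>Basis. norm (DF x b))"
    by (intro continuous_intros DFc)
  then have "compact ((\<lambda>x. \<Sum>b\<in>Basis. norm (DF x b)) ` cball x0 R)"
    by (intro compact_continuous_image) auto
  then obtain L where L: "L > 0" "\<And>x. x \<in> cball x0 R \<Longrightarrow> norm (\<Sum>b\<in>Basis. norm (DF x b)) \<le> L"
    using compact_imp_bounded[of "(\<lambda>x. \<Sum>b\<in>Basis. norm (DF x b)) ` cball x0 R"] unfolding bounded_pos by blast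
  have lip: "norm (F x - F y) \<le> L * norm (x - y)" if "x \<in> cball x0 R" "y \<in> cball x0 R" for x y
  proof (rule differentiable_bound[of "cball x0 R" F DF])
    fix z assume z: "z \<in> cball x0 R"
    show "(F has_derivative DF z) (at z within cball x0 R)" by (rule has_derivative_at_withinI, rule D) (use z R(2) in blast)
    show "onorm (DF z) \<le> L"
    proof (rule onorm_le)
      fix v
      have "linear (DF z)" using D[of z] z R(2) has_derivative_linear by blast
      then have "norm (DF z v) = norm (\<Sum>b\<in>Basis. (v \<bullet> b) *\<^sub>R DF z b)"
        by (subst linear_expand[of "DF z" v]) auto
      also have "\<dots> \<le> (\<Sum>b\<in>Basis. norm ((v \<bullet> b) *\<^sub>R DF z b))" by (rule norm_sum)
      also have "\<dots> \<le> (\<Sum>b\<in>Basis. norm (DF z b) * norm v)"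
        by (intro sum_mono) (simp add: mult.commute mult_right_mono Basis_le_norm)
      also have "\<dots> = (\<Sum>b\<in>Basis. norm (DF z b)) * norm v" by (rule sum_distrib_right[symmetric])
      also have "\<dots> \<le> L * norm v" using L(2)[OF z] by (intro mult_right_mono) auto
      finally show "norm (DF z v) \<le> L * norm v" .
    qed
  qed (use that in auto)
  \<comment> \<open>The interval has length \<open>2 * e\<close>: the first bound keeps the solution
    in the ball, the second gives the contraction factor
    \<open>L * (2 * e) \<le> 1 / 2\<close>.\<close>
  define e where "e = min (R / (2 * B)) (1 / (4 * L))"
  have e: "e > 0" "B * (2 * e) \<le> R" "L * (2 * e) < 1"
  proof -
    show "e > 0" using R B L by (simp add: e_def)
    have "e \<le> R / (2 * B)" "e \<le> 1 / (4 * L)" by (auto simp: e_def)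
    then show "B * (2 * e) \<le> R" "L * (2 * e) < 1" using B L by (auto simp: field_simps)
  qed
  obtain x where x: "x 0 = x0" "\<And>t. t \<in> {-e..e} \<Longrightarrow> x t \<in> cball x0 R"
    "\<And>t. t \<in> {-e..e} \<Longrightarrow> (x has_vector_derivative F (x t)) (at t within {-e..e})"
  proof (rule picard[of 0 "-e" e x0 R "\<lambda>t. F" L B])
    show "continuous_on ({- e..e} \<times> cball x0 R) (\<lambda>(t, x). F x)"
      unfolding case_prod_beta
      by (intro continuous_on_compose2[OF Ck_on_continuous[OF smooth[of 0]]] continuous_intros) (use R in auto)
  qed (use e lip R B L in auto)
  have xd: "(x has_vector_derivative F (x t)) (at t)" if "t \<in> {-e<..<e}" for t
    using x(3)[of t] that by (simp add: at_within_Icc_at)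
  have xU: "x t \<in> U" if "t \<in> {-e<..<e}" for t using x(2)[of t] R that by auto
  have "Ck_on k x {-e<..<e}" for k
  proof (induction k)
    case 0
    have "continuous_on {-e<..<e} x"
      using has_vector_derivative_continuous[OF xd] by (intro continuous_at_imp_continuous_on) blast
    then show ?case by simp
  next
    case (Suc k)
    show ?case
    proof (rule Ck_on_SucI)
      show "(x has_derivative (\<lambda>v. v *\<^sub>R F (x t))) (at t)" if "t \<in> {-e<..<e}" for t
        using xd[OF that] by (simp add: has_vector_derivative_def)
      show "Ck_on k (\<lambda>t. v *\<^sub>R F (x t)) {-e<..<e}" for v
        by (intro Ck_on_scaleR Ck_on_const Ck_on_compose[OF smooth Suc.IH]) (use xU in auto)
    qed simp
  qed
  with e(1) x(1) xU xd that show ?thesis by blast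
qed

section \<open>Charts and tangent vectors\<close>

locale charted_manifold =
  fixes M :: "('a, 'i, 'e::euclidean_space) atlas"
  assumes cover: "(\<Union>i\<in>idx M. cdom M i) = topspace (mtop M)"
    and openin_cdom: "\<And>i. i \<in> idx M \<Longrightarrow> openin (mtop M) (cdom M i)"
    and open_img: "\<And>i. i \<in> idx M \<Longrightarrow> open (cmap M i ` cdom M i)"
    and homeo: "\<And>i. i \<in> idx M \<Longrightarrow> homeomorphic_map (subtopology (mtop M) (cdom M i))
          (top_of_set (cmap M i ` cdom M i)) (cmap M i)"
    and smooth_transition: "\<And>i j. i \<in> idx M \<Longrightarrow> j \<in> idx M \<Longrightarrow>
          smooth_on (cmap M i ` (cdom M i \<inter> cdom M j)) (transition M i j)"
begin

abbreviation img where "img i \<equiv> cmap M i ` cdom M i"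
abbreviation overlap where "overlap i j \<equiv> cmap M i ` (cdom M i \<inter> cdom M j)"
abbreviation Dt where "Dt i j x \<equiv> frechet_derivative (transition M i j) (at x)"

lemma charts_atD: "i \<in> charts_at M p \<Longrightarrow> i \<in> idx M" "i \<in> charts_at M p \<Longrightarrow> p \<in> cdom M i"
  by (auto simp: charts_at_def)

lemma cdom_subset: "i \<in> idx M \<Longrightarrow> cdom M i \<subseteq> topspace (mtop M)"
  using cover by blast

lemma chart_exists: "p \<in> topspace (mtop M) \<Longrightarrow> \<exists>i. i \<in> charts_at M p"
  using cover by (auto simp: charts_at_def)

lemma charts_at_topspace: "i \<in> charts_at M p \<Longrightarrow> p \<in> topspace (mtop M)"
  using cdom_subset by (auto simp: charts_at_def)

lemma topspace_cdom: "i \<in> idx M \<Longrightarrow> topspace (subtopology (mtop M) (cdom M i)) = cdom M i"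
  using cdom_subset[of i] by auto

lemma inj_cmap: "i \<in> idx M \<Longrightarrow> inj_on (cmap M i) (cdom M i)"
  using homeomorphic_imp_injective_map[OF homeo] topspace_cdom by metis

lemma cinv_cmap [simp]: "i \<in> idx M \<Longrightarrow> p \<in> cdom M i \<Longrightarrow> cinv M i (cmap M i p) = p"
  by (simp add: cinv_def inv_into_f_f inj_cmap)

lemma cmap_cinv [simp]: "x \<in> img i \<Longrightarrow> cmap M i (cinv M i x) = x"
  by (simp add: cinv_def f_inv_into_f)

lemma cinv_in: "x \<in> img i \<Longrightarrow> cinv M i x \<in> cdom M i"
  by (simp add: cinv_def inv_into_into)

lemma overlapI: "p \<in> cdom M i \<Longrightarrow> p \<in> cdom M j \<Longrightarrow> cmap M i p \<in> overlap i j"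
  by blast

lemma cinv_overlap: "i \<in> idx M \<Longrightarrow> x \<in> overlap i j \<Longrightarrow> cinv M i x \<in> cdom M i \<inter> cdom M j"
  by auto

lemma continuous_cmap: "i \<in> idx M \<Longrightarrow> continuous_map (subtopology (mtop M) (cdom M i)) euclidean (cmap M i)"
  using homeomorphic_imp_continuous_map[OF homeo] continuous_map_into_fulltopology by blast

lemma continuous_cinv:
  assumes "i \<in> idx M" shows "continuous_map (top_of_set (img i)) (mtop M) (cinv M i)"
proof -
  obtain h where h: "homeomorphic_maps (subtopology (mtop M) (cdom M i)) (top_of_set (img i)) (cmap M i) h"
    using homeo[OF assms] homeomorphic_map_maps by blast
  then have "continuous_map (top_of_set (img i)) (mtop M) h"
    unfolding homeomorphic_maps_def using continuous_map_into_fulltopology by blast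
  then show ?thesis
  proof (rule continuous_map_eq)
    fix x assume "x \<in> topspace (top_of_set (img i))"
    then have x: "x \<in> img i" by simp
    then have "h x \<in> cdom M i" "cmap M i (h x) = x"
      using h topspace_cdom[OF assms] by (auto simp: homeomorphic_maps_def continuous_map_def)
    then show "h x = cinv M i x" using assms cinv_cmap by metis
  qed
qed

lemma open_cmap_image:
  assumes "i \<in> idx M" "openin (mtop M) V"
  shows "open (cmap M i ` (cdom M i \<inter> V))"
proof -
  have "openin (subtopology (mtop M) (cdom M i)) (cdom M i \<inter> V)"
    using assms(2) by (simp add: openin_subtopology_Int2)
  then have "openin (top_of_set (img i)) (cmap M i ` (cdom M i \<inter> V))"
    using homeomorphic_imp_open_map[OF homeo[OF assms(1)]] by (simp add: open_map_def)
  then show ?thesis using open_img[OF assms(1)] openin_open_trans by blast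
qed

lemma open_overlap: "i \<in> idx M \<Longrightarrow> j \<in> idx M \<Longrightarrow> open (overlap i j)"
  using open_cmap_image openin_cdom by blast

lemma openin_chart_preimage:
  assumes "i \<in> idx M" "open W" shows "openin (mtop M) {p \<in> cdom M i. cmap M i p \<in> W}"
proof -
  have "openin (subtopology (mtop M) (cdom M i)) {p \<in> topspace (subtopology (mtop M) (cdom M i)). cmap M i p \<in> W}"
    by (rule openin_continuous_map_preimage[OF continuous_cmap[OF assms(1)]]) (use assms(2) in simp)
  then show ?thesis
    unfolding topspace_cdom[OF assms(1)] using openin_cdom[OF assms(1)] openin_trans_full by blast
qed

lemma transition_in: "i \<in> idx M \<Longrightarrow> x \<in> overlap i j \<Longrightarrow> transition M i j x \<in> overlap j i"
  by (auto simp: transition_def)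

lemma transition_cmap: "i \<in> idx M \<Longrightarrow> p \<in> cdom M i \<Longrightarrow> transition M i j (cmap M i p) = cmap M j p"
  by (simp add: transition_def)

lemma Ck_transition: "i \<in> idx M \<Longrightarrow> j \<in> idx M \<Longrightarrow> Ck_on k (transition M i j) (overlap i j)"
  using smooth_transition smooth_on_open[OF open_overlap] by blast

lemma Dt_works:
  assumes "i \<in> idx M" "j \<in> idx M" "x \<in> overlap i j"
  shows "(transition M i j has_derivative Dt i j x) (at x)"
  using Ck_on_SucD[OF Ck_transition[OF assms(1,2)] assms(3)] .

lemma linear_Dt: "i \<in> idx M \<Longrightarrow> j \<in> idx M \<Longrightarrow> x \<in> overlap i j \<Longrightarrow> linear (Dt i j x)"
  using Dt_works has_derivative_linear by blast

lemma Dt_self: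
  assumes "i \<in> idx M" "x \<in> img i" shows "Dt i i x a = a"
proof -
  have "((\<lambda>x. x) has_derivative (\<lambda>a. a)) (at x)" by simp
  then have "(transition M i i has_derivative (\<lambda>a. a)) (at x)"
    by (rule has_derivative_transform_within_open[OF _ open_img[OF assms(1)] assms(2)])
      (auto simp: transition_def assms)
  from frechet_derivative_at[OF this] show ?thesis by metis
qed

text \<open>The chain rule on a triple overlap. It is what makes coordinates prescribed in a single
  chart extend to a consistent family, that is, to a tangent vector.\<close>

lemma Dt_cocycle:
  assumes "i \<in> idx M" "j \<in> idx M" "k \<in> idx M" "p \<in> cdom M i" "p \<in> cdom M j" "p \<in> cdom M k"
  shows "Dt j k (cmap M j p) (Dt i j (cmap M i p) a) = Dt i k (cmap M i p) a"
proof -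
  let ?U = "cmap M i ` (cdom M i \<inter> (cdom M j \<inter> cdom M k))"
  have U: "open ?U" "cmap M i p \<in> ?U"
    using assms by (auto intro!: open_cmap_image openin_cdom openin_Int)
  have "((\<lambda>x. transition M j k (transition M i j x)) has_derivative (\<lambda>a. Dt j k (cmap M j p) (Dt i j (cmap M i p) a))) (at (cmap M i p))"
    using has_derivative_compose[OF Dt_works[OF assms(1,2) overlapI[OF assms(4,5)]]]
      Dt_works[OF assms(2,3) overlapI[OF assms(5,6)]] assms by (simp add: transition_cmap)
  then have "(transition M i k has_derivative (\<lambda>a. Dt j k (cmap M j p) (Dt i j (cmap M i p) a))) (at (cmap M i p))"
    by (rule has_derivative_transform_within_open[OF _ U]) (use assms in \<open>auto simp: transition_cmap\<close>)
  from frechet_derivative_at[OF this] show ?thesis by metis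
qed

lemma Dt_inverse:
  assumes "i \<in> idx M" "j \<in> idx M" "p \<in> cdom M i" "p \<in> cdom M j"
  shows "Dt j i (cmap M j p) (Dt i j (cmap M i p) a) = a"
  using Dt_cocycle[OF assms(1,2,1,3,4,3)] Dt_self assms by simp

section \<open>Tangent vectors and their coordinates\<close>

lemma of_coords_at: "j \<in> charts_at M p \<Longrightarrow> of_coords M i p a j = Dt i j (cmap M i p) a"
  by (simp add: of_coords_def)

lemma of_coords_self: "i \<in> charts_at M p \<Longrightarrow> of_coords M i p a i = a"
  using Dt_self by (simp add: of_coords_def charts_at_def)

lemma tangentI:
  assumes "\<And>i j. i \<in> charts_at M p \<Longrightarrow> j \<in> charts_at M p \<Longrightarrow> v j = Dt i j (cmap M i p) (v i)"
    "\<And>i. i \<notin> charts_at M p \<Longrightarrow> v i = 0"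
  shows "v \<in> tangent_space M p"
  unfolding tangent_space_def using assms by blast

lemma tangent_outside: "v \<in> tangent_space M p \<Longrightarrow> i \<notin> charts_at M p \<Longrightarrow> v i = 0"
  unfolding tangent_space_def by blast

lemma of_coords_tangent:
  assumes "i \<in> charts_at M p" shows "of_coords M i p a \<in> tangent_space M p"
proof -
  have "of_coords M i p a k = Dt j k (cmap M j p) (of_coords M i p a j)"
    if "j \<in> charts_at M p" "k \<in> charts_at M p" for j k
    unfolding of_coords_at[OF that(1)] of_coords_at[OF that(2)]
    by (rule Dt_cocycle[symmetric]) (use that assms in \<open>simp_all add: charts_at_def\<close>)
  then show ?thesis by (rule tangentI) (simp_all add: of_coords_def)
qed

lemma linear_Dt_chart: "i \<in> charts_at M p \<Longrightarrow> j \<in> charts_at M p \<Longrightarrow> linear (Dt i j (cmap M i p))"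
  by (rule linear_Dt) (simp_all add: charts_at_def)

lemma tangent_component:
  "v \<in> tangent_space M p \<Longrightarrow> i \<in> charts_at M p \<Longrightarrow> j \<in> charts_at M p \<Longrightarrow> v j = Dt i j (cmap M i p) (v i)"
  unfolding tangent_space_def by blast

lemma of_coords_component:
  assumes "v \<in> tangent_space M p" "i \<in> charts_at M p" shows "of_coords M i p (v i) = v"
proof
  fix j show "of_coords M i p (v i) j = v j"
  proof (cases "j \<in> charts_at M p")
    case True
    then show ?thesis using tangent_component[OF assms True] by (simp only: of_coords_at)
  next
    case False
    then show ?thesis using tangent_outside[OF assms(1) False] by (simp add: of_coords_def)
  qed
qed

lemma tangent_eqI:
  assumes "u \<in> tangent_space M p" "v \<in> tangent_space M p" "i \<in> charts_at M p" "u i = v i"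
  shows "u = v"
  using of_coords_component[OF assms(1,3)] of_coords_component[OF assms(2,3)] unfolding assms(4) by (rule trans[OF sym])

lemma of_coords_linear:
  assumes "i \<in> charts_at M p"
  shows of_coords_add: "of_coords M i p (a + b) = of_coords M i p a + of_coords M i p b"
    and of_coords_scale: "of_coords M i p (r *\<^sub>R a) = tscale r (of_coords M i p a)"
    and of_coords_0: "of_coords M i p 0 = 0"
  using linear_add[OF linear_Dt_chart[OF assms]] linear_scale[OF linear_Dt_chart[OF assms]] linear_0[OF linear_Dt_chart[OF assms]]
  by (simp_all add: of_coords_def fun_eq_iff tscale_def)

lemma tangent_add:
  assumes "u \<in> tangent_space M p" "v \<in> tangent_space M p" shows "u + v \<in> tangent_space M p"
proof (rule tangentI)
  fix i j assume ij: "i \<in> charts_at M p" "j \<in> charts_at M p"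
  show "(u + v) j = Dt i j (cmap M i p) ((u + v) i)"
    using tangent_component[OF assms(1) ij] tangent_component[OF assms(2) ij] linear_add[OF linear_Dt_chart[OF ij]]
    by (simp only: plus_fun_apply)
qed (simp add: tangent_outside[OF assms(1)] tangent_outside[OF assms(2)])

lemma tangent_scale:
  assumes "u \<in> tangent_space M p" shows "tscale r u \<in> tangent_space M p"
proof (rule tangentI)
  fix i j assume ij: "i \<in> charts_at M p" "j \<in> charts_at M p"
  show "tscale r u j = Dt i j (cmap M i p) (tscale r u i)"
    using tangent_component[OF assms(1) ij] linear_scale[OF linear_Dt_chart[OF ij]]
    by (simp only: tscale_def)
qed (simp add: tangent_outside[OF assms] tscale_def)

lemma tangent_0: "0 \<in> tangent_space M p"
  by (rule tangentI) (use linear_0[OF linear_Dt_chart] in simp_all)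

end

section \<open>Levi-Civita connection\<close>

text \<open>Interpreted for the given manifold and, with prefix \<open>N\<close>, for its cone, so
  that connection, transport and projections are developed once for both.\<close>

locale pseudo_riemannian_manifold = charted_manifold M
  for M :: "('a, 'i, 'e::euclidean_space) atlas" +
  fixes g :: "('a, 'i, 'e) metric"
  assumes metric: "pseudo_riemannian M g"
begin

abbreviation mc where "mc \<equiv> metric_comp M g"
definition dm where "dm i x c a b = frechet_derivative (\<lambda>y. mc i y a b) (at x) c"
abbreviation Gam where "Gam \<equiv> christoffel M g"

context
  fixes p assumes p: "p \<in> topspace (mtop M)"
begin

lemma g_sym: "u \<in> tangent_space M p \<Longrightarrow> v \<in> tangent_space M p \<Longrightarrow> g p u v = g p v u"
  using metric p unfolding pseudo_riemannian_def by blast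

lemma g_add: "u \<in> tangent_space M p \<Longrightarrow> v \<in> tangent_space M p \<Longrightarrow> w \<in> tangent_space M p \<Longrightarrow>
    g p (u + v) w = g p u w + g p v w"
  using metric p unfolding pseudo_riemannian_def by blast

lemma g_scale: "u \<in> tangent_space M p \<Longrightarrow> v \<in> tangent_space M p \<Longrightarrow> g p (tscale r u) v = r * g p u v"
  using metric p unfolding pseudo_riemannian_def by blast

lemma g_nondegenerate: "u \<in> tangent_space M p \<Longrightarrow> (\<And>v. v \<in> tangent_space M p \<Longrightarrow> g p u v = 0) \<Longrightarrow> u = 0"
  using metric p unfolding pseudo_riemannian_def nondegenerate_on_def by blast

end

section \<open>The metric and its derivatives in a chart\<close>

lemma chart_point: "i \<in> idx M \<Longrightarrow> x \<in> img i \<Longrightarrow> i \<in> charts_at M (cinv M i x) \<and> cinv M i x \<in> topspace (mtop M)"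
  using cinv_in charts_at_topspace by (auto simp: charts_at_def)

lemma mc_g:
  assumes "i \<in> charts_at M p" "u \<in> tangent_space M p" "v \<in> tangent_space M p"
  shows "g p u v = mc i (cmap M i p) (u i) (v i)"
  using assms charts_atD[OF assms(1)] by (simp add: metric_comp_def of_coords_component)

lemma mc_bilinear:
  assumes "i \<in> idx M" "x \<in> img i"
  shows mc_sym: "mc i x a b = mc i x b a"
    and mc_add_left: "mc i x (a + a') b = mc i x a b + mc i x a' b"
    and mc_scale_left: "mc i x (r *\<^sub>R a) b = r * mc i x a b"
    and mc_add_right: "mc i x b (a + a') = mc i x b a + mc i x b a'"
    and mc_scale_right: "mc i x b (r *\<^sub>R a) = r * mc i x b a"
proof -
  have *: "i \<in> charts_at M (cinv M i x)" "cinv M i x \<in> topspace (mtop M)"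
    using chart_point[OF assms] by auto
  note of = of_coords_tangent[OF *(1)]
  show s: "mc i x a b = mc i x b a" for a b
    unfolding metric_comp_def by (rule g_sym[OF *(2) of of])
  show a: "mc i x (a + a') b = mc i x a b + mc i x a' b" for a a' b
    unfolding metric_comp_def of_coords_add[OF *(1)] by (rule g_add[OF *(2) of of of])
  show c: "mc i x (r *\<^sub>R a) b = r * mc i x a b" for r a b
    unfolding metric_comp_def of_coords_scale[OF *(1)] by (rule g_scale[OF *(2) of of])
  show "mc i x b (a + a') = mc i x b a + mc i x b a'" using a s by metis
  show "mc i x b (r *\<^sub>R a) = r * mc i x b a" using c s by metis
qed

lemma linear_mc_left: "i \<in> idx M \<Longrightarrow> x \<in> img i \<Longrightarrow> linear (\<lambda>a. mc i x a b)"
  by (auto intro!: linearI simp: mc_add_left mc_scale_left)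

lemma linear_mc_right: "i \<in> idx M \<Longrightarrow> x \<in> img i \<Longrightarrow> linear (\<lambda>b. mc i x a b)"
  by (auto intro!: linearI simp: mc_add_right mc_scale_right)

lemma mc_expand:
  assumes "i \<in> idx M" "x \<in> img i"
  shows "mc i x a b = (\<Sum>k\<in>Basis. \<Sum>l\<in>Basis. ((a \<bullet> k) * (b \<bullet> l)) * mc i x k l)"
proof -
  have "mc i x a b = (\<Sum>k\<in>Basis. (a \<bullet> k) *\<^sub>R mc i x k b)"
    by (rule linear_expand[OF linear_mc_left[OF assms]])
  also have "\<dots> = (\<Sum>k\<in>Basis. (a \<bullet> k) *\<^sub>R (\<Sum>l\<in>Basis. (b \<bullet> l) *\<^sub>R mc i x k l))"
    by (intro sum.cong refl arg_cong2[where f=scaleR] linear_expand[OF linear_mc_right[OF assms]])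
  finally show ?thesis by (simp add: sum_distrib_left mult.assoc)
qed

lemma mc_nondegenerate:
  assumes "i \<in> idx M" "x \<in> img i" "\<And>b. mc i x a b = 0" shows "a = 0"
proof -
  have *: "i \<in> charts_at M (cinv M i x)" "cinv M i x \<in> topspace (mtop M)"
    using chart_point[OF assms(1,2)] by auto
  have "of_coords M i (cinv M i x) a = 0"
  proof (rule g_nondegenerate[OF *(2) of_coords_tangent[OF *(1)]])
    fix v assume "v \<in> tangent_space M (cinv M i x)"
    with assms(3)[of "v i"] show "g (cinv M i x) (of_coords M i (cinv M i x) a) v = 0"
      by (simp add: metric_comp_def of_coords_component[OF _ *(1)])
  qed
  then show ?thesis using of_coords_self[OF *(1), of a] by simp
qed

lemma mc_eqI:
  assumes "i \<in> idx M" "x \<in> img i" "\<And>b. mc i x a b = mc i x a' b" shows "a = a'"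
proof -
  have "mc i x (a - a') b = 0" for b
    using linear_diff[OF linear_mc_left[OF assms(1,2)]] assms(3) by simp
  then show ?thesis using mc_nondegenerate[OF assms(1,2), of "a - a'"] by simp
qed

text \<open>\<open>G\<close> sends \<open>w\<close> to the coefficients of the functional that
  \<open>w\<close> represents. Nondegeneracy makes it injective, and a linear endomorphism of a
  finite-dimensional space is then surjective.\<close>

lemma mc_riesz:
  assumes "i \<in> idx M" "x \<in> img i" "linear l"
  shows "\<exists>w. \<forall>z. mc i x w z = l z"
proof -
  define G where "G w = (\<Sum>z\<in>Basis. mc i x w z *\<^sub>R z)" for w
  have lin: "linear G" unfolding G_def using mc_add_left[OF assms(1,2)] mc_scale_left[OF assms(1,2)]
    by (auto intro!: linearI simp: scaleR_add_left sum.distrib scaleR_sum_right)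
  have Gz: "G w \<bullet> z = mc i x w z" if "z \<in> Basis" for w z
    unfolding G_def using that by simp
  have inj: "inj G"
  proof (rule linear_injective_0[OF lin, THEN iffD2], intro allI impI)
    fix w assume "G w = 0"
    then have "mc i x w z = 0" if "z \<in> Basis" for z using Gz[OF that, of w] by simp
    then have "mc i x w b = 0" for b using linear_expand[OF linear_mc_right[OF assms(1,2)], of w b] by simp
    then show "w = 0" using mc_nondegenerate[OF assms(1,2)] by blast
  qed
  then obtain w where w: "G w = (\<Sum>z\<in>Basis. l z *\<^sub>R z)"
    using linear_injective_imp_surjective[OF lin] by (metis surjD)
  have "mc i x w z = l z" if "z \<in> Basis" for z
  proof -
    have "mc i x w z = (\<Sum>z\<in>Basis. l z *\<^sub>R z) \<bullet> z" using Gz[OF that, of w] w by simp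
    also have "\<dots> = l z" using that by simp
    finally show ?thesis .
  qed
  then have "mc i x w z = l z" for z
    using linear_expand[OF linear_mc_right[OF assms(1,2)], of w z] linear_expand[OF assms(3), of z] by simp
  then show ?thesis by blast
qed

lemma Ck_mc: "i \<in> idx M \<Longrightarrow> Ck_on k (\<lambda>y. mc i y a b) (img i)"
  using metric smooth_on_open[OF open_img] unfolding pseudo_riemannian_def by blast

lemma mc_deriv: "i \<in> idx M \<Longrightarrow> x \<in> img i \<Longrightarrow> ((\<lambda>y. mc i y a b) has_derivative (\<lambda>c. dm i x c a b)) (at x)"
  unfolding dm_def using Ck_on_SucD[OF Ck_mc] by blast

lemma dm_expand:
  assumes "i \<in> idx M" "x \<in> img i"
  shows "dm i x c a b = (\<Sum>k\<in>Basis. \<Sum>l\<in>Basis. ((a \<bullet> k) * (b \<bullet> l)) * dm i x c k l)"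
proof -
  have "((\<lambda>y. \<Sum>k\<in>Basis. \<Sum>l\<in>Basis. ((a \<bullet> k) * (b \<bullet> l)) * mc i y k l) has_derivative
     (\<lambda>c. \<Sum>k\<in>Basis. \<Sum>l\<in>Basis. ((a \<bullet> k) * (b \<bullet> l)) * dm i x c k l)) (at x)"
    by (intro has_derivative_sum has_derivative_mult_right mc_deriv assms)
  then have "((\<lambda>y. mc i y a b) has_derivative
     (\<lambda>c. \<Sum>k\<in>Basis. \<Sum>l\<in>Basis. ((a \<bullet> k) * (b \<bullet> l)) * dm i x c k l)) (at x)"
    by (rule has_derivative_transform_within_open[OF _ open_img[OF assms(1)] assms(2)])
      (rule mc_expand[OF assms(1), symmetric])
  from fun_cong[OF frechet_derivative_at[OF this], of c, symmetric] show ?thesis by (subst dm_def)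
qed

text \<open>The product rule with moving base point and moving arguments, obtained from the
  expansion in \<open>Basis\<close>, where only products of scalar functions remain. It yields both
  the transformation law of the derivatives of the metric and the constancy of inner products of
  parallel fields.\<close>

lemma mc_deriv_compose:
  assumes "i \<in> idx M" "X y \<in> img i" "(X has_derivative X') (at y)"
    "(A has_derivative A') (at y)" "(B has_derivative B') (at y)"
  shows "((\<lambda>y. mc i (X y) (A y) (B y)) has_derivative
     (\<lambda>v. dm i (X y) (X' v) (A y) (B y) + mc i (X y) (A' v) (B y) + mc i (X y) (A y) (B' v))) (at y)"
proof -
  have "((\<lambda>y. \<Sum>k\<in>Basis. \<Sum>l\<in>Basis. ((A y \<bullet> k) * (B y \<bullet> l)) * mc i (X y) k l) has_derivative
     (\<lambda>v. \<Sum>k\<in>Basis. \<Sum>l\<in>Basis. (A y \<bullet> k) * (B y \<bullet> l) * dm i (X y) (X' v) k l +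
        ((A y \<bullet> k) * (B' v \<bullet> l) + (A' v \<bullet> k) * (B y \<bullet> l)) * mc i (X y) k l)) (at y)"
    by (intro has_derivative_sum has_derivative_mult has_derivative_inner_left assms
        has_derivative_compose[OF assms(3) mc_deriv[OF assms(1,2)]])
  moreover have "(\<Sum>k\<in>Basis. \<Sum>l\<in>Basis. (A y \<bullet> k) * (B y \<bullet> l) * dm i (X y) (X' v) k l +
        ((A y \<bullet> k) * (B' v \<bullet> l) + (A' v \<bullet> k) * (B y \<bullet> l)) * mc i (X y) k l) =
     dm i (X y) (X' v) (A y) (B y) + mc i (X y) (A' v) (B y) + mc i (X y) (A y) (B' v)" for v
    unfolding dm_expand[OF assms(1,2), of "X' v" "A y" "B y"] mc_expand[OF assms(1,2), of "A y" "B' v"] mc_expand[OF assms(1,2), of "A' v" "B y"]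
    by (simp add: sum.distrib distrib_right)
  ultimately have D: "((\<lambda>y. \<Sum>k\<in>Basis. \<Sum>l\<in>Basis. ((A y \<bullet> k) * (B y \<bullet> l)) * mc i (X y) k l) has_derivative
     (\<lambda>v. dm i (X y) (X' v) (A y) (B y) + mc i (X y) (A' v) (B y) + mc i (X y) (A y) (B' v))) (at y)"
    by simp
  have "isCont X y" using assms(3) has_derivative_continuous by blast
  then have "\<forall>\<^sub>F z in at y. X z \<in> img i"
    using topological_tendstoD[OF _ open_img[OF assms(1)] assms(2)] by (simp add: isCont_def)
  then have "\<forall>\<^sub>F z in at y. (\<Sum>k\<in>Basis. \<Sum>l\<in>Basis. ((A z \<bullet> k) * (B z \<bullet> l)) * mc i (X z) k l) = mc i (X z) (A z) (B z)"
    by (rule eventually_mono) (rule mc_expand[OF assms(1), symmetric])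
  from has_derivative_transform_eventually[OF D this] show ?thesis
    using mc_expand[OF assms(1,2), of "A y" "B y"] by simp
qed

text \<open>The Christoffel symbols of the first kind as a trilinear map: the right-hand side of the
  equation defining \<open>christoffel\<close>, with \<open>z\<close> as test vector.\<close>

definition koszul where
  "koszul i x a b z = (dm i x a b z + dm i x b a z - dm i x z a b) / 2"

lemma linear_dm:
  assumes "i \<in> idx M" "x \<in> img i"
  shows "linear (\<lambda>c. dm i x c a b)" "linear (\<lambda>a. dm i x c a b)" "linear (\<lambda>b. dm i x c a b)"
proof -
  show "linear (\<lambda>c. dm i x c a b)" using mc_deriv[OF assms] has_derivative_linear by blast
  show "linear (\<lambda>a. dm i x c a b)" unfolding dm_expand[OF assms, of c _ b]
    by (auto intro!: linearI simp: inner_add_left distrib_right sum.distrib sum_distrib_left mult.assoc)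
  show "linear (\<lambda>b. dm i x c a b)" unfolding dm_expand[OF assms, of c a]
    by (auto intro!: linearI simp: inner_add_left distrib_right distrib_left sum.distrib sum_distrib_left mult_ac)
qed

lemmas dm_linear = linear_dm(1)[THEN linear_add] linear_dm(1)[THEN linear_scale]
  linear_dm(2)[THEN linear_add] linear_dm(2)[THEN linear_scale]
  linear_dm(3)[THEN linear_add] linear_dm(3)[THEN linear_scale]

lemma linear_koszul:
  assumes "i \<in> idx M" "x \<in> img i"
  shows "linear (\<lambda>a. koszul i x a b z)" "linear (\<lambda>b. koszul i x a b z)" "linear (\<lambda>z. koszul i x a b z)"
  unfolding koszul_def by (auto intro!: linearI simp: dm_linear[OF assms] algebra_simps add_divide_distrib diff_divide_distrib)

text \<open>This discharges the definite description in \<open>christoffel\<close>: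
  \<open>mc_riesz\<close> provides a solution and \<open>mc_eqI\<close> its uniqueness.\<close>

lemma Gam_koszul:
  assumes "i \<in> idx M" "x \<in> img i"
  shows "mc i x (Gam i x a b) z = koszul i x a b z"
proof -
  obtain w where w: "\<forall>z. mc i x w z = koszul i x a b z"
    using mc_riesz[OF assms linear_koszul(3)[OF assms]] by blast
  have "\<forall>z. mc i x (THE w. \<forall>z. mc i x w z = koszul i x a b z) z = koszul i x a b z"
    by (rule theI[of _ w]) (use w mc_eqI[OF assms] in auto)
  then show ?thesis unfolding christoffel_def koszul_def dm_def by blast
qed

lemma linear_Gam:
  assumes "i \<in> idx M" "x \<in> img i"
  shows "linear (\<lambda>a. Gam i x a b)" "linear (\<lambda>b. Gam i x a b)"
  by (rule linearI; rule mc_eqI[OF assms];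
      simp add: Gam_koszul[OF assms] mc_add_left[OF assms] mc_scale_left[OF assms]
      linear_koszul(1)[OF assms, THEN linear_add] linear_koszul(1)[OF assms, THEN linear_scale]
      linear_koszul(2)[OF assms, THEN linear_add] linear_koszul(2)[OF assms, THEN linear_scale])+

lemma dm_sym:
  assumes "i \<in> idx M" "x \<in> img i" shows "dm i x c a b = dm i x c b a"
  using frechet_derivative_cong_open[OF open_img[OF assms(1)] assms(2), of "\<lambda>y. mc i y a b" "\<lambda>y. mc i y b a"]
    mc_sym[OF assms(1)] unfolding dm_def by metis

text \<open>In the sum of \<open>koszul i x c a b\<close> and \<open>koszul i x c b a\<close> the
  four terms that differentiate along \<open>a\<close> or \<open>b\<close> cancel; the two that
  remain are equal by symmetry of the metric.\<close>

lemma metric_compatible: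
  assumes "i \<in> idx M" "x \<in> img i"
  shows "dm i x c a b = mc i x (Gam i x c a) b + mc i x a (Gam i x c b)"
  using dm_sym[OF assms, of a b c] dm_sym[OF assms, of b a c] dm_sym[OF assms, of c a b]
  by (simp add: mc_sym[OF assms, of a] Gam_koszul[OF assms] koszul_def field_simps)

text \<open>The Christoffel symbols solve a regular linear system whose matrix and right-hand side
  are smooth, so smooth dependence of solutions replaces a formula with the inverse metric.\<close>

lemma Ck_Gam:
  assumes "i \<in> idx M" shows "Ck_on k (\<lambda>x. Gam i x a b) (img i)"
proof (rule Ck_on_linear_solution[where G="\<lambda>x w. \<Sum>z\<in>Basis. mc i x w z *\<^sub>R z"
      and h="\<lambda>x. \<Sum>z\<in>Basis. koszul i x a b z *\<^sub>R z"])
  show "linear (\<lambda>w. \<Sum>z\<in>Basis. mc i x w z *\<^sub>R z)" if "x \<in> img i" for x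
    using mc_add_left[OF assms that] mc_scale_left[OF assms that]
    by (auto intro!: linearI simp: scaleR_add_left sum.distrib scaleR_sum_right)
  then show "inj (\<lambda>w. \<Sum>z\<in>Basis. mc i x w z *\<^sub>R z)" if "x \<in> img i" for x
    using that
  proof (subst linear_injective_0, simp, intro allI impI)
    fix w assume "(\<Sum>z\<in>Basis. mc i x w z *\<^sub>R z) = 0"
    then have "mc i x w z = 0" if "z \<in> Basis" for z
      using that inner_sum_left_Basis[of z "\<lambda>z. mc i x w z"] by simp
    then have "mc i x w b = 0" for b using linear_expand[OF linear_mc_right[OF assms \<open>x \<in> img i\<close>], of w b] by simp
    then show "w = 0" using mc_nondegenerate[OF assms \<open>x \<in> img i\<close>] by blast
  qed
  show "Ck_on k (\<lambda>x. \<Sum>z\<in>Basis. mc i x w z *\<^sub>R z) (img i)" for w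
    by (intro Ck_on_sum Ck_on_scaleR Ck_mc Ck_on_const assms open_img)
  have "Ck_on k (\<lambda>x. dm i x c a b) (img i)" for c a b
    using Ck_mc[OF assms, of "Suc k" a b] by (simp add: dm_def)
  then show "Ck_on k (\<lambda>x. \<Sum>z\<in>Basis. koszul i x a b z *\<^sub>R z) (img i)"
    unfolding koszul_def divide_inverse
    by (intro Ck_on_sum Ck_on_scaleR Ck_on_mult Ck_on_add Ck_on_diff Ck_on_const assms open_img)
  show "(\<Sum>z\<in>Basis. mc i x (Gam i x a b) z *\<^sub>R z) = (\<Sum>z\<in>Basis. koszul i x a b z *\<^sub>R z)" if "x \<in> img i" for x
    by (simp add: Gam_koszul[OF assms that])
qed (use assms open_img in auto)

section \<open>Change of charts for the metric and the Christoffel symbols\<close>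

lemma mc_transition:
  assumes "i \<in> idx M" "j \<in> idx M" "x \<in> overlap i j"
  shows "mc i x a b = mc j (transition M i j x) (Dt i j x a) (Dt i j x b)"
proof -
  obtain p where p: "p \<in> cdom M i" "p \<in> cdom M j" "x = cmap M i p" using assms(3) by blast
  have ch: "i \<in> charts_at M p" "j \<in> charts_at M p" using p assms by (auto simp: charts_at_def)
  have "mc i x a b = g p (of_coords M i p a) (of_coords M i p b)"
    using p assms by (simp add: metric_comp_def)
  also have "\<dots> = mc j (cmap M j p) (of_coords M i p a j) (of_coords M i p b j)"
    by (intro mc_g ch of_coords_tangent)
  finally show ?thesis using p assms of_coords_at[OF ch(2)] by (simp add: transition_cmap)
qed

definition D2t where "D2t i j x b a = frechet_derivative (\<lambda>y. Dt i j y b) (at x) a"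

lemma D2t_works:
  assumes "i \<in> idx M" "j \<in> idx M" "x \<in> overlap i j"
  shows "((\<lambda>y. Dt i j y b) has_derivative (\<lambda>a. D2t i j x b a)) (at x)"
proof -
  have "Ck_on (Suc 0) (\<lambda>y. Dt i j y b) (overlap i j)"
    using Ck_transition[OF assms(1,2), of "Suc (Suc 0)"] by simp
  from Ck_on_SucD[OF this assms(3)] show ?thesis unfolding D2t_def .
qed

lemma D2t_sym:
  assumes "i \<in> idx M" "j \<in> idx M" "x \<in> overlap i j"
  shows "D2t i j x b a = D2t i j x a b"
  unfolding D2t_def
  by (rule symmetric_second_derivative[OF Ck_transition[OF assms(1,2)] open_overlap[OF assms(1,2)] assms(3)])

lemma dm_transition:
  assumes "i \<in> idx M" "j \<in> idx M" "x \<in> overlap i j"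
  shows "dm i x c a b = dm j (transition M i j x) (Dt i j x c) (Dt i j x a) (Dt i j x b)
    + mc j (transition M i j x) (D2t i j x a c) (Dt i j x b) + mc j (transition M i j x) (Dt i j x a) (D2t i j x b c)"
proof -
  have im: "transition M i j x \<in> img j" using transition_in[OF assms(1,3)] by blast
  have "((\<lambda>y. mc j (transition M i j y) (Dt i j y a) (Dt i j y b)) has_derivative
     (\<lambda>c. dm j (transition M i j x) (Dt i j x c) (Dt i j x a) (Dt i j x b)
    + mc j (transition M i j x) (D2t i j x a c) (Dt i j x b) + mc j (transition M i j x) (Dt i j x a) (D2t i j x b c))) (at x)"
    by (intro mc_deriv_compose Dt_works D2t_works assms im)
  then have "((\<lambda>y. mc i y a b) has_derivative
     (\<lambda>c. dm j (transition M i j x) (Dt i j x c) (Dt i j x a) (Dt i j x b)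
    + mc j (transition M i j x) (D2t i j x a c) (Dt i j x b) + mc j (transition M i j x) (Dt i j x a) (D2t i j x b c))) (at x)"
    by (rule has_derivative_transform_within_open[OF _ open_overlap[OF assms(1,2)] assms(3)])
      (rule mc_transition[OF assms(1,2), symmetric])
  from fun_cong[OF frechet_derivative_at[OF this], of c, symmetric] show ?thesis by (subst dm_def)
qed

text \<open>When the law of \<open>dm\<close> is inserted into \<open>koszul\<close>, symmetry of
  second derivatives cancels every inhomogeneous term except the one with
  \<open>D2t i j x b a\<close>. Testing against vectors \<open>?D z\<close> suffices because the
  differential is onto.\<close>

lemma Gam_transition:
  assumes "i \<in> idx M" "j \<in> idx M" "x \<in> overlap i j"
  shows "Gam j (transition M i j x) (Dt i j x a) (Dt i j x b) = Dt i j x (Gam i x a b) - D2t i j x b a"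
proof -
  let ?y = "transition M i j x" and ?D = "Dt i j x"
  have x: "x \<in> img i" and y: "?y \<in> img j" using transition_in[OF assms(1,3)] assms(3) by blast+
  have surj: "\<exists>z. b = ?D z" for b
  proof -
    obtain p where p: "p \<in> cdom M i" "p \<in> cdom M j" "x = cmap M i p" using assms(3) by blast
    then show ?thesis using Dt_inverse[OF assms(2,1) p(2,1), of b] by metis
  qed
  have "mc j ?y (Gam j ?y (?D a) (?D b)) (?D z) = mc j ?y (?D (Gam i x a b) - D2t i j x b a) (?D z)" for z
  proof -
    have "mc j ?y (Gam j ?y (?D a) (?D b)) (?D z) = koszul j ?y (?D a) (?D b) (?D z)"
      by (rule Gam_koszul[OF assms(2) y])
    also have "\<dots> = koszul i x a b z - mc j ?y (D2t i j x b a) (?D z)"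
    proof -
      have "mc j ?y (?D b) (D2t i j x z a) = mc j ?y (D2t i j x z a) (?D b)" by (rule mc_sym[OF assms(2) y])
      then show ?thesis
        using dm_transition[OF assms, of a b z] dm_transition[OF assms, of b a z] dm_transition[OF assms, of z a b]
        unfolding koszul_def D2t_sym[OF assms, of z a] D2t_sym[OF assms, of z b] D2t_sym[OF assms, of a b]
        by (simp add: field_simps)
    qed
    also have "koszul i x a b z = mc j ?y (?D (Gam i x a b)) (?D z)"
      using Gam_koszul[OF assms(1) x] mc_transition[OF assms] by simp
    finally show ?thesis using linear_diff[OF linear_mc_left[OF assms(2) y]] by simp
  qed
  then show ?thesis using mc_eqI[OF assms(2) y] surj by metis
qed

end

section \<open>Parallel transport\<close>

lemma has_vector_derivative_cong_nhds:
  assumes "\<forall>\<^sub>F s in nhds t. f s = h s"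
  shows "(f has_vector_derivative D) (at t) \<longleftrightarrow> (h has_vector_derivative D) (at t)"
  using assms eventually_nhds_x_imp_x[OF assms] by (intro has_vector_derivative_cong_ev) auto

lemma has_vector_derivative_transform_nhds:
  assumes "(f has_vector_derivative D) (at t)" "\<forall>\<^sub>F s in nhds t. f s = h s"
  shows "(h has_vector_derivative D) (at t)"
  by (rule has_vector_derivative_cong_nhds[OF assms(2), THEN iffD1, OF assms(1)])

lemma smooth_onD:
  assumes "smooth_on S f" "x \<in> S"
  shows "\<exists>U h. open U \<and> x \<in> U \<and> (\<forall>k. Ck_on k h U) \<and> (\<forall>y\<in>U \<inter> S. h y = f y)"
  by (rule bspec[OF assms(1)[unfolded smooth_on_def] assms(2)])

lemma smooth_onI:
  assumes "\<And>x. x \<in> S \<Longrightarrow> \<exists>U h. open U \<and> x \<in> U \<and> (\<forall>k. Ck_on k h U) \<and> (\<forall>y\<in>U \<inter> S. h y = f y)"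
  shows "smooth_on S f"
  unfolding smooth_on_def using assms by (rule ballI)

lemma smooth_on_subset: assumes "smooth_on S f" "T \<subseteq> S" shows "smooth_on T f"
proof (rule smooth_onI)
  fix x assume "x \<in> T"
  with assms(2) have "x \<in> S" by blast
  obtain U h where U: "open U \<and> x \<in> U \<and> (\<forall>k. Ck_on k h U) \<and> (\<forall>y\<in>U \<inter> S. h y = f y)"
    using smooth_onD[OF assms(1) \<open>x \<in> S\<close>] by (elim exE)
  have "\<forall>y\<in>U \<inter> T. h y = f y"
  proof
    fix y assume y: "y \<in> U \<inter> T"
    then have "h y = f y" using U assms(2) by blast
    then show "h y = f y" using assms(2) y by simp
  qed
  with U have "open U \<and> x \<in> U \<and> (\<forall>k. Ck_on k h U) \<and> (\<forall>y\<in>U \<inter> T. h y = f y)" by (intro conjI) (elim conjE, assumption)+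
  then show "\<exists>U h. open U \<and> x \<in> U \<and> (\<forall>k. Ck_on k h U) \<and> (\<forall>y\<in>U \<inter> T. h y = f y)" by (intro exI)
qed

lemma smooth_on_cong:
  assumes "smooth_on S f" "\<And>x. x \<in> S \<Longrightarrow> f x = f' x" shows "smooth_on S f'"
proof (rule smooth_onI)
  fix x assume "x \<in> S"
  obtain U h where U: "open U \<and> x \<in> U \<and> (\<forall>k. Ck_on k h U) \<and> (\<forall>y\<in>U \<inter> S. h y = f y)"
    using smooth_onD[OF assms(1) \<open>x \<in> S\<close>] by (elim exE)
  have "\<forall>y\<in>U \<inter> S. h y = f' y"
  proof
    fix y assume y: "y \<in> U \<inter> S"
    then have "h y = f y" using U assms(2) by blast
    then show "h y = f' y" using assms(2) y by simp
  qed
  with U have "open U \<and> x \<in> U \<and> (\<forall>k. Ck_on k h U) \<and> (\<forall>y\<in>U \<inter> S. h y = f' y)" by (intro conjI) (elim conjE, assumption)+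
  then show "\<exists>U h. open U \<and> x \<in> U \<and> (\<forall>k. Ck_on k h U) \<and> (\<forall>y\<in>U \<inter> S. h y = f' y)" by (intro exI)
qed

lemma eventually_nhds_greaterThanLessThan:
  fixes t :: real
  assumes "a < t" "t < b" shows "\<forall>\<^sub>F s in nhds t. s \<in> {a<..<b}"
  by (rule eventually_nhds_in_open) (use assms in auto)

lemma finite_real_isolated:
  fixes S :: "real set"
  assumes "finite S" obtains d where "d > 0" "\<And>s. s \<in> S \<Longrightarrow> \<bar>s - z\<bar> < d \<Longrightarrow> s = z"
proof -
  have "\<exists>d>0. \<forall>s\<in>S. s \<noteq> z \<longrightarrow> d \<le> dist z s" by (rule finite_set_avoid[OF assms])
  then obtain d where d: "d > 0" "\<forall>s\<in>S. s \<noteq> z \<longrightarrow> d \<le> dist z s" by blast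
  show ?thesis by (rule that[OF d(1)]) (use d(2) in \<open>force simp: dist_real_def abs_minus_commute\<close>)
qed

lemma open_interval_around:
  fixes t :: real assumes "open J" "t \<in> J"
  obtains a b where "a < t" "t < b" "{a..b} \<subseteq> J"
proof -
  obtain e where e: "e > 0" "cball t e \<subseteq> J" using assms open_contains_cball by blast
  show ?thesis by (rule that[of "t - e" "t + e"]) (use e in \<open>auto simp: cball_eq_atLeastAtMost\<close>)
qed

lemma isCont_eventually_in:
  assumes "isCont f t" "open S" "f t \<in> S" shows "\<forall>\<^sub>F s in nhds t. f s \<in> S"
  using topological_tendstoD[OF assms(1)[unfolded isCont_def] assms(2,3)] assms(3)
  by (simp add: eventually_nhds_conv_at)

section \<open>Velocities and coordinate representations of curves\<close>

context charted_manifold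
begin

lemma Ck_Dt:
  assumes "i \<in> idx M" "j \<in> idx M" shows "Ck_on k (\<lambda>y. Dt i j y b) (overlap i j)"
  using Ck_transition[OF assms, of "Suc k"] by simp

lemma eventually_transition:
  assumes "i \<in> charts_at M (\<gamma> t)" "j \<in> charts_at M (\<gamma> t)"
    "((cmap M i \<circ> \<gamma>) has_vector_derivative c') (at t)"
    and ev: "\<forall>\<^sub>F s in nhds t. \<gamma> s \<in> cdom M i"
  shows "\<forall>\<^sub>F s in nhds t. i \<in> charts_at M (\<gamma> s) \<and> j \<in> charts_at M (\<gamma> s) \<and> cmap M i (\<gamma> s) \<in> overlap i j"
proof -
  note ij = charts_atD[OF assms(1)] charts_atD[OF assms(2)]
  have "isCont (cmap M i \<circ> \<gamma>) t" using assms(3) has_vector_derivative_continuous by blast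
  moreover have "(cmap M i \<circ> \<gamma>) t \<in> overlap i j" using ij by auto
  ultimately have "\<forall>\<^sub>F s in nhds t. (cmap M i \<circ> \<gamma>) s \<in> overlap i j"
    by (rule isCont_eventually_in[OF _ open_overlap[OF ij(1,3)]])
  then show ?thesis
  proof (rule eventually_elim2[OF ev])
    fix s assume s: "\<gamma> s \<in> cdom M i" "(cmap M i \<circ> \<gamma>) s \<in> overlap i j"
    then have "\<gamma> s \<in> cdom M j" using cinv_overlap[OF ij(1), of "cmap M i (\<gamma> s)" j] ij by simp
    with s ij show "i \<in> charts_at M (\<gamma> s) \<and> j \<in> charts_at M (\<gamma> s) \<and> cmap M i (\<gamma> s) \<in> overlap i j"
      by (auto simp: charts_at_def)
  qed
qed

lemma velocity_component:
  assumes "i \<in> charts_at M (\<gamma> t)" "j \<in> charts_at M (\<gamma> t)"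
    "((cmap M i \<circ> \<gamma>) has_vector_derivative c') (at t)" "\<forall>\<^sub>F s in nhds t. \<gamma> s \<in> cdom M i"
  shows "((cmap M j \<circ> \<gamma>) has_vector_derivative Dt i j (cmap M i (\<gamma> t)) c') (at t)"
    and "velocity M \<gamma> t j = Dt i j (cmap M i (\<gamma> t)) c'"
proof -
  note ij = charts_atD[OF assms(1)] charts_atD[OF assms(2)]
  have "(transition M i j has_derivative Dt i j (cmap M i (\<gamma> t))) (at ((cmap M i \<circ> \<gamma>) t))"
    using Dt_works[OF ij(1,3) overlapI[OF ij(2,4)]] by simp
  from has_derivative_compose[OF assms(3)[unfolded has_vector_derivative_def] this]
  have "((\<lambda>s. transition M i j ((cmap M i \<circ> \<gamma>) s)) has_derivative
      (\<lambda>r. Dt i j (cmap M i (\<gamma> t)) (r *\<^sub>R c'))) (at t)" .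
  then have "((\<lambda>s. transition M i j ((cmap M i \<circ> \<gamma>) s)) has_vector_derivative
      Dt i j (cmap M i (\<gamma> t)) c') (at t)"
    unfolding has_vector_derivative_def
    using linear_scale[OF linear_Dt[OF ij(1,3) overlapI[OF ij(2,4)]]] by simp
  moreover have "\<forall>\<^sub>F s in nhds t. transition M i j ((cmap M i \<circ> \<gamma>) s) = (cmap M j \<circ> \<gamma>) s"
    by (rule eventually_mono[OF assms(4)]) (simp add: transition_cmap[OF ij(1)])
  ultimately show D: "((cmap M j \<circ> \<gamma>) has_vector_derivative Dt i j (cmap M i (\<gamma> t)) c') (at t)"
    by (rule has_vector_derivative_transform_nhds)
  show "velocity M \<gamma> t j = Dt i j (cmap M i (\<gamma> t)) c'"
    using assms(2) vector_derivative_at[OF D] by (simp add: velocity_def)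
qed

lemma velocity_self:
  assumes "i \<in> charts_at M (\<gamma> t)" "((cmap M i \<circ> \<gamma>) has_vector_derivative c') (at t)"
  shows "velocity M \<gamma> t i = c'"
  using assms vector_derivative_at by (simp add: velocity_def)

lemma velocity_tangent:
  assumes "i \<in> charts_at M (\<gamma> t)"
    "((cmap M i \<circ> \<gamma>) has_vector_derivative c') (at t)" "\<forall>\<^sub>F s in nhds t. \<gamma> s \<in> cdom M i"
  shows "velocity M \<gamma> t \<in> tangent_space M (\<gamma> t)" "velocity M \<gamma> t = of_coords M i (\<gamma> t) c'"
proof -
  show eq: "velocity M \<gamma> t = of_coords M i (\<gamma> t) c'"
  proof
    fix j show "velocity M \<gamma> t j = of_coords M i (\<gamma> t) c' j"
      using velocity_component(2)[OF assms(1) _ assms(2,3), of j]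
      by (cases "j \<in> charts_at M (\<gamma> t)") (simp_all add: of_coords_def velocity_def)
  qed
  show "velocity M \<gamma> t \<in> tangent_space M (\<gamma> t)" unfolding eq by (rule of_coords_tangent[OF assms(1)])
qed

text \<open>\<open>velocity\<close> is built from \<open>vector_derivative\<close>, which is
  meaningful only where a derivative exists. Asking for one in a single chart that contains the
  curve near \<open>t\<close> is enough: it then exists in every chart around
  \<open>\<gamma> t\<close>, and the velocity is a tangent vector.\<close>

definition regular_at where
  "regular_at \<gamma> t \<longleftrightarrow> (\<exists>i c'. i \<in> charts_at M (\<gamma> t) \<and>
     ((cmap M i \<circ> \<gamma>) has_vector_derivative c') (at t) \<and> (\<forall>\<^sub>F s in nhds t. \<gamma> s \<in> cdom M i))"

lemma regular_atD:
  assumes "regular_at \<gamma> t" "j \<in> charts_at M (\<gamma> t)"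
  shows "((cmap M j \<circ> \<gamma>) has_vector_derivative velocity M \<gamma> t j) (at t)"
    "\<forall>\<^sub>F s in nhds t. \<gamma> s \<in> cdom M j"
proof -
  obtain i c' where i: "i \<in> charts_at M (\<gamma> t)" "((cmap M i \<circ> \<gamma>) has_vector_derivative c') (at t)"
    "\<forall>\<^sub>F s in nhds t. \<gamma> s \<in> cdom M i" using assms(1) unfolding regular_at_def by blast
  show "((cmap M j \<circ> \<gamma>) has_vector_derivative velocity M \<gamma> t j) (at t)"
    using velocity_component[OF i(1) assms(2) i(2,3)] by simp
  show "\<forall>\<^sub>F s in nhds t. \<gamma> s \<in> cdom M j"
    by (rule eventually_mono[OF eventually_transition[OF i(1) assms(2) i(2,3)]]) (simp add: charts_at_def)
qed

lemma regular_velocity_tangent: "regular_at \<gamma> t \<Longrightarrow> velocity M \<gamma> t \<in> tangent_space M (\<gamma> t)"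
  using velocity_tangent(1) unfolding regular_at_def by blast

lemma smooth_curve_mono:
  assumes "smooth_curve M J \<gamma>" "I \<subseteq> J" shows "smooth_curve M I \<gamma>"
proof -
  have "smooth_on {t \<in> I. \<gamma> t \<in> cdom M i} (cmap M i \<circ> \<gamma>)" if "i \<in> idx M" for i
  proof -
    have "smooth_on {t \<in> J. \<gamma> t \<in> cdom M i} (cmap M i \<circ> \<gamma>)"
      using assms(1) that unfolding smooth_curve_def by blast
    then show ?thesis
      by (rule smooth_on_subset) (use assms(2) in blast)
  qed
  moreover have "continuous_map (top_of_set I) (mtop M) \<gamma>"
    using assms continuous_map_from_subtopology_mono unfolding smooth_curve_def by blast
  ultimately show ?thesis unfolding smooth_curve_def by blast
qed

lemma smooth_curve_cong:
  assumes "smooth_curve M J \<gamma>" "\<And>t. t \<in> J \<Longrightarrow> \<gamma> t = \<delta> t" shows "smooth_curve M J \<delta>"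
proof -
  have "smooth_on {t \<in> J. \<delta> t \<in> cdom M i} (cmap M i \<circ> \<delta>)" if "i \<in> idx M" for i
  proof -
    have "smooth_on {t \<in> J. \<gamma> t \<in> cdom M i} (cmap M i \<circ> \<gamma>)"
      using assms(1) that unfolding smooth_curve_def by blast
    moreover have "{t \<in> J. \<delta> t \<in> cdom M i} = {t \<in> J. \<gamma> t \<in> cdom M i}" using assms(2) by auto
    ultimately have "smooth_on {t \<in> J. \<delta> t \<in> cdom M i} (cmap M i \<circ> \<gamma>)" by simp
    then show ?thesis by (rule smooth_on_cong) (use assms(2) in auto)
  qed
  moreover have "continuous_map (top_of_set J) (mtop M) \<delta>"
    by (rule continuous_map_eq[of _ _ \<gamma>]) (use assms in \<open>auto simp: smooth_curve_def\<close>)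
  ultimately show ?thesis unfolding smooth_curve_def by blast
qed

lemma smooth_curve_affine:
  assumes "smooth_curve M J \<gamma>" "\<And>s. s \<in> I \<Longrightarrow> \<alpha> * s + \<beta> \<in> J"
  shows "smooth_curve M I (\<lambda>s. \<gamma> (\<alpha> * s + \<beta>))"
  unfolding smooth_curve_def
proof (intro conjI ballI)
  have "continuous_map (top_of_set I) (top_of_set J) (\<lambda>s. \<alpha> * s + \<beta>)"
    using assms(2) by (auto intro!: continuous_intros)
  then show "continuous_map (top_of_set I) (mtop M) (\<lambda>s. \<gamma> (\<alpha> * s + \<beta>))"
    using continuous_map_compose[of _ _ _ _ \<gamma>] assms(1) unfolding smooth_curve_def o_def by blast
  fix i assume i: "i \<in> idx M"
  show "smooth_on {s \<in> I. \<gamma> (\<alpha> * s + \<beta>) \<in> cdom M i} (cmap M i \<circ> (\<lambda>s. \<gamma> (\<alpha> * s + \<beta>)))"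
  proof (rule smooth_onI)
    fix s assume s: "s \<in> {s \<in> I. \<gamma> (\<alpha> * s + \<beta>) \<in> cdom M i}"
    have "smooth_on {t \<in> J. \<gamma> t \<in> cdom M i} (cmap M i \<circ> \<gamma>)"
      using assms(1) i unfolding smooth_curve_def by blast
    moreover have "\<alpha> * s + \<beta> \<in> {t \<in> J. \<gamma> t \<in> cdom M i}" using s assms(2) by blast
    ultimately obtain U h where UU: "open U \<and> \<alpha> * s + \<beta> \<in> U \<and> (\<forall>k. Ck_on k h U) \<and>
        (\<forall>y\<in>U \<inter> {t \<in> J. \<gamma> t \<in> cdom M i}. h y = (cmap M i \<circ> \<gamma>) y)"
      by (blast dest: smooth_onD)
    then have U: "open U" "\<alpha> * s + \<beta> \<in> U" "\<And>k. Ck_on k h U" by (elim conjE, simp)+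
    have hU: "h y = cmap M i (\<gamma> y)" if "y \<in> U" "y \<in> J" "\<gamma> y \<in> cdom M i" for y
      using UU that by auto
    let ?W = "(\<lambda>s. \<alpha> * s + \<beta>) -` U"
    have W: "open ?W" by (intro open_vimage U continuous_intros)
    have "Ck_on k (\<lambda>s. h (\<alpha> * s + \<beta>)) ?W" for k
      by (rule Ck_on_compose[OF U(3)], rule Ck_on_add[OF Ck_on_bounded_linear[OF bounded_linear_mult_right W] Ck_on_const W])
        (use W in auto)
    then show "\<exists>U h. open U \<and> s \<in> U \<and> (\<forall>k. Ck_on k h U) \<and>
      (\<forall>y\<in>U \<inter> {s \<in> I. \<gamma> (\<alpha> * s + \<beta>) \<in> cdom M i}. h y = (cmap M i \<circ> (\<lambda>s. \<gamma> (\<alpha> * s + \<beta>))) y)"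
      using W U(2) assms(2) by (intro exI[of _ ?W] exI[of _ "\<lambda>s. h (\<alpha> * s + \<beta>)"] conjI allI) (auto simp: hU)
  qed
qed

text \<open>At an end point of \<open>J\<close> the coordinate curve need not have a two-sided
  derivative, but the smooth extension granted by \<open>smooth_on\<close> does. \<open>h\<close> is
  that extension, and the transport equation is posed with it.\<close>

lemma smooth_curve_local:
  assumes "smooth_curve M J \<gamma>" "z \<in> J" "i \<in> charts_at M (\<gamma> z)"
  obtains d h h' where "d > 0" "\<And>t. t \<in> J \<Longrightarrow> \<bar>t - z\<bar> < d \<Longrightarrow> \<gamma> t \<in> cdom M i \<and> h t = cmap M i (\<gamma> t)"
    "\<And>t. \<bar>t - z\<bar> < d \<Longrightarrow> (h has_vector_derivative h' t) (at t)" "continuous_on {z - d<..<z + d} h'"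
proof -
  note i = charts_atD[OF assms(3)]
  have "smooth_on {t \<in> J. \<gamma> t \<in> cdom M i} (cmap M i \<circ> \<gamma>)"
    using assms(1) i(1) unfolding smooth_curve_def by blast
  moreover have "z \<in> {t \<in> J. \<gamma> t \<in> cdom M i}" using assms(2) i(2) by blast
  ultimately obtain U h where UU: "open U \<and> z \<in> U \<and> (\<forall>k. Ck_on k h U) \<and>
      (\<forall>y\<in>U \<inter> {t \<in> J. \<gamma> t \<in> cdom M i}. h y = (cmap M i \<circ> \<gamma>) y)"
    by (blast dest: smooth_onD)
  then have U: "open U" "z \<in> U" "\<And>k. Ck_on k h U" by (elim conjE, simp)+
  have hU: "h y = cmap M i (\<gamma> y)" if "y \<in> U" "y \<in> J" "\<gamma> y \<in> cdom M i" for y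
    using UU that by auto
  have "openin (top_of_set J) {t \<in> topspace (top_of_set J). \<gamma> t \<in> cdom M i}"
    using assms(1) openin_cdom[OF i(1)] unfolding smooth_curve_def
    by (intro openin_continuous_map_preimage[of _ "mtop M"]) auto
  then obtain T where T: "open T" "{t \<in> J. \<gamma> t \<in> cdom M i} = J \<inter> T" by (auto simp: openin_open)
  then have "z \<in> T \<inter> U" using assms(2) i(2) U(2) by auto
  then obtain d where d: "d > 0" "ball z d \<subseteq> T \<inter> U" using openE[OF open_Int[OF T(1) U(1)]] by blast
  have dU: "t \<in> T \<inter> U" if "\<bar>t - z\<bar> < d" for t
    using d(2) that by (auto simp: subset_iff dist_real_def abs_minus_commute)
  define h' where "h' t = frechet_derivative h (at t) 1" for t
  show ?thesis
  proof (rule that[OF d(1)])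
    show "\<gamma> t \<in> cdom M i \<and> h t = cmap M i (\<gamma> t)" if "t \<in> J" "\<bar>t - z\<bar> < d" for t
      using dU[OF that(2)] that(1) T(2) hU[of t] by auto
    show "(h has_vector_derivative h' t) (at t)" if "\<bar>t - z\<bar> < d" for t
    proof -
      have D: "(h has_derivative frechet_derivative h (at t)) (at t)"
        using Ck_on_SucD[OF U(3)] dU[OF that] by blast
      have "frechet_derivative h (at t) r = r *\<^sub>R h' t" for r
        unfolding h'_def using linear_scale[OF has_derivative_linear[OF D], of r 1] by simp
      then have "frechet_derivative h (at t) = (\<lambda>r. r *\<^sub>R h' t)" by blast
      with D show ?thesis unfolding has_vector_derivative_def by simp
    qed
    have "continuous_on U h'" using U(3)[of "Suc 0"] by (simp add: h'_def)
    then show "continuous_on {z - d<..<z + d} h'"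
      by (rule continuous_on_subset) (use dU in \<open>auto simp: abs_less_iff\<close>)
  qed
qed

lemma smooth_curve_regular:
  assumes "smooth_curve M {a..b} \<gamma>" "a < t" "t < b"
  shows "regular_at \<gamma> t"
proof -
  have "\<gamma> t \<in> topspace (mtop M)"
    using assms unfolding smooth_curve_def by (auto simp: continuous_map_def)
  then obtain i where i: "i \<in> charts_at M (\<gamma> t)" using chart_exists by blast
  obtain d h h' where h: "d > 0" "\<And>s. s \<in> {a..b} \<Longrightarrow> \<bar>s - t\<bar> < d \<Longrightarrow> \<gamma> s \<in> cdom M i \<and> h s = cmap M i (\<gamma> s)"
    "\<And>s. \<bar>s - t\<bar> < d \<Longrightarrow> (h has_vector_derivative h' s) (at s)"
    by (rule smooth_curve_local[OF assms(1) _ i]) (use assms in auto)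
  have ev: "\<forall>\<^sub>F s in nhds t. \<gamma> s \<in> cdom M i \<and> h s = cmap M i (\<gamma> s)"
  proof (rule eventually_mono)
    show "\<forall>\<^sub>F s in nhds t. s \<in> {max a (t - d)<..<min b (t + d)}"
      using assms h(1) by (intro eventually_nhds_greaterThanLessThan) auto
    show "\<gamma> s \<in> cdom M i \<and> h s = cmap M i (\<gamma> s)" if "s \<in> {max a (t - d)<..<min b (t + d)}" for s
      by (rule h(2)) (use that in auto)
  qed
  then have "\<forall>\<^sub>F s in nhds t. h s = (cmap M i \<circ> \<gamma>) s" by (rule eventually_mono) simp
  then have "((cmap M i \<circ> \<gamma>) has_vector_derivative h' t) (at t)"
    by (rule has_vector_derivative_transform_nhds[rotated]) (use h(1) in \<open>auto intro: h(3)\<close>)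
  moreover have "\<forall>\<^sub>F s in nhds t. \<gamma> s \<in> cdom M i" using ev by (rule eventually_mono) simp
  ultimately show ?thesis using i unfolding regular_at_def by blast
qed

lemma piecewise_smooth_regular:
  assumes "piecewise_smooth_path M \<gamma>"
  obtains S where "finite S" "\<And>t. t \<in> {0<..<1} - S \<Longrightarrow> regular_at \<gamma> t"
proof -
  obtain S where S: "finite S" "\<And>a b. 0 \<le> a \<Longrightarrow> a < b \<Longrightarrow> b \<le> 1 \<Longrightarrow> {a<..<b} \<inter> S = {} \<Longrightarrow> smooth_curve M {a..b} \<gamma>"
    using assms unfolding piecewise_smooth_path_def by blast
  show ?thesis
  proof (rule that[OF S(1)])
    fix t :: real assume t: "t \<in> {0<..<1} - S"
    obtain d where d: "d > 0" "\<And>s. s \<in> S \<Longrightarrow> \<bar>s - t\<bar> < d \<Longrightarrow> s = t"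
      using finite_real_isolated[OF S(1)] by blast
    define a b where "a = max 0 (t - d)" and "b = min 1 (t + d)"
    have ab: "0 \<le> a" "a < t" "t < b" "b \<le> 1" using t d(1) by (auto simp: a_def b_def)
    have "{a<..<b} \<inter> S = {}"
    proof (rule ccontr)
      assume "{a<..<b} \<inter> S \<noteq> {}"
      then obtain s where s: "s \<in> S" "a < s" "s < b" by auto
      then have "\<bar>s - t\<bar> < d" by (auto simp: a_def b_def abs_less_iff)
      with d(2)[OF s(1)] t s(1) show False by simp
    qed
    with S(2) ab show "regular_at \<gamma> t" by (intro smooth_curve_regular[of a b]) auto
  qed
qed

end

section \<open>The parallel transport equation and the existence of parallel fields\<close>

context pseudo_riemannian_manifold
begin

lemma velocity_cong:
  assumes "\<forall>\<^sub>F s in nhds t. \<gamma> s = \<delta> s" shows "velocity M \<gamma> t = velocity M \<delta> t"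
proof -
  have "((cmap M i \<circ> \<gamma>) has_vector_derivative D) (at t) \<longleftrightarrow> ((cmap M i \<circ> \<delta>) has_vector_derivative D) (at t)" for i D
    by (rule has_vector_derivative_cong_nhds, rule eventually_mono[OF assms]) simp
  then show ?thesis
    unfolding velocity_def vector_derivative_def eventually_nhds_x_imp_x[OF assms] by presburger
qed

lemma parallel_at_cong:
  assumes "parallel_at M g \<gamma> V t" "\<forall>\<^sub>F s in nhds t. \<gamma> s = \<delta> s \<and> V s = W s"
  shows "parallel_at M g \<delta> W t"
  unfolding parallel_at_def
proof
  have ev: "\<forall>\<^sub>F s in nhds t. \<gamma> s = \<delta> s" "\<forall>\<^sub>F s in nhds t. V s = W s"
    using assms(2) by (auto elim: eventually_mono)
  note eqs = eventually_nhds_x_imp_x[OF ev(1)] eventually_nhds_x_imp_x[OF ev(2)]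
  fix i assume "i \<in> charts_at M (\<delta> t)"
  then have "((\<lambda>s. V s i) has_vector_derivative - Gam i (cmap M i (\<delta> t)) (velocity M \<delta> t i) (W t i)) (at t)"
    using assms(1) unfolding parallel_at_def velocity_cong[OF ev(1)] eqs by blast
  then show "((\<lambda>s. W s i) has_vector_derivative - Gam i (cmap M i (\<delta> t)) (velocity M \<delta> t i) (W t i)) (at t)"
    by (rule has_vector_derivative_transform_nhds) (rule eventually_mono[OF ev(2)], simp)
qed

text \<open>By the transformation law of the Christoffel symbols, the parallel transport equation
  only has to be checked in one chart.\<close>

lemma parallel_atI:
  assumes "i \<in> charts_at M (\<gamma> t)" "((cmap M i \<circ> \<gamma>) has_vector_derivative c') (at t)"
    and ev: "\<forall>\<^sub>F s in nhds t. \<gamma> s \<in> cdom M i \<and> V s \<in> tangent_space M (\<gamma> s)"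
    and V: "((\<lambda>s. V s i) has_vector_derivative - Gam i (cmap M i (\<gamma> t)) c' (V t i)) (at t)"
  shows "parallel_at M g \<gamma> V t"
  unfolding parallel_at_def
proof
  fix j assume j: "j \<in> charts_at M (\<gamma> t)"
  note ij = charts_atD[OF assms(1)] charts_atD[OF j]
  let ?x = "cmap M i (\<gamma> t)"
  have x: "?x \<in> overlap i j" "?x \<in> img i" using ij by auto
  have ev1: "\<forall>\<^sub>F s in nhds t. \<gamma> s \<in> cdom M i" using ev by (rule eventually_mono) simp
  note vel = velocity_component[OF assms(1) j assms(2) ev1]
  have c: "((\<lambda>s. cmap M i (\<gamma> s)) has_derivative (\<lambda>r. r *\<^sub>R c')) (at t)"
    using assms(2) unfolding has_vector_derivative_def o_def .
  have d1: "((\<lambda>s. Dt i j (cmap M i (\<gamma> s)) b) has_derivative (\<lambda>r. D2t i j ?x b (r *\<^sub>R c'))) (at t)" for b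
    by (rule has_derivative_compose[OF c D2t_works[OF ij(1,3) x(1)]])
  note d2 = has_derivative_inner_left[OF V[unfolded has_vector_derivative_def]]
  \<comment> \<open>The sum is the component of \<open>V\<close> in chart \<open>j\<close>, as the
    transition differential applied to the component in chart \<open>i\<close>; the expansion turns
    it into products of functions of \<open>s\<close>.\<close>
  have "((\<lambda>s. \<Sum>b\<in>Basis. (V s i \<bullet> b) *\<^sub>R Dt i j (cmap M i (\<gamma> s)) b) has_derivative
      (\<lambda>r. \<Sum>b\<in>Basis. (V t i \<bullet> b) *\<^sub>R D2t i j ?x b (r *\<^sub>R c')
         + ((r *\<^sub>R (- Gam i ?x c' (V t i))) \<bullet> b) *\<^sub>R Dt i j ?x b)) (at t)"
    by (rule has_derivative_sum) (rule has_derivative_scaleR[OF d2 d1])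
  moreover have "(\<Sum>b\<in>Basis. (V t i \<bullet> b) *\<^sub>R D2t i j ?x b (r *\<^sub>R c')
         + ((r *\<^sub>R (- Gam i ?x c' (V t i))) \<bullet> b) *\<^sub>R Dt i j ?x b)
      = r *\<^sub>R (- Gam j (transition M i j ?x) (Dt i j ?x c') (Dt i j ?x (V t i)))" for r
  proof -
    have lD2: "linear (\<lambda>a. D2t i j ?x b a)" for b
      using D2t_works[OF ij(1,3) x(1)] has_derivative_linear by blast
    have "(\<Sum>b\<in>Basis. (V t i \<bullet> b) *\<^sub>R D2t i j ?x b (r *\<^sub>R c')) = (\<Sum>b\<in>Basis. (V t i \<bullet> b) *\<^sub>R (r *\<^sub>R D2t i j ?x c' b))"
      by (simp add: linear_scale[OF lD2] D2t_sym[OF ij(1,3) x(1), of _ c'])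
    also have "\<dots> = r *\<^sub>R (\<Sum>b\<in>Basis. (V t i \<bullet> b) *\<^sub>R D2t i j ?x c' b)"
      by (simp add: scaleR_sum_right mult.commute)
    also have "\<dots> = r *\<^sub>R D2t i j ?x (V t i) c'"
      unfolding D2t_sym[OF ij(1,3) x(1), of "V t i" c'] by (simp only: linear_expand[OF lD2, of c' "V t i", symmetric])
    finally have 1: "(\<Sum>b\<in>Basis. (V t i \<bullet> b) *\<^sub>R D2t i j ?x b (r *\<^sub>R c')) = r *\<^sub>R D2t i j ?x (V t i) c'" .
    have 2: "(\<Sum>b\<in>Basis. ((r *\<^sub>R (- Gam i ?x c' (V t i))) \<bullet> b) *\<^sub>R Dt i j ?x b) = r *\<^sub>R (- Dt i j ?x (Gam i ?x c' (V t i)))"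
      using linear_expand[OF linear_Dt[OF ij(1,3) x(1)], of "r *\<^sub>R (- Gam i ?x c' (V t i))", symmetric]
        linear_scale[OF linear_Dt[OF ij(1,3) x(1)]] linear_neg[OF linear_Dt[OF ij(1,3) x(1)]] by (simp only:)
    \<comment> \<open>The second derivative of the transition map, caused by the moving base point,
      is exactly the inhomogeneous term in the transformation law of the Christoffel
      symbols.\<close>
    show ?thesis
      unfolding sum.distrib 1 2 Gam_transition[OF ij(1,3) x(1)] by (simp add: algebra_simps)
  qed
  ultimately have D: "((\<lambda>s. \<Sum>b\<in>Basis. (V s i \<bullet> b) *\<^sub>R Dt i j (cmap M i (\<gamma> s)) b) has_vector_derivative
      - Gam j (transition M i j ?x) (Dt i j ?x c') (Dt i j ?x (V t i))) (at t)"
    unfolding has_vector_derivative_def by simp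
  have evj: "\<forall>\<^sub>F s in nhds t. (\<Sum>b\<in>Basis. (V s i \<bullet> b) *\<^sub>R Dt i j (cmap M i (\<gamma> s)) b) = V s j"
  proof (rule eventually_elim2[OF ev eventually_transition[OF assms(1) j assms(2) ev1]])
    fix s assume s: "\<gamma> s \<in> cdom M i \<and> V s \<in> tangent_space M (\<gamma> s)"
      "i \<in> charts_at M (\<gamma> s) \<and> j \<in> charts_at M (\<gamma> s) \<and> cmap M i (\<gamma> s) \<in> overlap i j"
    then show "(\<Sum>b\<in>Basis. (V s i \<bullet> b) *\<^sub>R Dt i j (cmap M i (\<gamma> s)) b) = V s j"
      using tangent_component[of "V s" "\<gamma> s" i j] linear_expand[OF linear_Dt_chart, of i "\<gamma> s" j "V s i"] by simp
  qed
  have "V t j = Dt i j ?x (V t i)"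
    using tangent_component[of "V t" "\<gamma> t" i j] eventually_nhds_x_imp_x[OF ev] assms(1) j by blast
  with has_vector_derivative_transform_nhds[OF D evj]
  show "((\<lambda>s. V s j) has_vector_derivative - Gam j (cmap M j (\<gamma> t)) (velocity M \<gamma> t j) (V t j)) (at t)"
    by (simp only: vel(2) transition_cmap[OF ij(1,2)])
qed

text \<open>The conditions of \<open>parallel_along\<close> on an arbitrary interval, as needed for
  subdividing, gluing and reparametrizing.\<close>

definition par_on where
  "par_on \<gamma> a b V \<longleftrightarrow> (\<forall>t\<in>{a..b}. V t \<in> tangent_space M (\<gamma> t)) \<and>
     (\<forall>i\<in>idx M. continuous_on {t \<in> {a..b}. \<gamma> t \<in> cdom M i} (\<lambda>t. V t i)) \<and>
     (\<exists>S. finite S \<and> (\<forall>t\<in>{a<..<b} - S. parallel_at M g \<gamma> V t))"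

lemma parallel_along_par_on: "parallel_along M g \<gamma> V \<longleftrightarrow> par_on \<gamma> 0 1 V"
  unfolding parallel_along_def par_on_def ..

lemma par_onD:
  assumes "par_on \<gamma> a b V"
  shows "t \<in> {a..b} \<Longrightarrow> V t \<in> tangent_space M (\<gamma> t)"
    "i \<in> idx M \<Longrightarrow> continuous_on {t \<in> {a..b}. \<gamma> t \<in> cdom M i} (\<lambda>t. V t i)"
    "\<exists>S. finite S \<and> (\<forall>t\<in>{a<..<b} - S. parallel_at M g \<gamma> V t)"
  using assms unfolding par_on_def by blast+

text \<open>The junction \<open>b\<close> joins the exceptional set: only continuity is asked for
  there, and \<open>V b = W b\<close> gives it.\<close>

lemma par_on_glue:
  assumes V: "par_on \<gamma> a b V" and W: "par_on \<gamma> b c W" and "V b = W b"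
  shows "par_on \<gamma> a c (\<lambda>t. if t \<le> b then V t else W t)"
  unfolding par_on_def
proof (intro conjI ballI)
  fix t assume "t \<in> {a..c}"
  then show "(if t \<le> b then V t else W t) \<in> tangent_space M (\<gamma> t)"
    using par_onD(1)[OF V] par_onD(1)[OF W] by simp
next
  fix i assume i: "i \<in> idx M"
  have "continuous_on {t \<in> {a..c}. \<gamma> t \<in> cdom M i} (\<lambda>t. if t \<le> b then V t i else W t i)"
  proof (rule continuous_on_cases_le)
    show "continuous_on {t \<in> {t \<in> {a..c}. \<gamma> t \<in> cdom M i}. t \<le> b} (\<lambda>t. V t i)"
      by (rule continuous_on_subset[OF par_onD(2)[OF V i]]) auto
    show "continuous_on {t \<in> {t \<in> {a..c}. \<gamma> t \<in> cdom M i}. b \<le> t} (\<lambda>t. W t i)"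
      by (rule continuous_on_subset[OF par_onD(2)[OF W i]]) auto
  qed (use assms(3) in auto)
  then show "continuous_on {t \<in> {a..c}. \<gamma> t \<in> cdom M i} (\<lambda>t. (if t \<le> b then V t else W t) i)"
    by (simp add: if_distrib[of "\<lambda>v. v i"] cong: if_cong)
next
  obtain S T where S: "finite S" "\<And>t. t \<in> {a<..<b} - S \<Longrightarrow> parallel_at M g \<gamma> V t"
    and T: "finite T" "\<And>t. t \<in> {b<..<c} - T \<Longrightarrow> parallel_at M g \<gamma> W t"
    using par_onD(3)[OF V] par_onD(3)[OF W] by blast
  show "\<exists>S. finite S \<and> (\<forall>t\<in>{a<..<c} - S. parallel_at M g \<gamma> (\<lambda>t. if t \<le> b then V t else W t) t)"
  proof (intro exI[of _ "S \<union> T \<union> {b}"] conjI ballI)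
    fix t assume t: "t \<in> {a<..<c} - (S \<union> T \<union> {b})"
    show "parallel_at M g \<gamma> (\<lambda>t. if t \<le> b then V t else W t) t"
    proof (cases "t < b")
      case True
      have "\<forall>\<^sub>F s in nhds t. s \<in> {..<b}" using True by (intro eventually_nhds_in_open) auto
      then have "\<forall>\<^sub>F s in nhds t. \<gamma> s = \<gamma> s \<and> V s = (if s \<le> b then V s else W s)"
        by (rule eventually_mono) simp
      moreover have "parallel_at M g \<gamma> V t" by (rule S(2)) (use t True in auto)
      ultimately show ?thesis by (rule parallel_at_cong[rotated])
    next
      case False
      have "\<forall>\<^sub>F s in nhds t. s \<in> {b<..}" using False t by (intro eventually_nhds_in_open) auto
      then have "\<forall>\<^sub>F s in nhds t. \<gamma> s = \<gamma> s \<and> W s = (if s \<le> b then V s else W s)"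
        by (rule eventually_mono) simp
      moreover have "parallel_at M g \<gamma> W t" by (rule T(2)) (use t False in auto)
      ultimately show ?thesis by (rule parallel_at_cong[rotated])
    qed
  qed (use S T in auto)
qed

text \<open>Inside one chart parallelism is a linear differential equation for the coordinates,
  whose coefficients are the Christoffel symbols along \<open>h\<close>; \<open>linear_ode\<close>
  solves it and supplies the factor 2. The solution is carried to the other charts by
  \<open>of_coords\<close>.\<close>

lemma par_on_chart:
  assumes i: "i \<in> idx M" and dom: "\<And>t. t \<in> {p..q} \<Longrightarrow> \<gamma> t \<in> cdom M i \<and> h t = cmap M i (\<gamma> t)"
    and h: "\<And>t. t \<in> {p..q} \<Longrightarrow> (h has_vector_derivative h' t) (at t)" "continuous_on {p..q} h'"
    and K: "\<And>t w. t \<in> {p..q} \<Longrightarrow> norm (Gam i (h t) (h' t) w) \<le> K * norm w" "K * (q - p) \<le> 1 / 2" "0 \<le> K"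
    and t0: "t0 \<in> {p..q}" and v: "v \<in> tangent_space M (\<gamma> t0)"
  shows "\<exists>V. par_on \<gamma> p q V \<and> V t0 = v \<and> (\<forall>t\<in>{p..q}. norm (V t i) \<le> 2 * norm (v i))"
proof -
  have ch: "i \<in> charts_at M (\<gamma> t)" "h t \<in> img i" if "t \<in> {p..q}" for t
    using dom[OF that] i by (auto simp: charts_at_def)
  have hc: "continuous_on {p..q} h"
    using has_vector_derivative_continuous[OF h(1)] by (intro continuous_at_imp_continuous_on) blast
  note lG = linear_Gam[OF i ch(2)]
  have Gc: "continuous_on {p..q} (\<lambda>t. - Gam i (h t) (h' t) w)" for w
  proof -
    have "continuous_on {p..q} (\<lambda>t. - (\<Sum>b\<in>Basis. (h' t \<bullet> b) *\<^sub>R Gam i (h t) b w))"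
      by (intro continuous_intros h(2) continuous_on_compose2[OF Ck_on_continuous[OF Ck_Gam[OF i, of 0]] hc])
        (use ch(2) in auto)
    then show ?thesis
      by (rule continuous_on_eq) (simp add: linear_expand[OF lG(1), symmetric])
  qed
  obtain x where x: "x t0 = v i" "\<And>t. t \<in> {p..q} \<Longrightarrow> norm (x t) \<le> 2 * norm (v i)"
    "\<And>t. t \<in> {p..q} \<Longrightarrow> (x has_vector_derivative - Gam i (h t) (h' t) (x t)) (at t within {p..q})"
  proof (rule linear_ode[OF t0, of "\<lambda>t w. - Gam i (h t) (h' t) w" K "v i"])
    show "linear (\<lambda>w. - Gam i (h t) (h' t) w)" if "t \<in> {p..q}" for t
      by (intro linear_compose_neg lG that)
  qed (use K Gc in auto)
  have xc: "continuous_on {p..q} x"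
    unfolding continuous_on_eq_continuous_within using has_vector_derivative_continuous[OF x(3)] by blast
  define V where "V t = of_coords M i (\<gamma> t) (x t)" for t
  have Vi: "V t i = x t" if "t \<in> {p..q}" for t unfolding V_def using of_coords_self[OF ch(1)[OF that]] .
  have VT: "V t \<in> tangent_space M (\<gamma> t)" if "t \<in> {p..q}" for t unfolding V_def using of_coords_tangent[OF ch(1)[OF that]] .
  have "par_on \<gamma> p q V"
    unfolding par_on_def
  proof (intro conjI ballI VT)
    fix j assume j: "j \<in> idx M"
    have ov: "h t \<in> overlap i j" if "t \<in> {t \<in> {p..q}. \<gamma> t \<in> cdom M j}" for t
      using dom[of t] that by auto
    have "continuous_on {t \<in> {p..q}. \<gamma> t \<in> cdom M j} (\<lambda>t. \<Sum>b\<in>Basis. (x t \<bullet> b) *\<^sub>R Dt i j (h t) b)"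
      by (intro continuous_intros continuous_on_compose2[OF Ck_on_continuous[OF Ck_Dt[OF i j, of 0]]]
        continuous_on_subset[OF hc] continuous_on_subset[OF xc]) (use ov in auto)
    then show "continuous_on {t \<in> {p..q}. \<gamma> t \<in> cdom M j} (\<lambda>t. V t j)"
    proof (rule continuous_on_eq)
      fix t assume t: "t \<in> {t \<in> {p..q}. \<gamma> t \<in> cdom M j}"
      then have "j \<in> charts_at M (\<gamma> t)" using j by (simp add: charts_at_def)
      then have "V t j = Dt i j (h t) (x t)" using dom[of t] t by (simp add: V_def of_coords_at)
      then show "(\<Sum>b\<in>Basis. (x t \<bullet> b) *\<^sub>R Dt i j (h t) b) = V t j"
        using linear_expand[OF linear_Dt[OF i j ov[OF t]], of "x t"] by simp
    qed
  next
    have "parallel_at M g \<gamma> V t" if t: "t \<in> {p<..<q}" for t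
    proof (rule parallel_atI[where i=i and c'="h' t"])
      have t': "t \<in> {p..q}" using t by auto
      have ev: "\<forall>\<^sub>F s in nhds t. s \<in> {p..q}"
        using t by (intro eventually_mono[OF eventually_nhds_greaterThanLessThan[of p t q]]) auto
      show "i \<in> charts_at M (\<gamma> t)" using ch t' by blast
      show "((cmap M i \<circ> \<gamma>) has_vector_derivative h' t) (at t)"
        by (rule has_vector_derivative_transform_nhds[OF h(1)[OF t']]) (rule eventually_mono[OF ev], simp add: dom)
      show "\<forall>\<^sub>F s in nhds t. \<gamma> s \<in> cdom M i \<and> V s \<in> tangent_space M (\<gamma> s)"
        by (rule eventually_mono[OF ev]) (simp add: dom VT)
      have "(x has_vector_derivative - Gam i (h t) (h' t) (x t)) (at t)"
        using x(3)[OF t'] t by (simp add: at_within_Icc_at)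
      then have "(x has_vector_derivative - Gam i (cmap M i (\<gamma> t)) (h' t) (V t i)) (at t)"
        using dom[OF t'] Vi[OF t'] by simp
      then show "((\<lambda>s. V s i) has_vector_derivative - Gam i (cmap M i (\<gamma> t)) (h' t) (V t i)) (at t)"
        by (rule has_vector_derivative_transform_nhds) (rule eventually_mono[OF ev], simp add: Vi)
    qed
    then show "\<exists>S. finite S \<and> (\<forall>t\<in>{p<..<q} - S. parallel_at M g \<gamma> V t)" by (intro exI[of _ "{}"]) auto
  qed
  moreover have "V t0 = v" unfolding V_def x(1) by (rule of_coords_component[OF v ch(1)[OF t0]])
  ultimately show ?thesis using x(2) Vi by (intro exI[of _ V]) simp
qed

definition transports where
  "transports \<gamma> p q \<longleftrightarrow> (\<forall>t0\<in>{p, q}. \<forall>v\<in>tangent_space M (\<gamma> t0). \<exists>V. par_on \<gamma> p q V \<and> V t0 = v)"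

lemma transports_trans:
  assumes "transports \<gamma> p q" "transports \<gamma> q r" "p \<le> q" "q \<le> r"
  shows "transports \<gamma> p r"
  unfolding transports_def
proof (intro ballI)
  fix t0 v assume t0: "t0 \<in> {p, r}" and v: "v \<in> tangent_space M (\<gamma> t0)"
  have "\<exists>V W. par_on \<gamma> p q V \<and> par_on \<gamma> q r W \<and> V q = W q \<and> (t0 = p \<and> V p = v \<or> t0 = r \<and> W r = v)"
  proof (cases "t0 = p")
    case True
    then obtain V where V: "par_on \<gamma> p q V" "V p = v" using assms(1) v unfolding transports_def by blast
    moreover have "V q \<in> tangent_space M (\<gamma> q)" using par_onD(1)[OF V(1)] assms(3) by simp
    ultimately show ?thesis using assms(2) True unfolding transports_def by (metis insertI1)
  next
    case False
    with t0 have r: "t0 = r" by simp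
    then obtain W where W: "par_on \<gamma> q r W" "W r = v" using assms(2) v unfolding transports_def by blast
    moreover have "W q \<in> tangent_space M (\<gamma> q)" using par_onD(1)[OF W(1)] assms(4) by simp
    ultimately show ?thesis using assms(1) r unfolding transports_def by (metis insertI1 insertI2)
  qed
  then obtain V W where VW: "par_on \<gamma> p q V" "par_on \<gamma> q r W" "V q = W q" "t0 = p \<and> V p = v \<or> t0 = r \<and> W r = v"
    by blast
  have "(if t0 \<le> q then V t0 else W t0) = v" using VW(3,4) assms(3,4) by (cases "r = q") auto
  with par_on_glue[OF VW(1-3)] show "\<exists>V. par_on \<gamma> p r V \<and> V t0 = v"
    by (intro exI[of _ "\<lambda>t. if t \<le> q then V t else W t"]) simp
qed

text \<open>\<open>Bolzano\<close> reduces the claim to gluing and to short intervals around a point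
  \<open>z\<close>. Near \<open>z\<close> the curve stays in one chart and the Christoffel term has
  a bound \<open>K\<close>, so intervals shorter than \<open>1 / (2 * K)\<close> are covered by
  \<open>par_on_chart\<close>.\<close>

lemma transports_smooth_curve:
  assumes "smooth_curve M {a..b} \<gamma>" "a \<le> b"
  shows "transports \<gamma> a b"
proof -
  have "a \<le> a \<longrightarrow> b \<le> b \<longrightarrow> transports \<gamma> a b"
    using assms(2)
  proof (induction rule: Bolzano[where P="\<lambda>p q. a \<le> p \<longrightarrow> q \<le> b \<longrightarrow> transports \<gamma> p q"])
    case (trans p q r)
    then show ?case using transports_trans[of \<gamma> p q r] by auto
  next
    case (local z)
    have "\<gamma> z \<in> topspace (mtop M)"
      using assms local unfolding smooth_curve_def by (auto simp: continuous_map_def)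
    then obtain i where i: "i \<in> charts_at M (\<gamma> z)" using chart_exists by blast
    have zJ: "z \<in> {a..b}" using local by simp
    obtain d h h' where d: "d > 0" and dom: "\<And>t. t \<in> {a..b} \<Longrightarrow> \<bar>t - z\<bar> < d \<Longrightarrow> \<gamma> t \<in> cdom M i \<and> h t = cmap M i (\<gamma> t)"
      and h: "\<And>t. \<bar>t - z\<bar> < d \<Longrightarrow> (h has_vector_derivative h' t) (at t)" "continuous_on {z - d<..<z + d} h'"
      using smooth_curve_local[OF assms(1) zJ i] by blast
    define I where "I = {max a (z - d/2)..min b (z + d/2)}"
    have I: "t \<in> {a..b} \<and> \<bar>t - z\<bar> < d" if "t \<in> I" for t using that d by (auto simp: I_def abs_less_iff)
    have him: "h t \<in> img i" if "t \<in> I" for t using dom I[OF that] by auto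
    note i' = charts_atD(1)[OF i]
    have hc: "continuous_on I h"
      by (intro continuous_at_imp_continuous_on ballI has_vector_derivative_continuous[OF h(1)]) (use I in blast)
    have h'c: "continuous_on I h'" by (rule continuous_on_subset[OF h(2)], rule subsetI, drule I) (auto simp: abs_less_iff)
    \<comment> \<open>A continuous majorant of the operator norm of
      \<open>Gam i (h t) (h' t)\<close>; its boundedness on the compact interval gives one
      \<open>K\<close> for all parameters.\<close>
    define N where "N t = (\<Sum>k\<in>Basis. \<Sum>l\<in>Basis. \<bar>h' t \<bullet> k\<bar> * norm (Gam i (h t) k l))" for t
    have "continuous_on I N"
      unfolding N_def
      by (intro continuous_intros h'c continuous_on_compose2[OF Ck_on_continuous[OF Ck_Gam[OF i', of 0]] hc])
        (use him in auto)
    then have "bounded (N ` I)" unfolding I_def by (intro compact_imp_bounded compact_continuous_image) auto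
    then obtain K where K: "K > 0" "\<And>t. t \<in> I \<Longrightarrow> N t \<le> K" unfolding bounded_pos by fastforce
    have GK: "norm (Gam i (h t) (h' t) w) \<le> K * norm w" if "t \<in> I" for t w
    proof -
      note lG = linear_Gam[OF i' him[OF that]]
      have "Gam i (h t) (h' t) w = (\<Sum>k\<in>Basis. (h' t \<bullet> k) *\<^sub>R (\<Sum>l\<in>Basis. (w \<bullet> l) *\<^sub>R Gam i (h t) k l))"
        by (subst linear_expand[OF lG(1)], intro sum.cong refl arg_cong2[where f=scaleR] linear_expand[OF lG(2)])
      also have "norm \<dots> \<le> (\<Sum>k\<in>Basis. \<Sum>l\<in>Basis. \<bar>h' t \<bullet> k\<bar> * (norm w * norm (Gam i (h t) k l)))"
        unfolding scaleR_sum_right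
        by (intro sum_norm_le) (auto simp: abs_mult mult.assoc intro!: mult_left_mono mult_right_mono Basis_le_norm)
      also have "\<dots> = N t * norm w" by (simp add: N_def sum_distrib_right sum_distrib_left mult_ac)
      also have "\<dots> \<le> K * norm w" by (intro mult_right_mono K that) simp
      finally show ?thesis .
    qed
    define e where "e = min (d/2) (1 / (2 * K))"
    have e: "e > 0" using d K by (simp add: e_def)
    have "transports \<gamma> p q" if pq: "p \<le> z" "z \<le> q" "q - p < e" "a \<le> p" "q \<le> b" for p q
      unfolding transports_def
    proof (intro ballI)
      fix t0 v assume "t0 \<in> {p, q}" and v: "v \<in> tangent_space M (\<gamma> t0)"
      then have t0: "t0 \<in> {p..q}" using pq by auto
      have sub: "{p..q} \<subseteq> I" using pq by (auto simp: I_def e_def)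
      have "K * (q - p) \<le> K * (1 / (2 * K))" using pq K by (intro mult_left_mono) (auto simp: e_def)
      then have Kq: "K * (q - p) \<le> 1/2" using K by simp
      have "\<exists>V. par_on \<gamma> p q V \<and> V t0 = v \<and> (\<forall>t\<in>{p..q}. norm (V t i) \<le> 2 * norm (v i))"
      proof (rule par_on_chart[OF i', where h=h and h'=h' and K=K])
        show "\<gamma> t \<in> cdom M i \<and> h t = cmap M i (\<gamma> t)" if "t \<in> {p..q}" for t
          using that sub I[of t] by (intro dom) auto
        show "(h has_vector_derivative h' t) (at t)" if "t \<in> {p..q}" for t
          using that sub I[of t] by (intro h) auto
        show "continuous_on {p..q} h'" by (rule continuous_on_subset[OF h'c sub])
        show "norm (Gam i (h t) (h' t) w) \<le> K * norm w" if "t \<in> {p..q}" for t w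
          using that sub by (intro GK) auto
      qed (use K Kq t0 v in auto)
      then show "\<exists>V. par_on \<gamma> p q V \<and> V t0 = v" by blast
    qed
    then show ?case using e by blast
  qed
  then show ?thesis by simp
qed

text \<open>\<open>Bolzano\<close> once more: close to \<open>z\<close> only \<open>z\<close> itself
  can be a break point, so a short interval around it splits there into two smooth pieces. Either
  piece may shrink to a point, hence the degenerate case treated as \<open>refl\<close>.\<close>

lemma transports_piecewise:
  assumes "piecewise_smooth_path M \<gamma>" shows "transports \<gamma> 0 1"
proof -
  obtain S where S: "finite S" "\<And>a b. 0 \<le> a \<Longrightarrow> a < b \<Longrightarrow> b \<le> 1 \<Longrightarrow> {a<..<b} \<inter> S = {} \<Longrightarrow> smooth_curve M {a..b} \<gamma>"
    using assms unfolding piecewise_smooth_path_def by blast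
  have refl: "transports \<gamma> a a" if "a \<in> {0..1}" for a
    unfolding transports_def
  proof (intro ballI)
    fix t0 v assume "t0 \<in> {a, a}" "v \<in> tangent_space M (\<gamma> t0)"
    moreover have "continuous_on {t \<in> {a..a}. \<gamma> t \<in> cdom M i} f" for i and f :: "real \<Rightarrow> 'e"
      by (rule continuous_on_subset[of "{a}"]) auto
    ultimately show "\<exists>V. par_on \<gamma> a a V \<and> V t0 = v"
      by (intro exI[of _ "\<lambda>_. v"]) (auto simp: par_on_def)
  qed
  have smooth: "transports \<gamma> a b" if "0 \<le> a" "a \<le> b" "b \<le> 1" "{a<..<b} \<inter> S = {}" for a b
    using that refl[of a] S(2)[of a b] transports_smooth_curve[of a b \<gamma>] by (cases "a = b") auto
  have "(0::real) \<le> 0 \<longrightarrow> (1::real) \<le> 1 \<longrightarrow> transports \<gamma> 0 1"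
    using zero_le_one
  proof (induction rule: Bolzano[where P="\<lambda>p q. 0 \<le> p \<longrightarrow> q \<le> 1 \<longrightarrow> transports \<gamma> p q"])
    case (trans p q r)
    then show ?case using transports_trans[of \<gamma> p q r] by auto
  next
    case (local z)
    obtain d where d: "d > 0" "\<And>s. s \<in> S \<Longrightarrow> \<bar>s - z\<bar> < d \<Longrightarrow> s = z"
      using finite_real_isolated[OF S(1)] by blast
    have "transports \<gamma> p q" if pq: "p \<le> z" "z \<le> q" "q - p < d" "0 \<le> p" "q \<le> 1" for p q
    proof -
      have "{p<..<z} \<inter> S = {}" "{z<..<q} \<inter> S = {}"
        using d(2) pq by (force simp: abs_less_iff)+
      then show ?thesis
        using transports_trans[of \<gamma> p z q] smooth[of p z] smooth[of z q] pq by auto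
    qed
    then show ?case using d(1) by blast
  qed
  then show ?thesis by simp
qed

end

section \<open>Parallel fields: preservation of the metric and change of parameter\<close>

context pseudo_riemannian_manifold
begin

text \<open>Off a finite set the derivative of the inner product vanishes by
  \<open>metric_compatible\<close>; at the break points and the ends continuity suffices.\<close>

lemma par_on_metric_const:
  assumes \<gamma>: "continuous_map (top_of_set {a..b}) (mtop M) \<gamma>"
    and reg: "finite R" "\<And>t. t \<in> {a<..<b} - R \<Longrightarrow> regular_at \<gamma> t"
    and V: "par_on \<gamma> a b V" and W: "par_on \<gamma> a b W" and t: "t \<in> {a..b}"
  shows "g (\<gamma> t) (V t) (W t) = g (\<gamma> a) (V a) (W a)"
proof -
  define F where "F t = g (\<gamma> t) (V t) (W t)" for t
  have F: "F t = mc i (cmap M i (\<gamma> t)) (V t i) (W t i)" if "t \<in> {a..b}" "i \<in> charts_at M (\<gamma> t)" for t i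
    unfolding F_def using mc_g[OF that(2)] par_onD(1)[OF V that(1)] par_onD(1)[OF W that(1)] by blast
  have top: "\<gamma> t \<in> topspace (mtop M)" if "t \<in> {a..b}" for t
    using \<gamma> that by (auto simp: continuous_map_def)
  have "continuous (at z within {a..b}) F" if z: "z \<in> {a..b}" for z
  proof -
    obtain i where i: "i \<in> charts_at M (\<gamma> z)" using chart_exists top[OF z] by blast
    note i' = charts_atD[OF i]
    define D where "D = {t \<in> {a..b}. \<gamma> t \<in> cdom M i}"
    have ch: "i \<in> charts_at M (\<gamma> t)" "t \<in> {a..b}" "cmap M i (\<gamma> t) \<in> img i" if "t \<in> D" for t
      using that i' by (auto simp: D_def charts_at_def)
    have "openin (top_of_set {a..b}) {t \<in> topspace (top_of_set {a..b}). \<gamma> t \<in> cdom M i}"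
      using \<gamma> openin_cdom[OF i'(1)] by (intro openin_continuous_map_preimage) auto
    then obtain T where T: "open T" "D = {a..b} \<inter> T" by (auto simp: openin_open D_def)
    have zT: "z \<in> T" "z \<in> D" using T(2) z i'(2) by (auto simp: D_def)
    have "continuous_map (top_of_set D) (subtopology (mtop M) (cdom M i)) \<gamma>"
    proof -
      have "continuous_map (top_of_set D) (mtop M) \<gamma>"
        by (rule continuous_map_from_subtopology_mono[OF \<gamma>]) (auto simp: D_def)
      then show ?thesis by (auto simp: continuous_map_in_subtopology D_def)
    qed
    from continuous_map_compose[OF this continuous_cmap[OF i'(1)]]
    have cc: "continuous_on D (\<lambda>t. cmap M i (\<gamma> t))" by (simp add: o_def)
    have "continuous_on D (\<lambda>t. \<Sum>k\<in>Basis. \<Sum>l\<in>Basis. ((V t i \<bullet> k) * (W t i \<bullet> l)) * mc i (cmap M i (\<gamma> t)) k l)"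
      using par_onD(2)[OF V i'(1)] par_onD(2)[OF W i'(1)] unfolding D_def[symmetric]
      by (intro continuous_intros continuous_on_compose2[OF Ck_on_continuous[OF Ck_mc[OF i'(1), of 0]] cc])
        (use ch in auto)
    then have "continuous_on D F"
      by (rule continuous_on_eq) (simp add: F[OF ch(2,1)] mc_expand[OF i'(1) ch(3)])
    then have "continuous (at z within D) F" using zT(2) continuous_on_eq_continuous_within by blast
    moreover have "at z within {a..b} = at z within D"
      by (rule at_within_nhd[OF zT(1) T(1)]) (use T(2) in auto)
    ultimately show ?thesis by simp
  qed
  then have Fc: "continuous_on {a..b} F" by (simp add: continuous_on_eq_continuous_within)
  obtain S T where S: "finite S" "\<And>t. t \<in> {a<..<b} - S \<Longrightarrow> parallel_at M g \<gamma> V t"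
    and T: "finite T" "\<And>t. t \<in> {a<..<b} - T \<Longrightarrow> parallel_at M g \<gamma> W t"
    using par_onD(3)[OF V] par_onD(3)[OF W] by blast
  have "F t = F a"
  proof (rule has_derivative_zero_unique_strong_interval[OF _ Fc refl _ t])
    show "finite (R \<union> S \<union> T \<union> {a, b})" using reg S T by simp
    fix s assume s: "s \<in> {a..b} - (R \<union> S \<union> T \<union> {a, b})"
    then have s': "s \<in> {a<..<b}" "s \<in> {a..b}" by auto
    obtain i where i: "i \<in> charts_at M (\<gamma> s)" using chart_exists top s'(2) by blast
    note i' = charts_atD[OF i]
    have im: "cmap M i (\<gamma> s) \<in> img i" using i' by blast
    let ?X = "cmap M i (\<gamma> s)" and ?c = "velocity M \<gamma> s i"
    have rs: "regular_at \<gamma> s" using reg(2) s s' by blast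
    have dX: "((\<lambda>s. cmap M i (\<gamma> s)) has_derivative (\<lambda>r. r *\<^sub>R ?c)) (at s)"
      using regular_atD(1)[OF rs i] unfolding has_vector_derivative_def o_def .
    have dV: "((\<lambda>s. V s i) has_derivative (\<lambda>r. r *\<^sub>R (- Gam i ?X ?c (V s i)))) (at s)"
      using S(2)[of s] s s' i unfolding parallel_at_def has_vector_derivative_def by blast
    have dW: "((\<lambda>s. W s i) has_derivative (\<lambda>r. r *\<^sub>R (- Gam i ?X ?c (W s i)))) (at s)"
      using T(2)[of s] s s' i unfolding parallel_at_def has_vector_derivative_def by blast
    have z: "dm i ?X (r *\<^sub>R ?c) (V s i) (W s i) + mc i ?X (r *\<^sub>R (- Gam i ?X ?c (V s i))) (W s i)
        + mc i ?X (V s i) (r *\<^sub>R (- Gam i ?X ?c (W s i))) = 0" for r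
    proof -
      have n: "mc i ?X (- u) v = - mc i ?X u v" "mc i ?X v (- u) = - mc i ?X v u" for u v
        using linear_neg[OF linear_mc_left[OF i'(1) im]] linear_neg[OF linear_mc_right[OF i'(1) im]] by blast+
      show ?thesis
        unfolding mc_scale_left[OF i'(1) im] mc_scale_right[OF i'(1) im] n
          metric_compatible[OF i'(1) im] linear_scale[OF linear_Gam(1)[OF i'(1) im]]
          mc_scale_left[OF i'(1) im] mc_scale_right[OF i'(1) im]
        by (simp add: algebra_simps)
    qed
    have "((\<lambda>s. mc i (cmap M i (\<gamma> s)) (V s i) (W s i)) has_derivative (\<lambda>r. 0)) (at s)"
      using mc_deriv_compose[OF i'(1) im dX dV dW] unfolding z .
    moreover have "\<forall>\<^sub>F s in nhds s. mc i (cmap M i (\<gamma> s)) (V s i) (W s i) = F s"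
    proof (rule eventually_elim2[OF regular_atD(2)[OF rs i] eventually_nhds_greaterThanLessThan[of a s b]])
      show "mc i (cmap M i (\<gamma> s)) (V s i) (W s i) = F s" if "\<gamma> s \<in> cdom M i" "s \<in> {a<..<b}" for s
        using F[of s i] that i'(1) by (simp add: charts_at_def)
    qed (use s' in auto)
    ultimately have "(F has_vector_derivative 0) (at s)"
      using has_vector_derivative_transform_nhds[of "\<lambda>s. mc i (cmap M i (\<gamma> s)) (V s i) (W s i)" 0 s F]
      by (simp add: has_vector_derivative_def)
    then show "(F has_derivative (\<lambda>h. 0)) (at s within {a..b})"
      using has_derivative_at_withinI[of F] by (simp add: has_vector_derivative_def)
  qed
  then show ?thesis unfolding F_def .
qed

text \<open>The Christoffel term is linear in the velocity, so both sides of the transport equation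
  acquire the factor \<open>\<alpha>\<close>.\<close>

lemma parallel_at_affine:
  assumes "regular_at \<gamma> (\<alpha> * t + \<beta>)" "parallel_at M g \<gamma> V (\<alpha> * t + \<beta>)"
  shows "parallel_at M g (\<lambda>s. \<gamma> (\<alpha> * s + \<beta>)) (\<lambda>s. V (\<alpha> * s + \<beta>)) t"
  unfolding parallel_at_def
proof
  fix i assume i: "i \<in> charts_at M (\<gamma> (\<alpha> * t + \<beta>))"
  note i' = charts_atD[OF i]
  have im: "cmap M i (\<gamma> (\<alpha> * t + \<beta>)) \<in> img i" using i' by blast
  have aff: "((\<lambda>s. \<alpha> * s + \<beta>) has_vector_derivative \<alpha>) (at t)"
    by (auto intro!: derivative_eq_intros)
  have "(((cmap M i \<circ> \<gamma>) \<circ> (\<lambda>s. \<alpha> * s + \<beta>)) has_vector_derivative \<alpha> *\<^sub>R velocity M \<gamma> (\<alpha> * t + \<beta>) i) (at t)"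
    by (rule vector_diff_chain_at[OF aff regular_atD(1)[OF assms(1) i]])
  then have vel: "velocity M (\<lambda>s. \<gamma> (\<alpha> * s + \<beta>)) t i = \<alpha> *\<^sub>R velocity M \<gamma> (\<alpha> * t + \<beta>) i"
    using velocity_self[of i "\<lambda>s. \<gamma> (\<alpha> * s + \<beta>)" t] i by (simp add: o_def)
  have "(((\<lambda>s. V s i) \<circ> (\<lambda>s. \<alpha> * s + \<beta>)) has_vector_derivative
      \<alpha> *\<^sub>R (- Gam i (cmap M i (\<gamma> (\<alpha> * t + \<beta>))) (velocity M \<gamma> (\<alpha> * t + \<beta>) i) (V (\<alpha> * t + \<beta>) i))) (at t)"
    using assms(2) i unfolding parallel_at_def by (intro vector_diff_chain_at[OF aff]) blast
  then show "((\<lambda>s. V (\<alpha> * s + \<beta>) i) has_vector_derivative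
      - Gam i (cmap M i (\<gamma> (\<alpha> * t + \<beta>))) (velocity M (\<lambda>s. \<gamma> (\<alpha> * s + \<beta>)) t i) (V (\<alpha> * t + \<beta>) i)) (at t)"
    unfolding vel linear_scale[OF linear_Gam(1)[OF i'(1) im]] by (simp add: o_def)
qed

text \<open>\<open>\<alpha> \<noteq> 0\<close> keeps the preimage of the exceptional parameters
  finite. Irregular parameters of the curve join them, because the velocity is known to scale only
  at regular ones.\<close>

lemma par_on_affine:
  assumes V: "par_on \<gamma> a b V" and reg: "finite R" "\<And>t. t \<in> {a<..<b} - R \<Longrightarrow> regular_at \<gamma> t"
    and "\<alpha> \<noteq> 0" and closed: "\<And>s. s \<in> {p..q} \<Longrightarrow> \<alpha> * s + \<beta> \<in> {a..b}"
    and opn: "\<And>s. s \<in> {p<..<q} \<Longrightarrow> \<alpha> * s + \<beta> \<in> {a<..<b}"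
  shows "par_on (\<lambda>s. \<gamma> (\<alpha> * s + \<beta>)) p q (\<lambda>s. V (\<alpha> * s + \<beta>))"
  unfolding par_on_def
proof (intro conjI ballI)
  show "V (\<alpha> * s + \<beta>) \<in> tangent_space M (\<gamma> (\<alpha> * s + \<beta>))" if "s \<in> {p..q}" for s
    by (rule par_onD(1)[OF V closed[OF that]])
  show "continuous_on {s \<in> {p..q}. \<gamma> (\<alpha> * s + \<beta>) \<in> cdom M i} (\<lambda>s. V (\<alpha> * s + \<beta>) i)" if "i \<in> idx M" for i
    by (rule continuous_on_compose2[OF par_onD(2)[OF V that]]) (use closed in \<open>auto intro!: continuous_intros\<close>)
  obtain S where S: "finite S" "\<And>t. t \<in> {a<..<b} - S \<Longrightarrow> parallel_at M g \<gamma> V t"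
    using par_onD(3)[OF V] by blast
  have "inj (\<lambda>s. \<alpha> * s + \<beta>)" using \<open>\<alpha> \<noteq> 0\<close> by (auto intro!: injI)
  then have "finite ((\<lambda>s. \<alpha> * s + \<beta>) -` (S \<union> R))" using S(1) reg(1) by (intro finite_vimageI) auto
  moreover have "parallel_at M g (\<lambda>s. \<gamma> (\<alpha> * s + \<beta>)) (\<lambda>s. V (\<alpha> * s + \<beta>)) s"
    if "s \<in> {p<..<q} - (\<lambda>s. \<alpha> * s + \<beta>) -` (S \<union> R)" for s
    by (rule parallel_at_affine[OF reg(2) S(2)]) (use opn[of s] that in auto)
  ultimately show "\<exists>S. finite S \<and> (\<forall>t\<in>{p<..<q} - S. parallel_at M g (\<lambda>s. \<gamma> (\<alpha> * s + \<beta>)) (\<lambda>s. V (\<alpha> * s + \<beta>)) t)"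
    by blast
qed

lemma par_on_cong:
  assumes V: "par_on \<gamma> a b V" and eq: "\<And>t. t \<in> {a..b} \<Longrightarrow> \<gamma> t = \<delta> t"
  shows "par_on \<delta> a b V"
  unfolding par_on_def
proof (intro conjI ballI)
  show "V t \<in> tangent_space M (\<delta> t)" if "t \<in> {a..b}" for t
    using par_onD(1)[OF V that] eq[OF that] by simp
  have "{t \<in> {a..b}. \<delta> t \<in> cdom M i} = {t \<in> {a..b}. \<gamma> t \<in> cdom M i}" for i using eq by auto
  then show "continuous_on {t \<in> {a..b}. \<delta> t \<in> cdom M i} (\<lambda>t. V t i)" if "i \<in> idx M" for i
    using par_onD(2)[OF V that] by simp
  obtain S where S: "finite S" "\<And>t. t \<in> {a<..<b} - S \<Longrightarrow> parallel_at M g \<gamma> V t"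
    using par_onD(3)[OF V] by blast
  have "parallel_at M g \<delta> V t" if t: "t \<in> {a<..<b} - S" for t
  proof (rule parallel_at_cong[OF S(2)[OF t]])
    show "\<forall>\<^sub>F s in nhds t. \<gamma> s = \<delta> s \<and> V s = V s"
      by (rule eventually_mono[OF eventually_nhds_greaterThanLessThan[of a t b]]) (use t eq in auto)
  qed
  with S(1) show "\<exists>S. finite S \<and> (\<forall>t\<in>{a<..<b} - S. parallel_at M g \<delta> V t)" by blast
qed

end

subsection \<open>Composition and reversal of paths\<close>

definition pjoin :: "(real \<Rightarrow> 'a) \<Rightarrow> (real \<Rightarrow> 'a) \<Rightarrow> real \<Rightarrow> 'a" where
  "pjoin \<gamma> \<delta> t = (if t \<le> 1 / 2 then \<gamma> (2 * t) else \<delta> (2 * t - 1))"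

definition preverse :: "(real \<Rightarrow> 'a) \<Rightarrow> real \<Rightarrow> 'a" where
  "preverse \<gamma> t = \<gamma> (1 - t)"

lemma pjoin_ends [simp]: "pjoin \<gamma> \<delta> 0 = \<gamma> 0" "pjoin \<gamma> \<delta> 1 = \<delta> 1"
  by (simp_all add: pjoin_def)

lemma preverse_ends [simp]: "preverse \<gamma> 0 = \<gamma> 1" "preverse \<gamma> 1 = \<gamma> 0" "preverse (preverse \<gamma>) = \<gamma>"
  by (simp_all add: preverse_def fun_eq_iff)

context charted_manifold
begin

lemma piecewise_smooth_pathE:
  assumes "piecewise_smooth_path M \<gamma>"
  obtains S where "continuous_map (top_of_set {0..1}) (mtop M) \<gamma>" "finite S"
    "\<And>a b. 0 \<le> a \<Longrightarrow> a < b \<Longrightarrow> b \<le> 1 \<Longrightarrow> {a<..<b} \<inter> S = {} \<Longrightarrow> smooth_curve M {a..b} \<gamma>"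
  using assms unfolding piecewise_smooth_path_def pathin_def by blast

lemma piecewise_smooth_pathI:
  assumes "pathin (mtop M) \<gamma>" "finite S"
    "\<And>a b. 0 \<le> a \<Longrightarrow> a < b \<Longrightarrow> b \<le> 1 \<Longrightarrow> {a<..<b} \<inter> S = {} \<Longrightarrow> smooth_curve M {a..b} \<gamma>"
  shows "piecewise_smooth_path M \<gamma>"
  unfolding piecewise_smooth_path_def using assms(3) by (intro conjI exI[of _ S] assms(1,2)) simp

text \<open>With the midpoint added to the exceptional parameters, an interval that avoids them lies
  in one half, where the joined path is an affine reparametrization of one of the two paths.\<close>

lemma piecewise_smooth_pjoin:
  assumes "piecewise_smooth_path M \<gamma>" "piecewise_smooth_path M \<delta>" "\<gamma> 1 = \<delta> 0"
  shows "piecewise_smooth_path M (pjoin \<gamma> \<delta>)"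
proof -
  obtain S where S: "continuous_map (top_of_set {0..1}) (mtop M) \<gamma>" "finite S"
    "\<And>a b. 0 \<le> a \<Longrightarrow> a < b \<Longrightarrow> b \<le> 1 \<Longrightarrow> {a<..<b} \<inter> S = {} \<Longrightarrow> smooth_curve M {a..b} \<gamma>"
    using piecewise_smooth_pathE[OF assms(1)] by blast
  obtain T where T: "continuous_map (top_of_set {0..1}) (mtop M) \<delta>" "finite T"
    "\<And>a b. 0 \<le> a \<Longrightarrow> a < b \<Longrightarrow> b \<le> 1 \<Longrightarrow> {a<..<b} \<inter> T = {} \<Longrightarrow> smooth_curve M {a..b} \<delta>"
    using piecewise_smooth_pathE[OF assms(2)] by blast
  have "continuous_map (top_of_set {0..1}) (mtop M) (\<lambda>t. if t \<le> 1 / 2 then \<gamma> (2 * t) else \<delta> (2 * t - 1))"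
  proof (rule continuous_map_cases_le)
    have "continuous_map (top_of_set ({0..1} \<inter> {x. x \<in> {0..1} \<and> x \<le> 1 / 2})) (top_of_set {0..1}) (\<lambda>t::real. 2 * t)"
      by (auto intro!: continuous_intros)
    from continuous_map_compose[OF this S(1)]
    show "continuous_map (subtopology (top_of_set {0..1}) {x \<in> topspace (top_of_set {0..1}). x \<le> 1 / 2}) (mtop M) (\<lambda>t. \<gamma> (2 * t))"
      by (simp add: subtopology_subtopology o_def)
    have "continuous_map (top_of_set ({0..1} \<inter> {x. x \<in> {0..1} \<and> 1 / 2 \<le> x})) (top_of_set {0..1}) (\<lambda>t::real. 2 * t - 1)"
      by (auto intro!: continuous_intros)
    from continuous_map_compose[OF this T(1)]
    show "continuous_map (subtopology (top_of_set {0..1}) {x \<in> topspace (top_of_set {0..1}). 1 / 2 \<le> x}) (mtop M) (\<lambda>t. \<delta> (2 * t - 1))"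
      by (simp add: subtopology_subtopology o_def)
    show "\<gamma> (2 * t) = \<delta> (2 * t - 1)" if "t = 1 / 2" for t
      unfolding that using assms(3) by simp
  qed auto
  then have pin: "pathin (mtop M) (pjoin \<gamma> \<delta>)" unfolding pathin_def pjoin_def .
  have sm: "smooth_curve M {a..b} (pjoin \<gamma> \<delta>)"
    if ab: "0 \<le> a" "a < b" "b \<le> 1"
      and disj: "{a<..<b} \<inter> ((\<lambda>s. s / 2) ` S \<union> (\<lambda>s. (s + 1) / 2) ` T \<union> {1 / 2}) = {}" for a b
  proof -
    have "\<not> (a < 1 / 2 \<and> 1 / 2 < b)" using disj by auto
    then consider "b \<le> 1 / 2" | "1 / 2 \<le> a" by linarith
    then show ?thesis
    proof cases
      case 1
      have "{2 * a<..<2 * b} \<inter> S = {}"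
      proof (rule ccontr)
        assume "{2 * a<..<2 * b} \<inter> S \<noteq> {}"
        then obtain s where "s \<in> S" "2 * a < s" "s < 2 * b" by auto
        then have "s / 2 \<in> {a<..<b} \<inter> ((\<lambda>s. s / 2) ` S \<union> (\<lambda>s. (s + 1) / 2) ` T \<union> {1 / 2})" by auto
        with disj show False by blast
      qed
      with S(3)[of "2 * a" "2 * b"] ab 1 have "smooth_curve M {2 * a..2 * b} \<gamma>" by simp
      then have "smooth_curve M {a..b} (\<lambda>s. \<gamma> (2 * s + 0))" by (rule smooth_curve_affine) auto
      then show ?thesis by (rule smooth_curve_cong) (use 1 in \<open>auto simp: pjoin_def\<close>)
    next
      case 2
      have "{2 * a - 1<..<2 * b - 1} \<inter> T = {}"
      proof (rule ccontr)
        assume "{2 * a - 1<..<2 * b - 1} \<inter> T \<noteq> {}"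
        then obtain s where "s \<in> T" "2 * a - 1 < s" "s < 2 * b - 1" by auto
        then have "(s + 1) / 2 \<in> {a<..<b} \<inter> ((\<lambda>s. s / 2) ` S \<union> (\<lambda>s. (s + 1) / 2) ` T \<union> {1 / 2})" by auto
        with disj show False by blast
      qed
      with T(3)[of "2 * a - 1" "2 * b - 1"] ab 2 have "smooth_curve M {2 * a - 1..2 * b - 1} \<delta>" by simp
      then have "smooth_curve M {a..b} (\<lambda>s. \<delta> (2 * s + (- 1)))" by (rule smooth_curve_affine) auto
      then show ?thesis
      proof (rule smooth_curve_cong)
        fix s assume "s \<in> {a..b}"
        then show "\<delta> (2 * s + - 1) = pjoin \<gamma> \<delta> s"
        proof (cases "s = 1 / 2")
          case True
          show ?thesis unfolding True pjoin_def using assms(3) by simp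
        qed (use 2 in \<open>auto simp: pjoin_def\<close>)
      qed
    qed
  qed
  have fin: "finite ((\<lambda>s. s / 2) ` S \<union> (\<lambda>s. (s + 1) / 2) ` T \<union> {1 / 2})" using S(2) T(2) by simp
  show ?thesis by (rule piecewise_smooth_pathI[OF pin fin sm])
qed

lemma piecewise_smooth_preverse:
  assumes "piecewise_smooth_path M \<gamma>"
  shows "piecewise_smooth_path M (preverse \<gamma>)"
proof -
  obtain S where S: "continuous_map (top_of_set {0..1}) (mtop M) \<gamma>" "finite S"
    "\<And>a b. 0 \<le> a \<Longrightarrow> a < b \<Longrightarrow> b \<le> 1 \<Longrightarrow> {a<..<b} \<inter> S = {} \<Longrightarrow> smooth_curve M {a..b} \<gamma>"
    using piecewise_smooth_pathE[OF assms(1)] by blast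
  have "continuous_map (top_of_set {0..1}) (top_of_set {0..1}) (\<lambda>t::real. 1 - t)"
    by (auto intro!: continuous_intros)
  from continuous_map_compose[OF this S(1)] have pin: "pathin (mtop M) (preverse \<gamma>)"
    unfolding pathin_def preverse_def o_def .
  have sm: "smooth_curve M {a..b} (preverse \<gamma>)"
    if ab: "0 \<le> a" "a < b" "b \<le> 1" and disj: "{a<..<b} \<inter> (\<lambda>s. 1 - s) ` S = {}" for a b
  proof -
    have "{1 - b<..<1 - a} \<inter> S = {}"
    proof (rule ccontr)
      assume "{1 - b<..<1 - a} \<inter> S \<noteq> {}"
      then obtain s where "s \<in> S" "1 - b < s" "s < 1 - a" by auto
      then have "1 - s \<in> {a<..<b} \<inter> (\<lambda>s. 1 - s) ` S" by auto
      with disj show False by blast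
    qed
    with S(3)[of "1 - b" "1 - a"] ab have "smooth_curve M {1 - b..1 - a} \<gamma>" by simp
    then have "smooth_curve M {a..b} (\<lambda>s. \<gamma> ((- 1) * s + 1))" by (rule smooth_curve_affine) auto
    then show ?thesis by (rule smooth_curve_cong) (simp add: preverse_def)
  qed
  have fin: "finite ((\<lambda>s. 1 - s) ` S)" using S(2) by simp
  show ?thesis by (rule piecewise_smooth_pathI[OF pin fin sm])
qed

end

section \<open>Parallel transport between end points and holonomy-invariant subspaces\<close>

context pseudo_riemannian_manifold
begin

text \<open>A relation and not a function: existence, composition and reversal only manipulate
  fields along curves, and functionality is derived afterwards from the isometry property.\<close>

definition ptrans where
  "ptrans \<gamma> v w \<longleftrightarrow> piecewise_smooth_path M \<gamma> \<and> (\<exists>V. parallel_along M g \<gamma> V \<and> V 0 = v \<and> V 1 = w)"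

lemma ptrans_tangent:
  assumes "ptrans \<gamma> v w" shows "v \<in> tangent_space M (\<gamma> 0)" "w \<in> tangent_space M (\<gamma> 1)"
  using assms unfolding ptrans_def parallel_along_def by (metis atLeastAtMost_iff order_refl zero_le_one)+

lemma ptrans_top:
  assumes "piecewise_smooth_path M \<gamma>" "t \<in> {0..1}" shows "\<gamma> t \<in> topspace (mtop M)"
  using assms unfolding piecewise_smooth_path_def pathin_def by (auto simp: continuous_map_def)

lemma ptrans_exists:
  assumes "piecewise_smooth_path M \<gamma>" "v \<in> tangent_space M (\<gamma> 0)" shows "\<exists>w. ptrans \<gamma> v w"
  using transports_piecewise[OF assms(1)] assms unfolding transports_def ptrans_def parallel_along_par_on by blast

lemma ptrans_isometry:
  assumes "ptrans \<gamma> v w" "ptrans \<gamma> v' w'" shows "g (\<gamma> 1) w w' = g (\<gamma> 0) v v'"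
proof -
  have psp: "piecewise_smooth_path M \<gamma>" using assms(1) unfolding ptrans_def by blast
  obtain R where R: "finite R" "\<And>t. t \<in> {0<..<1} - R \<Longrightarrow> regular_at \<gamma> t"
    using piecewise_smooth_regular[OF psp] by blast
  obtain V V' where V: "par_on \<gamma> 0 1 V" "V 0 = v" "V 1 = w" and V': "par_on \<gamma> 0 1 V'" "V' 0 = v'" "V' 1 = w'"
    using assms unfolding ptrans_def parallel_along_par_on by blast
  have "continuous_map (top_of_set {0..1}) (mtop M) \<gamma>"
    using psp unfolding piecewise_smooth_path_def pathin_def by blast
  from par_on_metric_const[OF this R V(1) V'(1), of 1] show ?thesis using V V' by simp
qed

lemma ptrans_pjoin:
  assumes "ptrans \<gamma> u v" "ptrans \<delta> v w" "\<gamma> 1 = \<delta> 0"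
  shows "ptrans (pjoin \<gamma> \<delta>) u w"
proof -
  have psp: "piecewise_smooth_path M \<gamma>" "piecewise_smooth_path M \<delta>" using assms unfolding ptrans_def by blast+
  obtain R where R: "finite R" "\<And>t. t \<in> {0<..<1} - R \<Longrightarrow> regular_at \<gamma> t"
    using piecewise_smooth_regular[OF psp(1)] by blast
  obtain Q where Q: "finite Q" "\<And>t. t \<in> {0<..<1} - Q \<Longrightarrow> regular_at \<delta> t"
    using piecewise_smooth_regular[OF psp(2)] by blast
  obtain V W where V: "par_on \<gamma> 0 1 V" "V 0 = u" "V 1 = v" and W: "par_on \<delta> 0 1 W" "W 0 = v" "W 1 = w"
    using assms unfolding ptrans_def parallel_along_par_on by blast
  have "par_on (\<lambda>s. \<gamma> (2 * s + 0)) 0 (1/2) (\<lambda>s. V (2 * s + 0))"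
    by (rule par_on_affine[OF V(1) R]) auto
  then have 1: "par_on (pjoin \<gamma> \<delta>) 0 (1/2) (\<lambda>s. V (2 * s + 0))"
    by (rule par_on_cong) (auto simp: pjoin_def)
  have "par_on (\<lambda>s. \<delta> (2 * s + (- 1))) (1/2) 1 (\<lambda>s. W (2 * s + (- 1)))"
    by (rule par_on_affine[OF W(1) Q]) auto
  then have 2: "par_on (pjoin \<gamma> \<delta>) (1/2) 1 (\<lambda>s. W (2 * s + (- 1)))"
  proof (rule par_on_cong)
    fix s :: real assume "s \<in> {1/2..1}"
    then show "\<delta> (2 * s + - 1) = pjoin \<gamma> \<delta> s"
    proof (cases "s = 1 / 2")
      case True
      show ?thesis unfolding True pjoin_def using assms(3) by simp
    qed (auto simp: pjoin_def)
  qed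
  have "V (2 * (1/2) + 0) = W (2 * (1/2) + (- 1))" using V W by simp
  from par_on_glue[OF 1 2 this]
  have "parallel_along M g (pjoin \<gamma> \<delta>) (\<lambda>t. if t \<le> 1/2 then V (2 * t + 0) else W (2 * t + (- 1)))"
    unfolding parallel_along_par_on .
  with piecewise_smooth_pjoin[OF psp assms(3)] show ?thesis
    unfolding ptrans_def using V W by (intro conjI exI[of _ "\<lambda>t. if t \<le> 1/2 then V (2 * t + 0) else W (2 * t + (- 1))"]) auto
qed

lemma ptrans_preverse:
  assumes "ptrans \<gamma> v w" shows "ptrans (preverse \<gamma>) w v"
proof -
  have psp: "piecewise_smooth_path M \<gamma>" using assms unfolding ptrans_def by blast
  obtain R where R: "finite R" "\<And>t. t \<in> {0<..<1} - R \<Longrightarrow> regular_at \<gamma> t"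
    using piecewise_smooth_regular[OF psp] by blast
  obtain V where V: "par_on \<gamma> 0 1 V" "V 0 = v" "V 1 = w"
    using assms unfolding ptrans_def parallel_along_par_on by blast
  have "par_on (\<lambda>s. \<gamma> ((- 1) * s + 1)) 0 1 (\<lambda>s. V ((- 1) * s + 1))"
    by (rule par_on_affine[OF V(1) R]) auto
  then have "par_on (preverse \<gamma>) 0 1 (\<lambda>s. V ((- 1) * s + 1))"
    by (rule par_on_cong) (simp add: preverse_def)
  with piecewise_smooth_preverse[OF psp] show ?thesis
    unfolding ptrans_def parallel_along_par_on using V by (intro conjI exI[of _ "\<lambda>s. V ((- 1) * s + 1)"]) auto
qed

lemma ptrans_exists_back:
  assumes "piecewise_smooth_path M \<gamma>" "w \<in> tangent_space M (\<gamma> 1)" shows "\<exists>v. ptrans \<gamma> v w"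
  using ptrans_exists[OF piecewise_smooth_preverse[OF assms(1)], of w] assms(2) ptrans_preverse[of "preverse \<gamma>"]
  by auto

lemma tangent_metric_eqI:
  assumes "p \<in> topspace (mtop M)" "u \<in> tangent_space M p" "v \<in> tangent_space M p"
    "\<And>w. w \<in> tangent_space M p \<Longrightarrow> g p u w = g p v w"
  shows "u = v"
proof -
  obtain i where i: "i \<in> charts_at M p" using chart_exists assms(1) by blast
  have im: "cmap M i p \<in> img i" using charts_atD[OF i] by blast
  have "mc i (cmap M i p) (u i) b = mc i (cmap M i p) (v i) b" for b
    using assms(4)[OF of_coords_tangent[OF i, of b]]
    unfolding mc_g[OF i assms(2) of_coords_tangent[OF i]] mc_g[OF i assms(3) of_coords_tangent[OF i]] of_coords_self[OF i] .
  then have "u i = v i" using mc_eqI[OF charts_atD(1)[OF i] im] by blast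
  then show ?thesis using tangent_eqI[OF assms(2,3) i] by blast
qed

text \<open>No uniqueness theorem for differential equations enters. Each \<open>u\<close> at the
  end is the transport of some \<open>u0\<close>, so \<open>w\<close> and \<open>w'\<close> have the
  same product with \<open>u\<close>, namely that of \<open>v\<close> with \<open>u0\<close>;
  nondegeneracy concludes.\<close>

lemma ptrans_unique:
  assumes "ptrans \<gamma> v w" "ptrans \<gamma> v w'" shows "w = w'"
proof (rule tangent_metric_eqI)
  have psp: "piecewise_smooth_path M \<gamma>" using assms unfolding ptrans_def by blast
  show "\<gamma> 1 \<in> topspace (mtop M)" using ptrans_top[OF psp] by simp
  fix u assume "u \<in> tangent_space M (\<gamma> 1)"
  then obtain u0 where "ptrans \<gamma> u0 u" using ptrans_exists_back[OF psp] by blast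
  then show "g (\<gamma> 1) w u = g (\<gamma> 1) w' u" using ptrans_isometry[OF assms(1)] ptrans_isometry[OF assms(2)] by simp
qed (use ptrans_tangent assms in blast)+

text \<open>The device of \<open>ptrans_unique\<close> again: some transport of
  \<open>v + v'\<close> exists, and its products with all vectors at the end identify it.\<close>

lemma ptrans_add:
  assumes "ptrans \<gamma> v w" "ptrans \<gamma> v' w'" shows "ptrans \<gamma> (v + v') (w + w')"
proof -
  have psp: "piecewise_smooth_path M \<gamma>" using assms unfolding ptrans_def by blast
  have top: "\<gamma> 0 \<in> topspace (mtop M)" "\<gamma> 1 \<in> topspace (mtop M)" using ptrans_top[OF psp] by auto
  note T = ptrans_tangent[OF assms(1)] ptrans_tangent[OF assms(2)]
  obtain w'' where w'': "ptrans \<gamma> (v + v') w''" using ptrans_exists[OF psp tangent_add[OF T(1,3)]] by blast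
  have "w'' = w + w'"
  proof (rule tangent_metric_eqI[OF top(2) ptrans_tangent(2)[OF w''] tangent_add[OF T(2,4)]])
    fix u assume u: "u \<in> tangent_space M (\<gamma> 1)"
    then obtain u0 where u0: "ptrans \<gamma> u0 u" using ptrans_exists_back[OF psp] by blast
    show "g (\<gamma> 1) w'' u = g (\<gamma> 1) (w + w') u"
      using g_add[OF top(2) T(2,4) u] g_add[OF top(1) T(1,3) ptrans_tangent(1)[OF u0]]
        ptrans_isometry[OF w'' u0] ptrans_isometry[OF assms(1) u0] ptrans_isometry[OF assms(2) u0] by simp
  qed
  with w'' show ?thesis by simp
qed

lemma ptrans_scale:
  assumes "ptrans \<gamma> v w" shows "ptrans \<gamma> (tscale r v) (tscale r w)"
proof -
  have psp: "piecewise_smooth_path M \<gamma>" using assms unfolding ptrans_def by blast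
  have top: "\<gamma> 0 \<in> topspace (mtop M)" "\<gamma> 1 \<in> topspace (mtop M)" using ptrans_top[OF psp] by auto
  note T = ptrans_tangent[OF assms(1)]
  obtain w'' where w'': "ptrans \<gamma> (tscale r v) w''" using ptrans_exists[OF psp tangent_scale[OF T(1)]] by blast
  have "w'' = tscale r w"
  proof (rule tangent_metric_eqI[OF top(2) ptrans_tangent(2)[OF w''] tangent_scale[OF T(2)]])
    fix u assume u: "u \<in> tangent_space M (\<gamma> 1)"
    then obtain u0 where u0: "ptrans \<gamma> u0 u" using ptrans_exists_back[OF psp] by blast
    show "g (\<gamma> 1) w'' u = g (\<gamma> 1) (tscale r w) u"
      using g_scale[OF top(2) T(2) u] g_scale[OF top(1) T(1) ptrans_tangent(1)[OF u0]]
        ptrans_isometry[OF w'' u0] ptrans_isometry[OF assms(1) u0] by simp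
  qed
  with w'' show ?thesis by simp
qed

text \<open>Invariance is phrased through loops and related vectors instead of maps, the form in
  which a loop can be conjugated by a path.\<close>

definition hol_invariant where
  "hol_invariant p U \<longleftrightarrow> module.subspace tscale U \<and> U \<subseteq> tangent_space M p \<and> nondegenerate_on (g p) U \<and>
     (\<forall>\<gamma> u w. \<gamma> 0 = p \<and> \<gamma> 1 = p \<and> ptrans \<gamma> u w \<and> u \<in> U \<longrightarrow> w \<in> U)"

lemma holonomy_invariantI:
  assumes "p \<in> topspace (mtop M)" "module.subspace tscale U" "U \<subseteq> tangent_space M p" "nondegenerate_on (g p) U"
    "\<forall>P\<in>holonomy_group M g p. P ` U \<subseteq> U"
  shows "hol_invariant p U"
  unfolding hol_invariant_def
proof (intro conjI assms allI impI)
  fix \<gamma> u w assume *: "\<gamma> 0 = p \<and> \<gamma> 1 = p \<and> ptrans \<gamma> u w \<and> u \<in> U"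
  have psp: "piecewise_smooth_path M \<gamma>" using * unfolding ptrans_def by blast
  \<comment> \<open>\<open>holonomy_group\<close> consists of maps on the tangent space, so the
    relation is turned into a map by choice; uniqueness of transport then gives its value at
    \<open>u\<close>.\<close>
  define P where "P = (\<lambda>v\<in>tangent_space M p. SOME w. ptrans \<gamma> v w)"
  have P: "ptrans \<gamma> v (P v)" if "v \<in> tangent_space M p" for v
    unfolding P_def using someI_ex[OF ptrans_exists[OF psp, of v]] that * by simp
  have "P \<in> holonomy_group M g p"
    unfolding holonomy_group_def
  proof (intro CollectI conjI exI[of _ \<gamma>] ballI)
    show "P \<in> tangent_space M p \<rightarrow>\<^sub>E tangent_space M p"
      using ptrans_tangent(2)[OF P] * by (auto simp: P_def PiE_iff)
    show "\<exists>V. parallel_along M g \<gamma> V \<and> V 0 = v \<and> V 1 = P v" if "v \<in> tangent_space M p" for v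
      using P[OF that] unfolding ptrans_def by blast
  qed (use * psp in auto)
  then have "P u \<in> U" using assms(5) * by blast
  moreover have "P u = w" using ptrans_unique[OF P] * assms(3) by blast
  ultimately show "w \<in> U" by simp
qed

text \<open>A loop \<open>\<delta>\<close> at \<open>q\<close> becomes a loop at \<open>p\<close>
  after conjugation with \<open>\<gamma>\<close>. Nondegeneracy passes over because transport is an
  isometry and every vector of \<open>U\<close> has a transport.\<close>

lemma hol_invariant_transfer:
  assumes inv: "hol_invariant p U" and psp: "piecewise_smooth_path M \<gamma>" and ends: "\<gamma> 0 = p" "\<gamma> 1 = q"
  shows "hol_invariant q {w. \<exists>u\<in>U. ptrans \<gamma> u w}"
proof -
  let ?W = "{w. \<exists>u\<in>U. ptrans \<gamma> u w}"
  interpret vs: vector_space "tscale :: real \<Rightarrow> ('i \<Rightarrow> 'e) \<Rightarrow> _" by (rule vector_space_tscale)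
  have U: "vs.subspace U" "U \<subseteq> tangent_space M p" "nondegenerate_on (g p) U"
    using inv unfolding hol_invariant_def by auto
  have scale0: "tscale 0 v = 0" for v :: "'i \<Rightarrow> 'e" by (simp add: tscale_def fun_eq_iff)
  have zero: "ptrans \<gamma> 0 0"
  proof -
    have "0 \<in> tangent_space M (\<gamma> 0)" by (rule tangent_0)
    then obtain w where "ptrans \<gamma> 0 w" using ptrans_exists[OF psp] by blast
    from ptrans_scale[OF this, of 0] show ?thesis by (simp add: scale0)
  qed
  show ?thesis
    unfolding hol_invariant_def
  proof (intro conjI allI impI)
    show "vs.subspace ?W"
    proof (rule vs.subspaceI)
      show "0 \<in> ?W" using zero vs.subspace_0[OF U(1)] by blast
      show "x + y \<in> ?W" if "x \<in> ?W" "y \<in> ?W" for x y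
        using that ptrans_add vs.subspace_add[OF U(1)] by blast
      show "tscale c x \<in> ?W" if "x \<in> ?W" for c x
        using that ptrans_scale vs.subspace_scale[OF U(1)] by blast
    qed
    show "?W \<subseteq> tangent_space M q" using ptrans_tangent(2) ends by blast
    show "nondegenerate_on (g q) ?W"
      unfolding nondegenerate_on_def
    proof (intro ballI impI)
      fix w assume "w \<in> ?W" and orth: "\<forall>v\<in>?W. g q w v = 0"
      then obtain u where u: "u \<in> U" "ptrans \<gamma> u w" by blast
      have "g p u u' = 0" if u': "u' \<in> U" for u'
      proof -
        have "u' \<in> tangent_space M (\<gamma> 0)" using u' U ends by blast
        then obtain w' where w': "ptrans \<gamma> u' w'" using ptrans_exists[OF psp] by blast
        then have "g q w w' = 0" using orth u' by blast
        then show ?thesis using ptrans_isometry[OF u(2) w'] ends by simp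
      qed
      then have "u = 0" using U(3) u(1) unfolding nondegenerate_on_def by blast
      then show "w = 0" using ptrans_unique[OF u(2)] zero by blast
    qed
    fix \<delta> w w' assume *: "\<delta> 0 = q \<and> \<delta> 1 = q \<and> ptrans \<delta> w w' \<and> w \<in> ?W"
    then obtain u where u: "u \<in> U" "ptrans \<gamma> u w" by blast
    have "w' \<in> tangent_space M (\<gamma> 1)" using ptrans_tangent(2) * ends by metis
    then obtain u' where u': "ptrans \<gamma> u' w'" using ptrans_exists_back[OF psp] by blast
    have 1: "ptrans (pjoin \<gamma> \<delta>) u w'" using ptrans_pjoin[OF u(2)] * ends by blast
    have 2: "ptrans (pjoin (pjoin \<gamma> \<delta>) (preverse \<gamma>)) u u'"
      by (rule ptrans_pjoin[OF 1 ptrans_preverse[OF u']]) (use * ends in simp)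
    have "pjoin (pjoin \<gamma> \<delta>) (preverse \<gamma>) 0 = p" "pjoin (pjoin \<gamma> \<delta>) (preverse \<gamma>) 1 = p"
      using ends by simp_all
    then have "u' \<in> U" using inv 2 u(1) unfolding hol_invariant_def by blast
    with u' show "w' \<in> ?W" by blast
  qed
qed

end

section \<open>Geodesics and short coordinate segments\<close>

context charted_manifold
begin

lemma smooth_curve_chart:
  assumes i: "i \<in> idx M" and J: "open J" and x: "\<And>k. Ck_on k x J" "\<And>t. t \<in> J \<Longrightarrow> x t \<in> img i"
  shows "smooth_curve M J (\<lambda>t. cinv M i (x t))"
  unfolding smooth_curve_def
proof (intro conjI ballI)
  have xc: "continuous_on J x" using Ck_on_continuous[OF x(1)] .
  then have "continuous_map (top_of_set J) (top_of_set (img i)) x" using x(2) by auto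
  from continuous_map_compose[OF this continuous_cinv[OF i]]
  show "continuous_map (top_of_set J) (mtop M) (\<lambda>t. cinv M i (x t))" by (simp add: o_def)
  fix j assume j: "j \<in> idx M"
  let ?S = "{t \<in> J. cinv M i (x t) \<in> cdom M j}"
  have S: "x t \<in> overlap i j" if "t \<in> ?S" for t
  proof -
    have "cmap M i (cinv M i (x t)) \<in> overlap i j" using that x(2)[of t] cinv_in[of "x t" i] by (intro overlapI) auto
    then show ?thesis using x(2)[of t] that by simp
  qed
  have S': "t \<in> ?S" if "t \<in> J" "x t \<in> overlap i j" for t
    using that cinv_overlap[OF i that(2)] by simp
  have eq: "?S = J \<inter> x -` overlap i j" using S S' by blast
  have opn: "open ?S" unfolding eq by (rule continuous_open_preimage[OF xc J open_overlap[OF i j]])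
  have "Ck_on k (\<lambda>t. transition M i j (x t)) ?S" for k
    by (rule Ck_on_compose[OF Ck_transition[OF i j] Ck_on_subset[OF x(1)] _ opn]) (use S in auto)
  then have "Ck_on k (cmap M j \<circ> (\<lambda>t. cinv M i (x t))) ?S" for k
    by (simp add: transition_def o_def)
  then show "smooth_on ?S (cmap M j \<circ> (\<lambda>t. cinv M i (x t)))"
    using smooth_on_open[OF opn] by blast
qed

lemma smooth_curve_open_regular:
  assumes "smooth_curve M J \<gamma>" "open J" "t \<in> J" shows "regular_at \<gamma> t"
proof -
  obtain a b where ab: "a < t" "t < b" "{a..b} \<subseteq> J" using open_interval_around[OF assms(2,3)] .
  show ?thesis by (rule smooth_curve_regular[OF smooth_curve_mono[OF assms(1) ab(3)] ab(1,2)])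
qed

lemma smooth_curve_piecewise:
  assumes "smooth_curve M J \<gamma>" "{0..1} \<subseteq> J" shows "piecewise_smooth_path M \<gamma>"
proof (rule piecewise_smooth_pathI[where S="{}"])
  show "pathin (mtop M) \<gamma>"
    using smooth_curve_mono[OF assms] unfolding pathin_def smooth_curve_def by blast
  show "smooth_curve M {a..b} \<gamma>" if "0 \<le> a" "a < b" "b \<le> 1" for a b
    by (rule smooth_curve_mono[OF assms(1)]) (use that assms(2) in \<open>auto simp: subset_iff\<close>)
qed simp

end

section \<open>Light-like geodesics and transport along short segments\<close>

context pseudo_riemannian_manifold
begin

text \<open>In a chart the geodesic equation becomes a first-order autonomous system for position
  and velocity; \<open>parallel_atI\<close> carries the solution back to all charts.\<close>

lemma geodesic_exists:
  assumes p: "p \<in> topspace (mtop M)" and v: "v \<in> tangent_space M p"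
  obtains e \<gamma> where "e > 0" "geodesic M g {-e<..<e} \<gamma>" "\<gamma> 0 = p" "velocity M \<gamma> 0 = v"
proof -
  obtain i where i: "i \<in> charts_at M p" using chart_exists p by blast
  note i' = charts_atD[OF i]
  \<comment> \<open>The quadratic Christoffel term written out in \<open>Basis\<close>, which
    exhibits its joint smoothness in position and velocity.\<close>
  define Q where "Q z = (\<Sum>k\<in>Basis. \<Sum>l\<in>Basis. ((snd z \<bullet> k) * (snd z \<bullet> l)) *\<^sub>R Gam i (fst z) k l)" for z :: "'e \<times> 'e"
  have Q: "Q (x, y) = Gam i x y y" if "x \<in> img i" for x y
  proof -
    have "Gam i x y y = (\<Sum>k\<in>Basis. (y \<bullet> k) *\<^sub>R (\<Sum>l\<in>Basis. (y \<bullet> l) *\<^sub>R Gam i x k l))"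
      by (subst linear_expand[OF linear_Gam(1)[OF i'(1) that]], intro sum.cong refl arg_cong2[where f=scaleR]
          linear_expand[OF linear_Gam(2)[OF i'(1) that]])
    then show ?thesis by (simp add: Q_def scaleR_sum_right)
  qed
  define U where "U = img i \<times> (UNIV :: 'e set)"
  have U: "open U" unfolding U_def by (intro open_Times open_img i' open_UNIV)
  have fs: "Ck_on k fst U" "Ck_on k snd U" for k
    by (intro Ck_on_bounded_linear bounded_linear_fst bounded_linear_snd U)+
  have F0: "Ck_on k (\<lambda>z. (snd z, - Q z)) U" for k
    unfolding Q_def
    by (intro Ck_on_Pair Ck_on_minus Ck_on_sum Ck_on_scaleR Ck_on_mult Ck_on_inner fs Ck_on_const U
        Ck_on_compose[OF Ck_Gam[OF i'(1)] fs(1)]) (auto simp: U_def)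
  have U0: "(cmap M i p, v i) \<in> U" using i' by (auto simp: U_def)
  have "\<exists>e z. e > 0 \<and> z 0 = (cmap M i p, v i) \<and> (\<forall>t\<in>{-e<..<e}. z t \<in> U) \<and>
    (\<forall>t\<in>{-e<..<e}. (z has_vector_derivative (snd (z t), - Q (z t))) (at t)) \<and> (\<forall>k. Ck_on k z {-e<..<e})"
    by (rule autonomous_ode[OF U U0 F0]) blast
  then obtain e z where ez: "e > 0 \<and> z 0 = (cmap M i p, v i) \<and> (\<forall>t\<in>{-e<..<e}. z t \<in> U) \<and>
    (\<forall>t\<in>{-e<..<e}. (z has_vector_derivative (snd (z t), - Q (z t))) (at t)) \<and> (\<forall>k. Ck_on k z {-e<..<e})"
    by (elim exE)
  then have e: "e > 0" and z: "z 0 = (cmap M i p, v i)" "\<And>t. t \<in> {-e<..<e} \<Longrightarrow> z t \<in> U"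
    "\<And>t. t \<in> {-e<..<e} \<Longrightarrow> (z has_vector_derivative (snd (z t), - Q (z t))) (at t)"
    "\<And>k. Ck_on k z {-e<..<e}" by (elim conjE; simp)+
  define x y where "x t = fst (z t)" and "y t = snd (z t)" for t
  have xi: "x t \<in> img i" if "t \<in> {-e<..<e}" for t using z(2)[OF that] by (auto simp: U_def x_def)
  have xd: "(x has_vector_derivative y t) (at t)" if "t \<in> {-e<..<e}" for t
    unfolding x_def y_def
    using bounded_linear.has_vector_derivative[OF bounded_linear_fst z(3)[OF that]] by simp
  have yd: "(y has_vector_derivative - Gam i (x t) (y t) (y t)) (at t)" if "t \<in> {-e<..<e}" for t
  proof -
    have "(y has_vector_derivative - Q (z t)) (at t)"
      unfolding y_def using bounded_linear.has_vector_derivative[OF bounded_linear_snd z(3)[OF that]] by simp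
    moreover have "Q (z t) = Gam i (x t) (y t) (y t)"
      using Q[OF xi[OF that], of "y t"] by (simp add: x_def y_def)
    ultimately show ?thesis by simp
  qed
  define \<gamma> where "\<gamma> t = cinv M i (x t)" for t
  have ev: "\<forall>\<^sub>F s in nhds t. s \<in> {-e<..<e}" if "t \<in> {-e<..<e}" for t
    by (rule eventually_nhds_in_open) (use that in auto)
  have \<gamma>i: "\<gamma> t \<in> cdom M i" "cmap M i (\<gamma> t) = x t" "i \<in> charts_at M (\<gamma> t)" if "t \<in> {-e<..<e}" for t
    using xi[OF that] cinv_in[OF xi[OF that]] i' by (simp_all add: \<gamma>_def charts_at_def)
  have \<gamma>d: "((cmap M i \<circ> \<gamma>) has_vector_derivative y t) (at t)" if "t \<in> {-e<..<e}" for t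
    by (rule has_vector_derivative_transform_nhds[OF xd[OF that]])
      (rule eventually_mono[OF ev[OF that]], simp add: \<gamma>i)
  have ev\<gamma>: "\<forall>\<^sub>F s in nhds t. \<gamma> s \<in> cdom M i" if "t \<in> {-e<..<e}" for t
    by (rule eventually_mono[OF ev[OF that] \<gamma>i(1)])
  have vel: "velocity M \<gamma> t i = y t" "velocity M \<gamma> t \<in> tangent_space M (\<gamma> t)" if "t \<in> {-e<..<e}" for t
    using velocity_self[OF \<gamma>i(3)[OF that] \<gamma>d[OF that]]
      velocity_tangent(1)[OF \<gamma>i(3)[OF that] \<gamma>d[OF that] ev\<gamma>[OF that]] by blast+
  have "parallel_at M g \<gamma> (velocity M \<gamma>) t" if t: "t \<in> {-e<..<e}" for t
  proof (rule parallel_atI[OF \<gamma>i(3)[OF t] \<gamma>d[OF t]])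
    show "\<forall>\<^sub>F s in nhds t. \<gamma> s \<in> cdom M i \<and> velocity M \<gamma> s \<in> tangent_space M (\<gamma> s)"
      by (rule eventually_mono[OF ev[OF t]]) (simp add: \<gamma>i vel)
    have "((\<lambda>s. velocity M \<gamma> s i) has_vector_derivative - Gam i (x t) (y t) (y t)) (at t)"
      by (rule has_vector_derivative_transform_nhds[OF yd[OF t]])
        (rule eventually_mono[OF ev[OF t]], simp add: vel)
    then show "((\<lambda>s. velocity M \<gamma> s i) has_vector_derivative - Gam i (cmap M i (\<gamma> t)) (y t) (velocity M \<gamma> t i)) (at t)"
      by (simp only: \<gamma>i(2)[OF t] vel(1)[OF t])
  qed
  moreover have "smooth_curve M {-e<..<e} \<gamma>"
  proof -
    have xk: "Ck_on k x {-e<..<e}" for k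
      unfolding x_def by (rule Ck_on_compose_linear[OF bounded_linear_fst z(4)]) simp
    show ?thesis unfolding \<gamma>_def by (rule smooth_curve_chart[OF i'(1) _ xk xi]) auto
  qed
  ultimately have "geodesic M g {-e<..<e} \<gamma>"
    unfolding geodesic_def using e by (auto simp: is_interval_oo)
  moreover have 0: "0 \<in> {-e<..<e}" using e by simp
  moreover have g0: "\<gamma> 0 = p" using z(1) i' by (simp add: \<gamma>_def x_def)
  moreover have "velocity M \<gamma> 0 = v"
  proof (rule tangent_eqI[OF _ v i])
    show "velocity M \<gamma> 0 \<in> tangent_space M p" using vel(2)[OF 0] g0 by simp
    show "velocity M \<gamma> 0 i = v i" using vel(1)[OF 0] z(1) by (simp add: y_def)
  qed
  ultimately show ?thesis using that e by blast
qed

lemma geodesic_par_on: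
  assumes "geodesic M g J \<gamma>" "{a..b} \<subseteq> J"
  shows "par_on \<gamma> a b (velocity M \<gamma>)"
proof -
  have geo: "open J" "smooth_curve M J \<gamma>" "\<And>t. t \<in> J \<Longrightarrow> parallel_at M g \<gamma> (velocity M \<gamma>) t"
    using assms(1) unfolding geodesic_def by blast+
  have J: "t \<in> J" if "t \<in> {a..b}" for t using that assms(2) by blast
  show ?thesis
    unfolding par_on_def
  proof (intro conjI ballI)
    show "velocity M \<gamma> t \<in> tangent_space M (\<gamma> t)" if "t \<in> {a..b}" for t
      by (rule regular_velocity_tangent[OF smooth_curve_open_regular[OF geo(2,1) J[OF that]]])
    show "continuous_on {t \<in> {a..b}. \<gamma> t \<in> cdom M i} (\<lambda>t. velocity M \<gamma> t i)" if i: "i \<in> idx M" for i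
    proof (rule continuous_at_imp_continuous_on, rule ballI)
      fix t assume t: "t \<in> {t \<in> {a..b}. \<gamma> t \<in> cdom M i}"
      then have "parallel_at M g \<gamma> (velocity M \<gamma>) t" "i \<in> charts_at M (\<gamma> t)"
        using geo(3) J i by (auto simp: charts_at_def)
      then show "isCont (\<lambda>t. velocity M \<gamma> t i) t"
        unfolding parallel_at_def using has_vector_derivative_continuous by blast
    qed
    show "\<exists>S. finite S \<and> (\<forall>t\<in>{a<..<b} - S. parallel_at M g \<gamma> (velocity M \<gamma>) t)"
      using geo(3) J by (intro exI[of _ "{}"]) auto
  qed
qed

lemma geodesic_speed_const:
  assumes "geodesic M g J \<gamma>" "{a..b} \<subseteq> J" "t \<in> {a..b}"
  shows "g (\<gamma> t) (velocity M \<gamma> t) (velocity M \<gamma> t) = g (\<gamma> a) (velocity M \<gamma> a) (velocity M \<gamma> a)"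
proof -
  have geo: "open J" "smooth_curve M J \<gamma>" using assms(1) unfolding geodesic_def by blast+
  have "continuous_map (top_of_set {a..b}) (mtop M) \<gamma>"
    using smooth_curve_mono[OF geo(2) assms(2)] unfolding smooth_curve_def by blast
  then show ?thesis
    by (rule par_on_metric_const[where R="{}"])
      (use assms geo geodesic_par_on[OF assms(1,2)] in \<open>auto intro!: smooth_curve_open_regular[of J]\<close>)
qed

text \<open>The velocity of a geodesic is parallel, so being null persists on both sides of 0, and
  completeness applies to the short geodesic. Its extension agrees with it near 0 and hence has the
  same initial velocity.\<close>

lemma light_line_exists:
  assumes p: "p \<in> topspace (mtop M)" and v: "v \<in> tangent_space M p" "g p v v = 0"
    and complete: "light_line_complete M g"
  obtains \<gamma> where "light_line_geodesic M g UNIV \<gamma>" "\<gamma> 0 = p" "velocity M \<gamma> 0 = v"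
proof -
  obtain e \<gamma> where \<gamma>: "e > 0" "geodesic M g {-e<..<e} \<gamma>" "\<gamma> 0 = p" "velocity M \<gamma> 0 = v"
    using geodesic_exists[OF p v(1)] by blast
  have "g (\<gamma> t) (velocity M \<gamma> t) (velocity M \<gamma> t) = 0" if t: "t \<in> {-e<..<e}" for t
  proof (cases "0 \<le> t")
    case True
    then have "{0..t} \<subseteq> {-e<..<e}" using t \<gamma>(1) by auto
    from geodesic_speed_const[OF \<gamma>(2) this, of t] True show ?thesis using \<gamma> v by simp
  next
    case False
    then have "{t..0} \<subseteq> {-e<..<e}" using t \<gamma>(1) by auto
    from geodesic_speed_const[OF \<gamma>(2) this, of 0] False show ?thesis using \<gamma> v by simp
  qed
  then have "light_line_geodesic M g {-e<..<e} \<gamma>" unfolding light_line_geodesic_def using \<gamma>(2) by blast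
  then obtain \<delta> where \<delta>: "light_line_geodesic M g UNIV \<delta>" "\<And>t. t \<in> {-e<..<e} \<Longrightarrow> \<delta> t = \<gamma> t"
    using complete unfolding light_line_complete_def by blast
  have 0: "0 \<in> {-e<..<e}" using \<gamma>(1) by simp
  have "\<forall>\<^sub>F s in nhds 0. \<delta> s = \<gamma> s"
    by (rule eventually_mono[OF eventually_nhds_in_open[of "{-e<..<e}"]]) (use \<delta>(2) 0 in auto)
  then have "velocity M \<delta> 0 = v" using velocity_cong \<gamma>(4) by metis
  then show ?thesis using that[OF \<delta>(1)] \<delta>(2)[OF 0] \<gamma>(3) by simp
qed

text \<open>The uniform estimate that makes recurrence usable: the ball depends on its centre only,
  and the factor 2 on neither the segment nor the transported vector.\<close>

lemma short_segments:
  assumes i: "i \<in> charts_at M q"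
  obtains \<rho> where "\<rho> > 0" "ball (cmap M i q) \<rho> \<subseteq> img i"
    "\<And>x y v. x \<in> ball (cmap M i q) \<rho> \<Longrightarrow> y \<in> ball (cmap M i q) \<rho> \<Longrightarrow> v \<in> tangent_space M (cinv M i x) \<Longrightarrow>
       \<exists>w. ptrans (\<lambda>s. cinv M i (x + s *\<^sub>R (y - x))) v w \<and> norm (w i) \<le> 2 * norm (v i)"
proof -
  note i' = charts_atD[OF i]
  obtain R where R: "R > 0" "cball (cmap M i q) R \<subseteq> img i"
    using open_contains_cball[of "img i"] open_img[OF i'(1)] i'(2) by blast
  define N where "N x = (\<Sum>k\<in>Basis. \<Sum>l\<in>Basis. norm (Gam i x k l))" for x
  have "continuous_on (cball (cmap M i q) R) N"
    unfolding N_def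
    by (intro continuous_intros continuous_on_subset[OF Ck_on_continuous[OF Ck_Gam[OF i'(1), of 0]] R(2)])
  then have "bounded (N ` cball (cmap M i q) R)" by (intro compact_imp_bounded compact_continuous_image) auto
  then obtain K where "K > 0" and K0: "\<forall>r\<in>N ` cball (cmap M i q) R. norm r \<le> K" unfolding bounded_pos by blast
  moreover have "N x \<le> K" if "x \<in> cball (cmap M i q) R" for x
    using bspec[OF K0 imageI[OF that]] by (simp add: abs_le_iff)
  ultimately have K: "K > 0" "\<And>x. x \<in> cball (cmap M i q) R \<Longrightarrow> N x \<le> K" by blast+
  have GK: "norm (Gam i x c w) \<le> K * norm c * norm w" if "x \<in> cball (cmap M i q) R" for x c w
  proof -
    have im: "x \<in> img i" using that R(2) by blast
    have "Gam i x c w = (\<Sum>k\<in>Basis. (c \<bullet> k) *\<^sub>R (\<Sum>l\<in>Basis. (w \<bullet> l) *\<^sub>R Gam i x k l))"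
      by (subst linear_expand[OF linear_Gam(1)[OF i'(1) im]], intro sum.cong refl arg_cong2[where f=scaleR]
          linear_expand[OF linear_Gam(2)[OF i'(1) im]])
    also have "norm \<dots> \<le> (\<Sum>k\<in>Basis. \<Sum>l\<in>Basis. norm c * (norm w * norm (Gam i x k l)))"
      unfolding scaleR_sum_right
      by (intro sum_norm_le) (auto simp: abs_mult mult.assoc intro!: mult_mono Basis_le_norm)
    also have "\<dots> = N x * (norm c * norm w)" by (simp add: N_def sum_distrib_right sum_distrib_left mult_ac)
    also have "\<dots> \<le> K * (norm c * norm w)" by (intro mult_right_mono K that) simp
    finally show ?thesis by (simp add: mult.assoc)
  qed
  \<comment> \<open>Two points of the ball are at distance at most \<open>2 * \<rho>\<close>, so on
    the unit parameter interval \<open>K * (2 * \<rho>) \<le> 1 / 2\<close> is the smallness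
    condition of \<open>par_on_chart\<close>.\<close>
  define \<rho> where "\<rho> = min R (1 / (4 * K))"
  have \<rho>: "\<rho> > 0" "ball (cmap M i q) \<rho> \<subseteq> cball (cmap M i q) R" "K * (2 * \<rho>) \<le> 1 / 2"
  proof -
    show "\<rho> > 0" using R K by (simp add: \<rho>_def)
    show "ball (cmap M i q) \<rho> \<subseteq> cball (cmap M i q) R" by (auto simp: \<rho>_def)
    have "\<rho> \<le> 1 / (4 * K)" by (simp add: \<rho>_def)
    then have "K * (2 * \<rho>) \<le> K * (2 * (1 / (4 * K)))" using K by (intro mult_left_mono) auto
    then show "K * (2 * \<rho>) \<le> 1 / 2" using K by simp
  qed
  show ?thesis
  proof (rule that[OF \<rho>(1)])
    show "ball (cmap M i q) \<rho> \<subseteq> img i" using \<rho>(2) R(2) by blast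
    fix x y v assume xy: "x \<in> ball (cmap M i q) \<rho>" "y \<in> ball (cmap M i q) \<rho>" and v: "v \<in> tangent_space M (cinv M i x)"
    define h where "h s = x + s *\<^sub>R (y - x)" for s :: real
    have hb: "h s \<in> ball (cmap M i q) \<rho>" if "s \<in> {0..1}" for s
    proof -
      have "(1 - s) *\<^sub>R x + s *\<^sub>R y \<in> ball (cmap M i q) \<rho>"
        using convexD[OF convex_ball xy, of "1 - s" s] that by simp
      then show ?thesis by (simp add: h_def algebra_simps)
    qed
    have him: "h s \<in> img i" if "s \<in> {0..1}" for s using hb[OF that] \<rho>(2) R(2) by blast
    have hd: "(h has_vector_derivative (y - x)) (at s)" for s
      unfolding h_def by (auto intro!: derivative_eq_intros)
    let ?J = "h -` ball (cmap M i q) \<rho>"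
    have J: "open ?J" unfolding h_def by (intro open_vimage continuous_intros open_ball)
    have hk: "Ck_on k h ?J" for k
      unfolding h_def by (intro Ck_on_add Ck_on_const Ck_on_bounded_linear bounded_linear_scaleR_left J[unfolded h_def])
    have "smooth_curve M ?J (\<lambda>s. cinv M i (h s))"
      by (rule smooth_curve_chart[OF i'(1) J hk]) (use \<rho>(2) R(2) in blast)
    then have psp: "piecewise_smooth_path M (\<lambda>s. cinv M i (h s))"
      by (rule smooth_curve_piecewise) (use hb in auto)
    have nyx: "norm (y - x) \<le> 2 * \<rho>"
      using xy dist_triangle_less_add[of y "cmap M i q" \<rho> x \<rho>] by (simp add: dist_norm norm_minus_commute)
    have "\<exists>V. par_on (\<lambda>s. cinv M i (h s)) 0 1 V \<and> V 0 = v \<and> (\<forall>t\<in>{0..1}. norm (V t i) \<le> 2 * norm (v i))"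
    proof (rule par_on_chart[OF i'(1), where h=h and h'="\<lambda>_. y - x" and K="K * norm (y - x)"])
      show "cinv M i (h t) \<in> cdom M i \<and> h t = cmap M i (cinv M i (h t))" if "t \<in> {0..1}" for t
        using cinv_in[OF him[OF that]] cmap_cinv[OF him[OF that]] by simp
      show "norm (Gam i (h t) (y - x) w) \<le> K * norm (y - x) * norm w" if "t \<in> {0..1}" for t w
        using hb[OF that] \<rho>(2) by (intro GK) blast
      have "K * norm (y - x) \<le> K * (2 * \<rho>)" using nyx K by (intro mult_left_mono) auto
      then show "K * norm (y - x) * (1 - 0) \<le> 1 / 2" using \<rho>(3) by simp
      show "v \<in> tangent_space M (cinv M i (h 0))" using v by (simp add: h_def)
    qed (use K hd in auto)
    then obtain V where "par_on (\<lambda>s. cinv M i (h s)) 0 1 V" "V 0 = v" "\<forall>t\<in>{0..1}. norm (V t i) \<le> 2 * norm (v i)" by blast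
    then have "ptrans (\<lambda>s. cinv M i (h s)) v (V 1) \<and> norm (V 1 i) \<le> 2 * norm (v i)"
      unfolding ptrans_def parallel_along_par_on using psp by auto
    then show "\<exists>w. ptrans (\<lambda>s. cinv M i (x + s *\<^sub>R (y - x))) v w \<and> norm (w i) \<le> 2 * norm (v i)"
      unfolding h_def by blast
  qed
qed

end

section \<open>The cone\<close>

locale cone_base = charted_manifold M for M :: "('a, 'i, 'e::euclidean_space) atlas"
begin

abbreviation "NM \<equiv> cone_manifold M"

lemma cone_manifold_simps [simp]:
  "mtop NM = prod_topology (top_of_set {0<..}) (mtop M)" "idx NM = idx M"
  "cdom NM i = {0<..} \<times> cdom M i" "cmap NM i (r, p) = (r, cmap M i p)"
  by (simp_all add: cone_manifold_def)

lemma cone_img: "cmap NM i ` ({0<..} \<times> S) = {0<..} \<times> cmap M i ` S"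
  by force

lemma cone_overlap: "cmap NM i ` (({0<..} \<times> cdom M i) \<inter> ({0<..} \<times> cdom M j)) = {0<..} \<times> overlap i j"
  unfolding Times_Int_Times Int_absorb by (rule cone_img)

lemma cone_inj: assumes "i \<in> idx M" shows "inj_on (cmap NM i) ({0<..} \<times> cdom M i)"
  using inj_onD[OF inj_cmap[OF assms]] by (auto intro!: inj_onI)

lemma cone_cinv:
  assumes "i \<in> idx M" "r > 0" "x \<in> img i" shows "cinv NM i (r, x) = (r, cinv M i x)"
  unfolding cinv_def[of NM] cone_manifold_simps
  by (rule inv_into_f_eq[OF cone_inj[OF assms(1)]]) (use assms cinv_in in auto)

lemma cone_transition:
  assumes "i \<in> idx M" "r > 0" "x \<in> img i" shows "transition NM i j (r, x) = (r, transition M i j x)"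
  using cone_cinv[OF assms] by (simp add: transition_def)

lemma cone_homeomorphic_map:
  assumes i: "i \<in> idx M"
  shows "homeomorphic_map (subtopology (mtop NM) (cdom NM i)) (top_of_set (cmap NM i ` cdom NM i)) (cmap NM i)"
proof -
  obtain h where h: "homeomorphic_maps (subtopology (mtop M) (cdom M i)) (top_of_set (img i)) (cmap M i) h"
    using homeo[OF i] homeomorphic_map_maps by blast
  have "homeomorphic_maps (top_of_set {0::real<..}) (top_of_set {0<..}) (\<lambda>r. r) (\<lambda>r. r)"
    by (simp add: homeomorphic_maps_def)
  with h have "homeomorphic_maps (prod_topology (top_of_set {0::real<..}) (subtopology (mtop M) (cdom M i)))
     (prod_topology (top_of_set {0<..}) (top_of_set (img i))) (\<lambda>(r, p). (r, cmap M i p)) (\<lambda>(r, x). (r, h x))"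
    unfolding homeomorphic_maps_prod by blast
  then have "homeomorphic_map (prod_topology (top_of_set {0::real<..}) (subtopology (mtop M) (cdom M i)))
     (prod_topology (top_of_set {0<..}) (top_of_set (img i))) (\<lambda>(r, p). (r, cmap M i p))"
    using homeomorphic_map_maps by blast
  moreover have "(\<lambda>(r, p). (r, cmap M i p)) = cmap NM i" by (auto simp: fun_eq_iff)
  moreover have "subtopology (mtop NM) (cdom NM i) = prod_topology (top_of_set {0::real<..}) (subtopology (mtop M) (cdom M i))"
    by (simp add: subtopology_Times subtopology_subtopology)
  moreover have "top_of_set (cmap NM i ` cdom NM i) = prod_topology (top_of_set {0::real<..}) (top_of_set (img i))"
    by (simp add: cone_img)
  ultimately show ?thesis by simp
qed

lemma cone_charted_manifold: "charted_manifold NM"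
proof
  show "(\<Union>i\<in>idx NM. cdom NM i) = topspace (mtop NM)"
    using cover by auto
  fix i assume "i \<in> idx NM"
  then have i: "i \<in> idx M" by simp
  show "openin (mtop NM) (cdom NM i)" using openin_cdom[OF i] by (simp add: openin_prod_Times_iff)
  show "open (cmap NM i ` cdom NM i)" using open_img[OF i] by (simp add: cone_img open_Times)
  show "homeomorphic_map (subtopology (mtop NM) (cdom NM i)) (top_of_set (cmap NM i ` cdom NM i)) (cmap NM i)"
    by (rule cone_homeomorphic_map[OF i])
  fix j assume "j \<in> idx NM"
  then have j: "j \<in> idx M" by simp
  have opn: "open ({0::real<..} \<times> overlap i j)" by (intro open_Times open_overlap i j open_greaterThan)
  have fs: "Ck_on k fst ({0::real<..} \<times> overlap i j)" "Ck_on k snd ({0::real<..} \<times> overlap i j)" for k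
    by (intro Ck_on_bounded_linear bounded_linear_fst bounded_linear_snd opn)+
  have "Ck_on k (\<lambda>z. (fst z, transition M i j (snd z))) ({0::real<..} \<times> overlap i j)" for k
    by (rule Ck_on_Pair[OF fs(1) Ck_on_compose[OF Ck_transition[OF i j] fs(2) _ opn] opn]) auto
  then have "Ck_on k (transition NM i j) ({0::real<..} \<times> overlap i j)" for k
    by (rule iffD1[OF Ck_on_cong[OF opn], rotated]) (use cone_transition[OF i] in auto)
  then show "smooth_on (cmap NM i ` (cdom NM i \<inter> cdom NM j)) (transition NM i j)"
    unfolding cone_manifold_simps cone_overlap using smooth_on_open[OF opn] by blast
qed

end

sublocale cone_base \<subseteq> N: charted_manifold "cone_manifold M"
  by (rule cone_charted_manifold)

section \<open>Radial and base components of tangent vectors of the cone\<close>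

context cone_base
begin

lemma cone_charts_at: "r > 0 \<Longrightarrow> charts_at NM (r, p) = charts_at M p"
  by (auto simp: charts_at_def)

lemma cone_Dt:
  assumes "i \<in> idx M" "j \<in> idx M" "r > 0" "x \<in> overlap i j"
  shows "N.Dt i j (r, x) (\<sigma>, a) = (\<sigma>, Dt i j x a)"
proof -
  have D: "(transition M i j has_derivative Dt i j x) (at (snd (r, x)))" using Dt_works[OF assms(1,2,4)] by simp
  have sn: "(snd has_derivative snd) (at (r, x))" by (rule bounded_linear_imp_has_derivative[OF bounded_linear_snd])
  have fn: "(fst has_derivative fst) (at (r, x))" by (rule bounded_linear_imp_has_derivative[OF bounded_linear_fst])
  have "((\<lambda>z. (fst z, transition M i j (snd z))) has_derivative (\<lambda>v. (fst v, Dt i j x (snd v)))) (at (r, x))"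
    by (rule has_derivative_Pair[OF fn has_derivative_compose[OF sn D]])
  then have "(transition NM i j has_derivative (\<lambda>v. (fst v, Dt i j x (snd v)))) (at (r, x))"
  proof (rule has_derivative_transform_within_open)
    show "open ({0::real<..} \<times> overlap i j)" by (intro open_Times open_overlap assms open_greaterThan)
    show "(r, x) \<in> {0<..} \<times> overlap i j" using assms by simp
    show "(fst z, transition M i j (snd z)) = transition NM i j z" if "z \<in> {0<..} \<times> overlap i j" for z
      using that cone_transition[OF assms(1), of "fst z" "snd z" j] by (cases z) auto
  qed
  from fun_cong[OF frechet_derivative_at[OF this], of "(\<sigma>, a)", symmetric] show ?thesis by simp
qed

text \<open>Transition maps of the cone leave the first coordinate untouched, so the first component
  agrees in all charts and the choice in \<open>dx0\<close> does not matter; the second components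
  transform as on \<open>M\<close>.\<close>

lemma cone_tangent:
  assumes r: "r > 0" and u: "u \<in> tangent_space NM (r, p)"
  shows cone_fst: "i \<in> charts_at M p \<Longrightarrow> fst (u i) = dx0 M p u"
    and cone_base_part: "base_part u \<in> tangent_space M p"
proof -
  have comp: "u j = (fst (u i), Dt i j (cmap M i p) (snd (u i)))" if ij: "i \<in> charts_at M p" "j \<in> charts_at M p" for i j
  proof -
    have "u j = N.Dt i j (cmap NM i (r, p)) (u i)"
      using N.tangent_component[OF u] ij cone_charts_at[OF r] by blast
    also have "\<dots> = N.Dt i j (r, cmap M i p) (fst (u i), snd (u i))" by simp
    also have "\<dots> = (fst (u i), Dt i j (cmap M i p) (snd (u i)))"
      by (rule cone_Dt[OF _ _ r overlapI]) (use ij charts_atD in auto)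
    finally show ?thesis .
  qed
  show "fst (u i) = dx0 M p u" if i: "i \<in> charts_at M p"
  proof -
    have "(SOME i. i \<in> charts_at M p) \<in> charts_at M p" using i by (rule someI)
    from comp[OF i this] show ?thesis unfolding dx0_def by (metis fst_conv)
  qed
  show "base_part u \<in> tangent_space M p"
  proof (rule tangentI)
    show "base_part u j = Dt i j (cmap M i p) (base_part u i)" if "i \<in> charts_at M p" "j \<in> charts_at M p" for i j
      using arg_cong[OF comp[OF that], of snd] by (simp add: base_part_def)
    show "base_part u i = 0" if "i \<notin> charts_at M p" for i
      using N.tangent_outside[OF u, of i] that cone_charts_at[OF r] by (simp add: base_part_def zero_prod_def)
  qed
qed

text \<open>The cone vector with radial component \<open>\<sigma>\<close> and base component
  \<open>v\<close>. Its coordinates do not involve the radius, so the same formula serves all points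
  \<open>(r, p)\<close> over \<open>p\<close>; at \<open>(r, p)\<close> the vector
  \<open>lift p r 0\<close> is the value of the radial field.\<close>

definition lift :: "'a \<Rightarrow> real \<Rightarrow> ('i, 'e) tvec \<Rightarrow> ('i, real \<times> 'e) tvec" where
  "lift p \<sigma> v = (\<lambda>i. if i \<in> charts_at M p then (\<sigma>, v i) else 0)"

lemma lift_tangent:
  assumes "r > 0" "v \<in> tangent_space M p" shows "lift p \<sigma> v \<in> tangent_space NM (r, p)"
proof (rule N.tangentI)
  fix i j assume "i \<in> charts_at NM (r, p)" "j \<in> charts_at NM (r, p)"
  then have ij: "i \<in> charts_at M p" "j \<in> charts_at M p" using cone_charts_at[OF assms(1)] by auto
  have "N.Dt i j (r, cmap M i p) (\<sigma>, v i) = (\<sigma>, Dt i j (cmap M i p) (v i))"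
    by (rule cone_Dt[OF _ _ assms(1) overlapI]) (use ij charts_atD in auto)
  then show "lift p \<sigma> v j = N.Dt i j (cmap NM i (r, p)) (lift p \<sigma> v i)"
    using ij tangent_component[OF assms(2) ij] by (simp add: lift_def)
qed (simp add: lift_def cone_charts_at[OF assms(1)])

lemma lift_parts:
  assumes "v \<in> tangent_space M p" "p \<in> topspace (mtop M)"
  shows "dx0 M p (lift p \<sigma> v) = \<sigma>" "base_part (lift p \<sigma> v) = v"
proof -
  obtain i where "i \<in> charts_at M p" using chart_exists[OF assms(2)] by blast
  then have "(SOME i. i \<in> charts_at M p) \<in> charts_at M p" by (rule someI)
  then show "dx0 M p (lift p \<sigma> v) = \<sigma>" by (simp add: dx0_def lift_def)
  show "base_part (lift p \<sigma> v) = v"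
    using tangent_outside[OF assms(1)] by (auto simp: base_part_def lift_def fun_eq_iff)
qed

lemma lift_decompose:
  assumes "r > 0" "u \<in> tangent_space NM (r, p)" shows "u = lift p (dx0 M p u) (base_part u)"
proof
  fix i show "u i = lift p (dx0 M p u) (base_part u) i"
  proof (cases "i \<in> charts_at M p")
    case True
    then show ?thesis using cone_fst[OF assms True] by (simp add: lift_def base_part_def prod_eq_iff)
  next
    case False
    then show ?thesis using N.tangent_outside[OF assms(2), of i] cone_charts_at[OF assms(1)] by (simp add: lift_def)
  qed
qed

lemma lift_add: "lift p (\<sigma> + \<tau>) (u + v) = lift p \<sigma> u + lift p \<tau> v"
  by (auto simp: lift_def fun_eq_iff)

lemma lift_scale: "lift p (c * \<sigma>) (tscale c v) = tscale c (lift p \<sigma> v)"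
  by (auto simp: lift_def fun_eq_iff tscale_def)

lemma cone_of_coords:
  assumes "r > 0" "i \<in> charts_at M p"
  shows "of_coords NM i (r, p) (\<sigma>, a) = lift p \<sigma> (of_coords M i p a)"
proof (rule N.tangent_eqI[of _ "(r, p)" _ i])
  show "i \<in> charts_at NM (r, p)" using assms cone_charts_at by simp
  then show "of_coords NM i (r, p) (\<sigma>, a) i = lift p \<sigma> (of_coords M i p a) i"
    using N.of_coords_self[of i "(r, p)" "(\<sigma>, a)"] of_coords_self[OF assms(2)] assms(2) by (simp add: lift_def)
  show "of_coords NM i (r, p) (\<sigma>, a) \<in> tangent_space NM (r, p)"
    by (rule N.of_coords_tangent) fact
  show "lift p \<sigma> (of_coords M i p a) \<in> tangent_space NM (r, p)"
    by (rule lift_tangent[OF assms(1) of_coords_tangent[OF assms(2)]])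
qed

end

section \<open>The cone metric\<close>

locale riemannian_cone = cone_base M + pseudo_riemannian_manifold M g
  for M :: "('a, 'i, 'e::euclidean_space) atlas" and g
begin

abbreviation "NG \<equiv> cone_metric M g"

lemma cone_metric_lift:
  assumes "p \<in> topspace (mtop M)" "u \<in> tangent_space M p" "v \<in> tangent_space M p"
  shows "NG (r, p) (lift p \<sigma> u) (lift p \<tau> v) = \<sigma> * \<tau> + r\<^sup>2 * g p u v"
  using lift_parts[OF assms(2,1)] lift_parts[OF assms(3,1)] by (simp add: cone_metric_def)

lemma cone_metric_comp:
  assumes "i \<in> idx M" "r > 0" "x \<in> img i"
  shows "metric_comp NM NG i (r, x) (\<sigma>, a) (\<tau>, b) = \<sigma> * \<tau> + r\<^sup>2 * mc i x a b"
proof -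
  have ch: "i \<in> charts_at M (cinv M i x)" "cinv M i x \<in> topspace (mtop M)" using chart_point[OF assms(1,3)] by auto
  show ?thesis
    unfolding metric_comp_def cone_cinv[OF assms] cone_of_coords[OF assms(2) ch(1)]
    by (rule cone_metric_lift[OF ch(2) of_coords_tangent[OF ch(1)] of_coords_tangent[OF ch(1)]])
qed

text \<open>Every tangent vector of the cone is a lift, and on lifts the metric is explicit, so that
  the axioms reduce to those of \<open>g\<close>.\<close>

lemma cone_pseudo_riemannian: "pseudo_riemannian NM NG"
  unfolding pseudo_riemannian_def
proof (intro conjI ballI allI)
  fix z assume z: "z \<in> topspace (mtop NM)"
  obtain r p where rp: "z = (r, p)" "r > 0" "p \<in> topspace (mtop M)" using z by (cases z) auto
  have dec: "\<exists>\<sigma> v. v \<in> tangent_space M p \<and> u = lift p \<sigma> v" if "u \<in> tangent_space NM z" for u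
    using lift_decompose[OF rp(2)] cone_base_part[OF rp(2)] that unfolding rp(1) by blast
  show "NG z u v = NG z v u" if uv: "u \<in> tangent_space NM z" "v \<in> tangent_space NM z" for u v
  proof -
    obtain \<sigma> u' where du: "u' \<in> tangent_space M p" "u = lift p \<sigma> u'" using dec[OF uv(1)] by blast
    obtain \<tau> v' where dv: "v' \<in> tangent_space M p" "v = lift p \<tau> v'" using dec[OF uv(2)] by blast
    note d = du dv
    show ?thesis unfolding rp(1) d(2,4) cone_metric_lift[OF rp(3) d(1,3)] cone_metric_lift[OF rp(3) d(3,1)]
      using g_sym[OF rp(3) d(1,3)] by simp
  qed
  show "NG z (u + v) w = NG z u w + NG z v w"
    if uv: "u \<in> tangent_space NM z" "v \<in> tangent_space NM z" "w \<in> tangent_space NM z" for u v w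
  proof -
    obtain \<sigma> u' where du: "u' \<in> tangent_space M p" "u = lift p \<sigma> u'" using dec[OF uv(1)] by blast
    obtain \<tau> v' where dv: "v' \<in> tangent_space M p" "v = lift p \<tau> v'" using dec[OF uv(2)] by blast
    obtain \<rho> w' where dw: "w' \<in> tangent_space M p" "w = lift p \<rho> w'" using dec[OF uv(3)] by blast
    note d = du dv dw
    show ?thesis
      unfolding rp(1) d(2,4,6) lift_add[symmetric] cone_metric_lift[OF rp(3) tangent_add[OF d(1,3)] d(5)]
        cone_metric_lift[OF rp(3) d(1,5)] cone_metric_lift[OF rp(3) d(3,5)]
      using g_add[OF rp(3) d(1,3,5)] by (simp add: algebra_simps)
  qed
  show "NG z (tscale c u) v = c * NG z u v" if uv: "u \<in> tangent_space NM z" "v \<in> tangent_space NM z" for c u v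
  proof -
    obtain \<sigma> u' where du: "u' \<in> tangent_space M p" "u = lift p \<sigma> u'" using dec[OF uv(1)] by blast
    obtain \<tau> v' where dv: "v' \<in> tangent_space M p" "v = lift p \<tau> v'" using dec[OF uv(2)] by blast
    note d = du dv
    show ?thesis
      unfolding rp(1) d(2,4) lift_scale[symmetric] cone_metric_lift[OF rp(3) tangent_scale[OF d(1)] d(3)]
        cone_metric_lift[OF rp(3) d(1,3)]
      using g_scale[OF rp(3) d(1,3)] by (simp add: algebra_simps)
  qed
  show "nondegenerate_on (NG z) (tangent_space NM z)"
    unfolding nondegenerate_on_def
  proof (intro ballI impI)
    fix u assume u: "u \<in> tangent_space NM z" and 0: "\<forall>v\<in>tangent_space NM z. NG z u v = 0"
    obtain \<sigma> u' where d: "u' \<in> tangent_space M p" "u = lift p \<sigma> u'" using dec[OF u] by blast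
    have *: "\<sigma> * \<tau> + r\<^sup>2 * g p u' v = 0" if "v \<in> tangent_space M p" for \<tau> v
      using bspec[OF 0, of "lift p \<tau> v"] lift_tangent[OF rp(2) that] cone_metric_lift[OF rp(3) d(1) that]
      unfolding rp(1) d(2) by simp
    have "g p u' v = 0" if "v \<in> tangent_space M p" for v using *[OF that, of 0] rp(2) by simp
    then have "u' = 0" using g_nondegenerate[OF rp(3) d(1)] by blast
    moreover have "\<sigma> = 0"
    proof -
      \<comment> \<open>Comparing the test vectors with \<open>\<tau> = 1\<close> and
        \<open>\<tau> = 0\<close> isolates \<open>\<sigma>\<close> without evaluating
        \<open>g p u' 0\<close>.\<close>
      have "\<sigma> * 1 + r\<^sup>2 * g p u' 0 = \<sigma> * 0 + r\<^sup>2 * g p u' 0"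
        using *[OF tangent_0, of 0] *[OF tangent_0, of 1] by (simp only:)
      then show ?thesis by simp
    qed
    ultimately show "u = 0" unfolding d(2) by (auto simp: lift_def fun_eq_iff zero_prod_def)
  qed
next
  fix i and a b :: "real \<times> 'e" assume "i \<in> idx NM"
  then have i: "i \<in> idx M" by simp
  obtain \<sigma> a' \<tau> b' where ab: "a = (\<sigma>, a')" "b = (\<tau>, b')" by (metis surj_pair)
  have opn: "open ({0::real<..} \<times> img i)" by (intro open_Times open_img i open_greaterThan)
  have fs: "Ck_on k fst ({0::real<..} \<times> img i)" "Ck_on k snd ({0::real<..} \<times> img i)" for k
    by (intro Ck_on_bounded_linear bounded_linear_fst bounded_linear_snd opn)+
  have "Ck_on k (\<lambda>z. mc i (snd z) a' b') ({0::real<..} \<times> img i)" for k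
    by (rule Ck_on_compose[OF Ck_mc[OF i] fs(2) _ opn]) auto
  then have "Ck_on k (\<lambda>z. \<sigma> * \<tau> + fst z * fst z * mc i (snd z) a' b') ({0::real<..} \<times> img i)" for k
    by (intro Ck_on_add Ck_on_mult Ck_on_const fs opn)
  then have "Ck_on k (\<lambda>z. metric_comp NM NG i z a b) ({0::real<..} \<times> img i)" for k
    by (rule iffD1[OF Ck_on_cong[OF opn], rotated])
      (auto simp: ab cone_metric_comp[OF i] power2_eq_square)
  then show "smooth_on (cmap NM i ` cdom NM i) (\<lambda>z. metric_comp NM NG i z a b)"
    unfolding cone_manifold_simps cone_img using smooth_on_open[OF opn] by blast
qed

end

sublocale riemannian_cone \<subseteq> N: pseudo_riemannian_manifold "cone_manifold M" "cone_metric M g"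
  by unfold_locales (rule cone_pseudo_riemannian)

section \<open>The connection of the cone along curves of constant radius\<close>

context riemannian_cone
begin

lemma cone_dm:
  assumes "i \<in> idx M" "r > 0" "x \<in> img i"
  shows "N.dm i (r, x) (\<rho>, c) (\<sigma>, a) (\<tau>, b) = 2 * r * \<rho> * mc i x a b + r\<^sup>2 * dm i x c a b"
proof -
  have D: "((\<lambda>y. mc i y a b) has_derivative (\<lambda>c. dm i x c a b)) (at (snd (r, x)))" using mc_deriv[OF assms(1,3)] by simp
  have sn: "(snd has_derivative snd) (at (r, x))" by (rule bounded_linear_imp_has_derivative[OF bounded_linear_snd])
  have fn: "(fst has_derivative fst) (at (r, x))" by (rule bounded_linear_imp_has_derivative[OF bounded_linear_fst])
  have "((\<lambda>z. \<sigma> * \<tau> + (fst z * fst z) * mc i (snd z) a b) has_derivative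
      (\<lambda>v. 0 + ((fst (r, x) * fst (r, x)) * dm i x (snd v) a b + (fst (r, x) * fst v + fst v * fst (r, x)) * mc i (snd (r, x)) a b))) (at (r, x))"
    by (intro has_derivative_add has_derivative_const has_derivative_mult fn has_derivative_compose[OF sn D])
  then have "((\<lambda>z. metric_comp NM NG i z (\<sigma>, a) (\<tau>, b)) has_derivative
      (\<lambda>v. 0 + ((fst (r, x) * fst (r, x)) * dm i x (snd v) a b + (fst (r, x) * fst v + fst v * fst (r, x)) * mc i (snd (r, x)) a b))) (at (r, x))"
  proof (rule has_derivative_transform_within_open)
    show "open ({0::real<..} \<times> img i)" by (intro open_Times open_img assms open_greaterThan)
    show "(r, x) \<in> {0<..} \<times> img i" using assms by simp
    show "\<sigma> * \<tau> + (fst z * fst z) * mc i (snd z) a b = metric_comp NM NG i z (\<sigma>, a) (\<tau>, b)" if "z \<in> {0<..} \<times> img i" for z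
      using that cone_metric_comp[OF assms(1), of "fst z" "snd z"] by (cases z) (auto simp: power2_eq_square)
  qed
  from fun_cong[OF frechet_derivative_at[OF this], of "(\<rho>, c)", symmetric]
  show ?thesis unfolding N.dm_def by (simp add: power2_eq_square algebra_simps)
qed

text \<open>Only directions \<open>(0, a)\<close> are evaluated, as curves of constant radius
  involve no others. The first component is the second fundamental form of the level set. For
  \<open>\<sigma> = r\<close> and \<open>b = 0\<close> the value is \<open>(0, a)\<close>: the
  covariant derivative of the radial field is the identity on such directions.\<close>

lemma cone_Gam:
  assumes "i \<in> idx M" "r > 0" "x \<in> img i"
  shows "N.Gam i (r, x) (0, a) (\<sigma>, b) = (- (r * mc i x a b), Gam i x a b + (\<sigma> / r) *\<^sub>R a)"
proof (rule N.mc_eqI)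
  show i: "i \<in> idx NM" using assms by simp
  show im: "(r, x) \<in> N.img i" using assms by (simp add: cone_img)
  fix z :: "real \<times> 'e"
  obtain \<zeta> c where z: "z = (\<zeta>, c)" by (metis surj_pair)
  have "N.mc i (r, x) (N.Gam i (r, x) (0, a) (\<sigma>, b)) z = N.koszul i (r, x) (0, a) (\<sigma>, b) z"
    by (rule N.Gam_koszul[OF i im])
  also have "\<dots> = r\<^sup>2 * koszul i x a b c + r * \<sigma> * mc i x a c - r * \<zeta> * mc i x a b"
    unfolding N.koszul_def koszul_def z cone_dm[OF assms] by (simp add: field_simps)
  also have "\<dots> = N.mc i (r, x) (- (r * mc i x a b), Gam i x a b + (\<sigma> / r) *\<^sub>R a) z"
    unfolding z cone_metric_comp[OF assms] mc_add_left[OF assms(1,3)] mc_scale_left[OF assms(1,3)] Gam_koszul[OF assms(1,3)]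
    using assms(2) by (simp add: field_simps power2_eq_square)
  finally show "N.mc i (r, x) (N.Gam i (r, x) (0, a) (\<sigma>, b)) z
      = N.mc i (r, x) (- (r * mc i x a b), Gam i x a b + (\<sigma> / r) *\<^sub>R a) z" .
qed

lemma smooth_curve_cone:
  assumes r: "r > 0" and \<gamma>: "smooth_curve M J \<gamma>"
  shows "smooth_curve NM J (\<lambda>t. (r, \<gamma> t))"
  unfolding smooth_curve_def
proof (intro conjI ballI)
  have "continuous_map (top_of_set J) (mtop M) \<gamma>" using \<gamma> unfolding smooth_curve_def by blast
  then show "continuous_map (top_of_set J) (mtop NM) (\<lambda>t. (r, \<gamma> t))"
    using r by (simp add: continuous_map_pairwise o_def)
  fix i assume "i \<in> idx NM"
  then have sm: "smooth_on {t \<in> J. \<gamma> t \<in> cdom M i} (cmap M i \<circ> \<gamma>)"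
    using \<gamma> unfolding smooth_curve_def by simp
  have "smooth_on {t \<in> J. \<gamma> t \<in> cdom M i} (cmap NM i \<circ> (\<lambda>t. (r, \<gamma> t)))"
  proof (rule smooth_onI)
    fix t assume "t \<in> {t \<in> J. \<gamma> t \<in> cdom M i}"
    from smooth_onD[OF sm this] obtain U h where U: "open U \<and> t \<in> U \<and> (\<forall>k. Ck_on k h U) \<and>
        (\<forall>y\<in>U \<inter> {t \<in> J. \<gamma> t \<in> cdom M i}. h y = (cmap M i \<circ> \<gamma>) y)" by (elim exE)
    then have "Ck_on k (\<lambda>t. (r, h t)) U" for k by (intro Ck_on_Pair Ck_on_const) auto
    with U show "\<exists>U h. open U \<and> t \<in> U \<and> (\<forall>k. Ck_on k h U) \<and>
        (\<forall>y\<in>U \<inter> {t \<in> J. \<gamma> t \<in> cdom M i}. h y = (cmap NM i \<circ> (\<lambda>t. (r, \<gamma> t))) y)"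
      by (intro exI[of _ U] exI[of _ "\<lambda>t. (r, h t)"]) auto
  qed
  then show "smooth_on {t \<in> J. (r, \<gamma> t) \<in> cdom NM i} (cmap NM i \<circ> (\<lambda>t. (r, \<gamma> t)))" using r by simp
qed

end

section \<open>Symmetric bilinear forms\<close>

locale symmetric_form =
  fixes b :: "'e::euclidean_space \<Rightarrow> 'e \<Rightarrow> real"
  assumes linear_left: "\<And>w. linear (\<lambda>v. b v w)" and sym: "\<And>v w. b v w = b w v"
begin

lemma linear_right: "linear (\<lambda>w. b v w)"
  using linear_left[of v] sym[of v] by simp

lemmas add = linear_left[THEN linear_add] linear_right[THEN linear_add]
lemmas scale = linear_left[THEN linear_scale] linear_right[THEN linear_scale]
lemmas diff = linear_left[THEN linear_diff] linear_right[THEN linear_diff]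

lemma expand: "b v w = (\<Sum>k\<in>Basis. \<Sum>l\<in>Basis. ((v \<bullet> k) * (w \<bullet> l)) * b k l)"
proof -
  have "b v w = (\<Sum>k\<in>Basis. (v \<bullet> k) *\<^sub>R (\<Sum>l\<in>Basis. (w \<bullet> l) *\<^sub>R b k l))"
    by (subst linear_expand[OF linear_left], intro sum.cong refl arg_cong2[where f=scaleR] linear_expand[OF linear_right])
  then show ?thesis by (simp add: sum_distrib_left mult.assoc)
qed

text \<open>The constant is explicit in the matrix entries, so that for the difference of the
  metrics at two points it becomes small as the points approach each other.\<close>

lemma quadratic_bound: "\<bar>b v v\<bar> \<le> (\<Sum>k\<in>Basis. \<Sum>l\<in>Basis. \<bar>b k l\<bar>) * (norm v)\<^sup>2"
proof -
  have "norm (b v v) \<le> (\<Sum>k\<in>Basis. \<Sum>l\<in>Basis. norm v * (norm v * \<bar>b k l\<bar>))"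
    unfolding expand[of v v]
    by (intro sum_norm_le) (auto simp: abs_mult mult.assoc intro!: mult_mono Basis_le_norm)
  also have "\<dots> = (\<Sum>k\<in>Basis. \<Sum>l\<in>Basis. \<bar>b k l\<bar>) * (norm v)\<^sup>2"
    by (simp add: sum_distrib_right sum_distrib_left mult_ac power2_eq_square)
  finally show ?thesis by simp
qed

text \<open>The minimum over the compact unit sphere serves as \<open>c\<close>; homogeneity does
  the rest.\<close>

lemma positive_definite_bound:
  assumes "\<And>v. v \<noteq> 0 \<Longrightarrow> b v v > 0"
  shows "\<exists>c>0. \<forall>v. c * (norm v)\<^sup>2 \<le> b v v"
proof -
  have "continuous_on (sphere 0 1) (\<lambda>v. \<Sum>k\<in>Basis. \<Sum>l\<in>Basis. ((v \<bullet> k) * (v \<bullet> l)) * b k l)"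
    by (intro continuous_intros)
  then have c: "continuous_on (sphere 0 1) (\<lambda>v. b v v)" by (simp only: expand[symmetric])
  obtain v0 where v0: "v0 \<in> sphere 0 1" "\<forall>v\<in>sphere 0 1. b v0 v0 \<le> b v v"
    using continuous_attains_inf[OF compact_sphere _ c] by fastforce
  have "b v0 v0 * (norm v)\<^sup>2 \<le> b v v" for v
  proof (cases "v = 0")
    case False
    then have "b v0 v0 \<le> b ((1 / norm v) *\<^sub>R v) ((1 / norm v) *\<^sub>R v)" by (intro bspec[OF v0(2)]) simp
    also have "\<dots> = b v v / (norm v)\<^sup>2" by (simp add: scale power2_eq_square)
    finally show ?thesis using False by (simp add: field_simps)
  qed (simp add: linear_left[THEN linear_0])
  moreover have "b v0 v0 > 0" using v0(1) by (intro assms) auto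
  ultimately show ?thesis by blast
qed

text \<open>A nonzero vector \<open>x\<close> is completed to two null vectors on the line \<open>x + s w\<close>, where \<open>w\<close> is
  a vector on which the form has the opposite sign.\<close>

lemma null_functional:
  assumes pos: "b u u > 0" and neg: "b w w < 0" and f: "linear f"
    and null: "\<And>v. b v v = 0 \<Longrightarrow> f v = (0::real)"
  shows "f x = 0"
proof (cases "b x x = 0")
  case True
  then show ?thesis by (rule null)
next
  case False
  \<comment> \<open>Either \<open>u\<close> or \<open>w\<close>, depending on the sign of
    \<open>b x x\<close>.\<close>
  then obtain z where z: "b x x * b z z < 0"
    using pos neg by (metis linorder_neqE_linordered_idom mult_neg_pos mult_pos_neg)
  define D where "D = (b x z)\<^sup>2 - b x x * b z z"
  have D: "D > 0" using z zero_le_power2[of "b x z"] unfolding D_def by linarith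
  have zz: "b z z \<noteq> 0" using z by auto
  \<comment> \<open>The roots of the quadratic
    \<open>b (x + c *\<^sub>R z) (x + c *\<^sub>R z)\<close> in \<open>c\<close>; they are real and
    distinct because \<open>b x x\<close> and \<open>b z z\<close> have opposite signs.\<close>
  define s t where "s = (- b x z + sqrt D) / b z z" and "t = (- b x z - sqrt D) / b z z"
  have q: "b (x + c *\<^sub>R z) (x + c *\<^sub>R z) = b x x + 2 * c * b x z + c\<^sup>2 * b z z" for c
    by (simp add: add scale sym[of z x] power2_eq_square algebra_simps)
  have root: "b x x + 2 * c * b x z + c\<^sup>2 * b z z = 0" if c: "c * b z z = - b x z + d" "d\<^sup>2 = D" for c d
  proof -
    have "b z z * (b x x + 2 * c * b x z + c\<^sup>2 * b z z) = b x x * b z z + 2 * (c * b z z) * b x z + (c * b z z)\<^sup>2"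
      by (simp add: power2_eq_square algebra_simps)
    also have "\<dots> = b x x * b z z - (b x z)\<^sup>2 + d\<^sup>2" unfolding c(1) by (simp add: power2_eq_square algebra_simps)
    also have "\<dots> = 0" unfolding c(2) D_def by simp
    finally show ?thesis using zz by simp
  qed
  have "f (x + s *\<^sub>R z) = 0"
    by (rule null) (unfold q, rule root[of _ "sqrt D"], use zz D in \<open>simp_all add: s_def\<close>)
  moreover have "f (x + t *\<^sub>R z) = 0"
    by (rule null) (unfold q, rule root[of _ "- sqrt D"], use zz D in \<open>simp_all add: t_def\<close>)
  ultimately have st: "f x + s * f z = 0" "f x + t * f z = 0" by (simp_all add: linear_add[OF f] linear_scale[OF f])
  have "s - t = 2 * sqrt D / b z z" unfolding s_def t_def diff_divide_distrib[symmetric] by simp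
  then have "s - t \<noteq> 0" using D zz by simp
  moreover have "(s - t) * f z = (f x + s * f z) - (f x + t * f z)" by (simp add: algebra_simps)
  ultimately have "f z = 0" unfolding st by simp
  with st show ?thesis by simp
qed

text \<open>A nonnegative form pairs its isotropic vectors trivially with everything: along a line
  in direction \<open>v\<close> its values are affine in the parameter, so a nonzero slope would
  make them negative somewhere.\<close>

lemma indefinite_if_isotropic_semidefinite:
  assumes nondeg: "\<And>v. (\<And>w. b v w = 0) \<Longrightarrow> v = 0" and v: "v \<noteq> 0" "b v v \<le> 0"
  shows "\<exists>w. b w w < 0"
proof (rule ccontr)
  assume "\<not> (\<exists>w. b w w < 0)"
  then have nn: "b w w \<ge> 0" for w by (meson not_less)
  then have v0: "b v v = 0" using v(2) by (simp add: order_antisym)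
  have "b v w = 0" for w
  proof (rule ccontr)
    assume vw: "b v w \<noteq> 0"
    \<comment> \<open>Chosen so that the form takes the value \<open>- 1\<close> at
      \<open>w + c *\<^sub>R v\<close>.\<close>
    define c where "c = - (b w w + 1) / (2 * b v w)"
    have "b (w + c *\<^sub>R v) (w + c *\<^sub>R v) = b w w + 2 * c * b v w + c\<^sup>2 * b v v"
      by (simp add: add scale sym[of w v] power2_eq_square algebra_simps)
    also have "\<dots> = - 1" using vw by (simp add: v0 c_def field_simps)
    finally show False using nn[of "w + c *\<^sub>R v"] by simp
  qed
  then show False using nondeg v(1) by blast
qed

end

section \<open>Orthogonal projection onto a nondegenerate subspace\<close>

locale nondegenerate_form = symmetric_form b for b :: "'e::euclidean_space \<Rightarrow> 'e \<Rightarrow> real" +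
  fixes S :: "'e set"
  assumes nondegenerate: "\<And>v. (\<And>w. b v w = 0) \<Longrightarrow> v = 0"
    and subspace: "subspace S" and nondegenerate_on: "\<And>u. u \<in> S \<Longrightarrow> (\<And>v. v \<in> S \<Longrightarrow> b u v = 0) \<Longrightarrow> u = 0"
begin

text \<open>The complement of \<open>S\<close> with respect to \<open>b\<close> is the Euclidean
  complement of the image of \<open>S\<close> under the injective map \<open>G\<close>, so the
  dimensions of \<open>S\<close> and its complement add up to \<open>DIM('e)\<close>. Nondegeneracy
  on \<open>S\<close> makes their intersection trivial, hence their sum is everything.\<close>

lemma orthogonal_projection: "\<exists>y\<in>S. \<forall>u\<in>S. b z u = b y u"
proof -
  define G where "G v = (\<Sum>k\<in>Basis. b v k *\<^sub>R k)" for v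
  have lin: "linear G" unfolding G_def
    by (auto intro!: linearI simp: add scale scaleR_add_left sum.distrib scaleR_sum_right)
  have Gi: "G v \<bullet> w = b v w" for v w
  proof -
    have "G v \<bullet> w = (\<Sum>k\<in>Basis. b v k * (k \<bullet> w))" unfolding G_def by (simp add: inner_sum_left)
    also have "\<dots> = b v w" using linear_expand[OF linear_right, of v w] by (simp add: mult.commute inner_commute)
    finally show ?thesis .
  qed
  have inj: "inj G"
  proof (rule linear_injective_0[OF lin, THEN iffD2], intro allI impI)
    fix v assume "G v = 0"
    then show "v = 0" using Gi[of v] by (intro nondegenerate) simp
  qed
  define W where "W = {y \<in> UNIV. \<forall>x\<in>G ` S. orthogonal x y}"
  have W: "y \<in> W \<longleftrightarrow> (\<forall>u\<in>S. b u y = 0)" for y by (simp add: W_def orthogonal_def Gi)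
  have sA: "subspace (G ` S)" using linear_subspace_image[OF lin subspace] .
  have sW: "subspace W" unfolding subspace_def by (auto simp: W add scale linear_right[THEN linear_0])
  have "dim W + dim (G ` S) = dim (UNIV :: 'e set)"
    unfolding W_def by (rule dim_subspace_orthogonal_to_vectors[OF sA subspace_UNIV]) simp
  moreover have "dim (G ` S) = dim S" by (rule dim_image_eq[OF lin inj_on_subset[OF inj]]) simp
  moreover have "dim {x + y |x y. x \<in> S \<and> y \<in> W} + dim (S \<inter> W) = dim S + dim W"
    by (rule dim_sums_Int[OF subspace sW])
  moreover have "S \<inter> W = {0}"
  proof -
    have "u = 0" if u: "u \<in> S" "u \<in> W" for u
      by (rule nondegenerate_on[OF u(1)]) (use u(2) sym[of u] in \<open>simp add: W\<close>)
    then show ?thesis using subspace_0[OF subspace] subspace_0[OF sW] by blast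
  qed
  ultimately have "dim {x + y |x y. x \<in> S \<and> y \<in> W} = DIM('e)" by simp
  then have "span {x + y |x y. x \<in> S \<and> y \<in> W} = UNIV" by (rule dim_eq_full[THEN iffD1])
  then have "{x + y |x y. x \<in> S \<and> y \<in> W} = UNIV"
    unfolding span_eq_iff[THEN iffD2, OF subspace_sums[OF subspace sW]] .
  then have "z \<in> {x + y |x y. x \<in> S \<and> y \<in> W}" by simp
  then obtain y w where yw: "z = y + w" "y \<in> S" "w \<in> W" by blast
  have "b z u = b y u" if u: "u \<in> S" for u
  proof -
    have "b w u = 0" using bspec[OF iffD1[OF W yw(3)] u] unfolding sym[of w u] .
    then show ?thesis by (simp add: yw(1) add)
  qed
  with yw(2) show ?thesis by blast
qed

text \<open>Nondegeneracy on \<open>S\<close> makes \<open>y\<close> unique for given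
  \<open>z\<close>; the projection is therefore linear and, in finite dimension, bounded.\<close>

lemma projection_bound: "\<exists>C. \<forall>z y. y \<in> S \<longrightarrow> (\<forall>u\<in>S. b z u = b y u) \<longrightarrow> \<bar>b y y\<bar> \<le> C * (norm z)\<^sup>2"
proof -
  have ex: "\<forall>z. \<exists>y. y \<in> S \<and> (\<forall>u\<in>S. b z u = b y u)" using orthogonal_projection by blast
  obtain L where L0: "\<forall>z. L z \<in> S \<and> (\<forall>u\<in>S. b z u = b (L z) u)"
    using choice[OF ex] by (elim exE)
  have L: "L z \<in> S" for z using L0 by blast
  have bL: "b (L z) u = b z u" if "u \<in> S" for z u using L0 that by metis
  have uniq: "y = L z" if y: "y \<in> S" "\<And>u. u \<in> S \<Longrightarrow> b y u = b z u" for y z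
  proof -
    have "y - L z = 0"
      by (rule nondegenerate_on) (simp_all add: diff y bL L subspace_diff[OF subspace])
    then show ?thesis by simp
  qed
  have "linear L"
  proof (rule linearI)
    show "L (v + w) = L v + L w" for v w
      by (rule uniq[symmetric]) (simp_all add: add bL L subspace_add[OF subspace])
    show "L (c *\<^sub>R v) = c *\<^sub>R L v" for c v
      by (rule uniq[symmetric]) (simp_all add: scale bL L subspace_scale[OF subspace])
  qed
  then have "bounded_linear L" by (rule linear_linear[THEN iffD2])
  then obtain K where K: "K > 0" "\<And>z. norm (L z) \<le> norm z * K" using bounded_linear.pos_bounded by blast
  define Q where "Q = (\<Sum>k\<in>Basis. \<Sum>l\<in>Basis. \<bar>b k l\<bar>)"
  have Q: "Q \<ge> 0" "\<And>v. \<bar>b v v\<bar> \<le> Q * (norm v)\<^sup>2"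
    unfolding Q_def using quadratic_bound by (auto intro!: sum_nonneg)
  have "\<bar>b y y\<bar> \<le> (Q * K\<^sup>2) * (norm z)\<^sup>2" if y: "y \<in> S" "\<forall>u\<in>S. b z u = b y u" for z y
  proof -
    have "y = L z" by (rule uniq[OF y(1)]) (simp add: y(2))
    then have "\<bar>b y y\<bar> \<le> Q * (norm (L z))\<^sup>2" using Q(2) by blast
    also have "\<dots> \<le> Q * (norm z * K)\<^sup>2" using Q K by (intro mult_left_mono power_mono) auto
    finally show ?thesis by (simp add: power_mult_distrib mult_ac)
  qed
  then show ?thesis by blast
qed

end

section \<open>Recurrence\<close>

text \<open>Division by the square of the integer shows \<open>c = 0\<close>, and division by the
  integer then shows \<open>b = 0\<close>. A bound on an infinite set of integers is all that
  recurrence provides.\<close>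

lemma quadratic_bounded_infinite:
  fixes a b c C :: real
  assumes "infinite I" "\<And>n::nat. n \<in> I \<Longrightarrow> \<bar>a + 2 * real n * b + (real n)\<^sup>2 * c\<bar> \<le> C"
  shows "b = 0"
proof -
  obtain f :: "nat \<Rightarrow> nat" where f: "strict_mono f" "\<And>n. f n \<in> I" using infinite_enumerate[OF assms(1)] by blast
  \<comment> \<open>A strictly increasing sequence satisfies \<open>f k \<ge> k\<close>, so the
    shift by \<open>Suc\<close> makes all \<open>x n\<close> nonzero.\<close>
  define x where "x n = real (f (Suc n))" for n
  have fn: "f (Suc n) \<ge> Suc n" for n using f(1) by (rule seq_suble)
  have xn: "x n \<noteq> 0" for n using fn[of n] by (simp add: x_def)
  have inv0: "(\<lambda>n. inverse (x n)) \<longlonglongrightarrow> 0"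
  proof (rule Lim_null_comparison[OF _ LIMSEQ_inverse_real_of_nat], rule always_eventually, rule allI)
    fix n show "norm (inverse (x n)) \<le> inverse (real (Suc n))"
      using fn[of n] by (auto simp: x_def intro!: le_imp_inverse_le)
  qed
  have bd: "\<bar>a + 2 * x n * b + (x n)\<^sup>2 * c\<bar> \<le> C" for n unfolding x_def using assms(2)[OF f(2)] .
  have "(\<lambda>n. C * (inverse (x n))\<^sup>2) \<longlonglongrightarrow> C * 0\<^sup>2" by (intro tendsto_intros inv0)
  then have l0: "(\<lambda>n. C * (inverse (x n))\<^sup>2) \<longlonglongrightarrow> 0" by simp
  have "(\<lambda>n. (a + 2 * x n * b + (x n)\<^sup>2 * c) * (inverse (x n))\<^sup>2) \<longlonglongrightarrow> 0"
    by (rule Lim_null_comparison[OF _ l0], rule always_eventually)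
      (use bd in \<open>auto simp: abs_mult intro!: mult_right_mono\<close>)
  moreover have "(a + 2 * x n * b + (x n)\<^sup>2 * c) * (inverse (x n))\<^sup>2 = a * (inverse (x n))\<^sup>2 + 2 * b * inverse (x n) + c" for n
    using xn[of n] by (simp add: field_simps power2_eq_square)
  ultimately have "(\<lambda>n. a * (inverse (x n))\<^sup>2 + 2 * b * inverse (x n) + c) \<longlonglongrightarrow> 0" by simp
  moreover have "(\<lambda>n. a * (inverse (x n))\<^sup>2 + 2 * b * inverse (x n) + c) \<longlonglongrightarrow> a * 0\<^sup>2 + 2 * b * 0 + c"
    by (intro tendsto_intros inv0)
  ultimately have c: "c = 0" using LIMSEQ_unique by fastforce
  have "(\<lambda>n. C * \<bar>inverse (x n)\<bar>) \<longlonglongrightarrow> C * \<bar>0\<bar>" by (intro tendsto_intros inv0)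
  then have l1: "(\<lambda>n. C * \<bar>inverse (x n)\<bar>) \<longlonglongrightarrow> 0" by simp
  have "(\<lambda>n. (a + 2 * x n * b) * inverse (x n)) \<longlonglongrightarrow> 0"
    by (rule Lim_null_comparison[OF _ l1], rule always_eventually)
      (use bd c in \<open>auto simp: abs_mult intro!: mult_right_mono\<close>)
  moreover have "(a + 2 * x n * b) * inverse (x n) = a * inverse (x n) + 2 * b" for n
    using xn[of n] by (simp add: field_simps)
  ultimately have "(\<lambda>n. a * inverse (x n) + 2 * b) \<longlonglongrightarrow> 0" by simp
  moreover have "(\<lambda>n. a * inverse (x n) + 2 * b) \<longlonglongrightarrow> a * 0 + 2 * b" by (intro tendsto_intros inv0)
  ultimately show ?thesis using LIMSEQ_unique by fastforce
qed

text \<open>Finitely many of the sets \<open>W q\<close> cover the space, and by the pigeonhole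
  principle one of them catches infinitely many integer times.\<close>

lemma compact_recurrence:
  fixes \<delta> :: "real \<Rightarrow> 'a"
  assumes "compact_space X" "\<And>t. \<delta> t \<in> topspace X"
    and W: "\<And>q. q \<in> topspace X \<Longrightarrow> openin X (W q) \<and> q \<in> W q"
  obtains q where "q \<in> topspace X" "infinite {n. \<delta> (real n) \<in> W q}"
proof -
  have "\<exists>F. finite F \<and> F \<subseteq> W ` topspace X \<and> topspace X \<subseteq> \<Union>F"
    using assms(1) W unfolding compact_space_alt by (elim allE[of _ "W ` topspace X"]) blast
  then obtain F where F: "finite F" "F \<subseteq> W ` topspace X" "topspace X \<subseteq> \<Union>F" by blast
  have "\<forall>n::nat. \<exists>V. V \<in> F \<and> \<delta> (real n) \<in> V" using F(3) assms(2) by blast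
  from choice[OF this] obtain h where h: "\<And>n::nat. h n \<in> F \<and> \<delta> (real n) \<in> h n" by blast
  have "finite (range h)" using finite_subset[OF _ F(1)] h by blast
  then obtain m where m: "infinite {n \<in> UNIV. h n = h m}" using pigeonhole_infinite[of UNIV h] by auto
  obtain q where q: "q \<in> topspace X" "h m = W q" using h[of m] F(2) by blast
  have "{n \<in> UNIV. h n = h m} \<subseteq> {n. \<delta> (real n) \<in> W q}" using h q(2) by auto
  then have "infinite {n. \<delta> (real n) \<in> W q}" using m infinite_super by blast
  with q(1) show ?thesis using that by blast
qed

section \<open>Metric geometry of tangent spaces\<close>

context pseudo_riemannian_manifold
begin

lemma g_add_right:
  assumes "p \<in> topspace (mtop M)" "u \<in> tangent_space M p" "v \<in> tangent_space M p" "w \<in> tangent_space M p"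
  shows "g p w (u + v) = g p w u + g p w v"
  using g_add[OF assms] g_sym[OF assms(1) assms(4) tangent_add[OF assms(2,3)]]
    g_sym[OF assms(1,4,2)] g_sym[OF assms(1,4,3)] by simp

lemma g_scale_right:
  assumes "p \<in> topspace (mtop M)" "u \<in> tangent_space M p" "w \<in> tangent_space M p"
  shows "g p w (tscale r u) = r * g p w u"
  using g_scale[OF assms] g_sym[OF assms(1,3) tangent_scale[OF assms(2)]] g_sym[OF assms(1,3,2)] by simp

lemma g_quadratic:
  assumes "p \<in> topspace (mtop M)" "u \<in> tangent_space M p" "v \<in> tangent_space M p"
  shows "g p (u + tscale r v) (u + tscale r v) = g p u u + 2 * r * g p u v + r\<^sup>2 * g p v v"
proof -
  note T = assms(2,3) tangent_scale[OF assms(3), of r] tangent_add[OF assms(2) tangent_scale[OF assms(3)], of r]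
  show ?thesis
    unfolding g_add[OF assms(1) T(1,3,4)] g_add_right[OF assms(1) T(1,3,1)] g_add_right[OF assms(1) T(1,3,3)]
      g_scale[OF assms(1) T(2,3)] g_scale[OF assms(1) T(2,1)] g_scale_right[OF assms(1) T(2,2)] g_scale_right[OF assms(1) T(2,1)]
    using g_sym[OF assms(1) T(2,1)] by (simp add: power2_eq_square algebra_simps)
qed

lemma symmetric_form_mc:
  assumes "i \<in> idx M" "x \<in> img i" shows "symmetric_form (mc i x)"
  by (rule symmetric_form.intro[OF linear_mc_left[OF assms] mc_sym[OF assms]])

text \<open>Passing to the components in one chart moves \<open>U\<close> into a Euclidean space,
  where the dimension count for projections is available.\<close>

lemma nondegenerate_form_mc:
  assumes p: "p \<in> topspace (mtop M)" and U: "module.subspace tscale U" "U \<subseteq> tangent_space M p" "nondegenerate_on (g p) U"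
    and i: "i \<in> charts_at M p"
  shows "nondegenerate_form (mc i (cmap M i p)) ((\<lambda>v. v i) ` U)"
proof -
  note i' = charts_atD[OF i]
  have x: "cmap M i p \<in> img i" using i' by blast
  interpret vs: vector_space "tscale :: real \<Rightarrow> ('i \<Rightarrow> 'e) \<Rightarrow> _" by (rule vector_space_tscale)
  interpret symmetric_form "mc i (cmap M i p)" by (rule symmetric_form_mc[OF i'(1) x])
  show ?thesis
  proof
    show "v = 0" if "\<And>w. mc i (cmap M i p) v w = 0" for v by (rule mc_nondegenerate[OF i'(1) x that])
    show "subspace ((\<lambda>v. v i) ` U)"
      unfolding subspace_def
    proof (intro conjI ballI allI)
      show "0 \<in> (\<lambda>v. v i) ` U" using vs.subspace_0[OF U(1)] by (rule rev_image_eqI) simp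
      show "a + b \<in> (\<lambda>v. v i) ` U" if ab: "a \<in> (\<lambda>v. v i) ` U" "b \<in> (\<lambda>v. v i) ` U" for a b
      proof -
        obtain u v where "u \<in> U" "a = u i" "v \<in> U" "b = v i" using ab by blast
        then show ?thesis using vs.subspace_add[OF U(1), of u v] by (intro rev_image_eqI[of "u + v"]) simp_all
      qed
      show "c *\<^sub>R a \<in> (\<lambda>v. v i) ` U" if a: "a \<in> (\<lambda>v. v i) ` U" for c a
      proof -
        obtain u where "u \<in> U" "a = u i" using a by blast
        then show ?thesis using vs.subspace_scale[OF U(1), of u c] by (intro rev_image_eqI[of "tscale c u"]) (simp_all add: tscale_def)
      qed
    qed
    show "a = 0" if a: "a \<in> (\<lambda>v. v i) ` U" and 0: "\<And>b. b \<in> (\<lambda>v. v i) ` U \<Longrightarrow> mc i (cmap M i p) a b = 0" for a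
    proof -
      obtain u where u: "u \<in> U" "a = u i" using a by blast
      have "g p u v = 0" if v: "v \<in> U" for v
      proof -
        have "g p u v = mc i (cmap M i p) (u i) (v i)" by (rule mc_g[OF i]) (use u v U(2) in auto)
        then show ?thesis using 0[of "v i"] v u(2) by simp
      qed
      then have "u = 0" using U(3) u(1) unfolding nondegenerate_on_def by blast
      then show ?thesis using u(2) by simp
    qed
  qed
qed

context
  fixes p U
  assumes p: "p \<in> topspace (mtop M)" and U: "module.subspace tscale U" "U \<subseteq> tangent_space M p" "nondegenerate_on (g p) U"
begin

lemma g_projection:
  assumes z: "z \<in> tangent_space M p" shows "\<exists>y\<in>U. \<forall>u\<in>U. g p z u = g p y u"
proof -
  obtain i where i: "i \<in> charts_at M p" using chart_exists p by blast
  interpret nondegenerate_form "mc i (cmap M i p)" "(\<lambda>v. v i) ` U" by (rule nondegenerate_form_mc[OF p U i])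
  obtain y where y: "y \<in> U" "\<forall>b\<in>(\<lambda>v. v i) ` U. mc i (cmap M i p) (z i) b = mc i (cmap M i p) (y i) b"
    using orthogonal_projection[of "z i"] by blast
  have "g p z u = g p y u" if u: "u \<in> U" for u
  proof -
    have uT: "u \<in> tangent_space M p" "y \<in> tangent_space M p" using u y(1) U(2) by blast+
    show ?thesis using bspec[OF y(2) imageI[OF u]] unfolding mc_g[OF i z uT(1)] mc_g[OF i uT(2,1)] .
  qed
  with y(1) show ?thesis by blast
qed

lemma g_projection_bound:
  assumes i: "i \<in> charts_at M p"
  obtains C where "\<And>z y. z \<in> tangent_space M p \<Longrightarrow> y \<in> U \<Longrightarrow> (\<And>u. u \<in> U \<Longrightarrow> g p z u = g p y u) \<Longrightarrow>
    \<bar>g p y y\<bar> \<le> C * (norm (z i))\<^sup>2"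
proof -
  interpret nondegenerate_form "mc i (cmap M i p)" "(\<lambda>v. v i) ` U" by (rule nondegenerate_form_mc[OF p U i])
  obtain C where C: "\<forall>z y. y \<in> (\<lambda>v. v i) ` U \<longrightarrow> (\<forall>u\<in>(\<lambda>v. v i) ` U. mc i (cmap M i p) z u = mc i (cmap M i p) y u) \<longrightarrow>
      \<bar>mc i (cmap M i p) y y\<bar> \<le> C * (norm z)\<^sup>2" using projection_bound by blast
  show ?thesis
  proof (rule that[of C])
    fix z y assume z: "z \<in> tangent_space M p" and y: "y \<in> U" and eq: "\<And>u. u \<in> U \<Longrightarrow> g p z u = g p y u"
    have yT: "y \<in> tangent_space M p" using y U(2) by blast
    have "mc i (cmap M i p) (z i) b = mc i (cmap M i p) (y i) b" if b: "b \<in> (\<lambda>v. v i) ` U" for b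
    proof -
      obtain u where u: "u \<in> U" "b = u i" using b by blast
      have uT: "u \<in> tangent_space M p" using u(1) U(2) by blast
      show ?thesis using eq[OF u(1)] unfolding u(2) mc_g[OF i z uT] mc_g[OF i yT uT] .
    qed
    then have "\<bar>mc i (cmap M i p) (y i) (y i)\<bar> \<le> C * (norm (z i))\<^sup>2" using C y by blast
    then show "\<bar>g p y y\<bar> \<le> C * (norm (z i))\<^sup>2" unfolding mc_g[OF i yT yT] .
  qed
qed

end

text \<open>The difference of the functionals given by \<open>w\<close> and \<open>w'\<close>
  vanishes on null vectors, hence everywhere by \<open>null_functional\<close>. This is the form in
  which the spanning property of null vectors is used.\<close>

lemma null_vectors_separate:
  assumes p: "p \<in> topspace (mtop M)" and pos: "\<exists>u\<in>tangent_space M p. g p u u > 0" and neg: "\<exists>u\<in>tangent_space M p. g p u u < 0"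
    and w: "w \<in> tangent_space M p" "w' \<in> tangent_space M p"
    and null: "\<And>v. v \<in> tangent_space M p \<Longrightarrow> g p v v = 0 \<Longrightarrow> g p w v = g p w' v"
  shows "w = w'"
proof -
  obtain i where i: "i \<in> charts_at M p" using chart_exists p by blast
  note i' = charts_atD[OF i]
  have x: "cmap M i p \<in> img i" using i' by blast
  let ?b = "mc i (cmap M i p)"
  interpret symmetric_form ?b by (rule symmetric_form_mc[OF i'(1) x])
  obtain u1 u2 where u: "u1 \<in> tangent_space M p" "g p u1 u1 > 0" "u2 \<in> tangent_space M p" "g p u2 u2 < 0" using pos neg by blast
  have pos': "?b (u1 i) (u1 i) > 0" using u(2) mc_g[OF i u(1,1)] by simp
  have neg': "?b (u2 i) (u2 i) < 0" using u(4) mc_g[OF i u(3,3)] by simp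
  have lin: "linear (\<lambda>a. ?b (w i) a - ?b (w' i) a)" by (intro linear_compose_sub linear_right)
  have "?b (w i) a - ?b (w' i) a = 0" for a
  proof (rule null_functional[OF pos' neg' lin])
    fix a assume a: "?b a a = 0"
    let ?v = "of_coords M i p a"
    have v: "?v \<in> tangent_space M p" "?v i = a" using of_coords_tangent[OF i] of_coords_self[OF i] by blast+
    have "g p ?v ?v = 0" using a mc_g[OF i v(1,1)] v(2) by simp
    from null[OF v(1) this] show "?b (w i) a - ?b (w' i) a = 0"
      unfolding mc_g[OF i w(1) v(1)] mc_g[OF i w(2) v(1)] v(2) by simp
  qed
  then have "w i = w' i" by (intro mc_eqI[OF i'(1) x]) simp
  then show ?thesis by (rule tangent_eqI[OF w i])
qed

lemma riemannian_if_definite: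
  assumes s: "s \<noteq> 0" and def: "\<And>p v. p \<in> topspace (mtop M) \<Longrightarrow> v \<in> tangent_space M p \<Longrightarrow> v \<noteq> 0 \<Longrightarrow> s * g p v v > 0"
  shows "riemannian M (\<lambda>p u v. s * g p u v)"
  unfolding riemannian_def pseudo_riemannian_def
proof (intro conjI ballI allI impI)
  fix p assume p: "p \<in> topspace (mtop M)"
  show "s * g p u v = s * g p v u" if "u \<in> tangent_space M p" "v \<in> tangent_space M p" for u v
    using g_sym[OF p that] by simp
  show "s * g p (u + v) w = s * g p u w + s * g p v w"
    if "u \<in> tangent_space M p" "v \<in> tangent_space M p" "w \<in> tangent_space M p" for u v w
    using g_add[OF p that] by (simp add: distrib_left)
  show "s * g p (tscale r u) v = r * (s * g p u v)" if "u \<in> tangent_space M p" "v \<in> tangent_space M p" for r u v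
    using g_scale[OF p that] by simp
  show "nondegenerate_on (\<lambda>u v. s * g p u v) (tangent_space M p)"
    unfolding nondegenerate_on_def using g_nondegenerate[OF p] s by simp
next
  fix i a b assume i: "i \<in> idx M"
  have "metric_comp M (\<lambda>p u v. s * g p u v) i x a b = s * mc i x a b" for x by (simp add: metric_comp_def)
  moreover have "Ck_on k (\<lambda>x. s * mc i x a b) (img i)" for k by (intro Ck_on_mult Ck_on_const Ck_mc i open_img)
  ultimately have "\<forall>k. Ck_on k (\<lambda>x. metric_comp M (\<lambda>p u v. s * g p u v) i x a b) (img i)" by simp
  then show "smooth_on (img i) (\<lambda>x. metric_comp M (\<lambda>p u v. s * g p u v) i x a b)"
    by (rule smooth_on_open[OF open_img[OF i], THEN iffD2])
next
  fix p v assume "p \<in> topspace (mtop M)" "v \<in> tangent_space M p" "v \<noteq> 0"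
  then show "0 < s * g p v v" by (rule def)
qed

text \<open>By nondegeneracy, wherever \<open>s * g\<close> is not positive definite it takes a
  negative value; so the complement of the set \<open>P\<close> of definite points is
  \<open>Q\<close>, and both are open. Connectedness leaves only the two trivial cases, and
  indefiniteness rules out that \<open>P\<close> is everything. The cases \<open>s = 1\<close> and
  \<open>s = - 1\<close> yield vectors of both signs at each point.\<close>

lemma not_definite:
  assumes conn: "connected_space (mtop M)" and ind: "indefinite M g" and s: "s \<noteq> 0" and p0: "p0 \<in> topspace (mtop M)"
  shows "\<exists>v\<in>tangent_space M p0. s * g p0 v v < 0"
proof -
  define P where "P = {p \<in> topspace (mtop M). \<forall>v\<in>tangent_space M p. v \<noteq> 0 \<longrightarrow> s * g p v v > 0}"
  define Q where "Q = {p \<in> topspace (mtop M). \<exists>v\<in>tangent_space M p. s * g p v v < 0}"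
  have form: "symmetric_form (\<lambda>a b. s * mc i x a b)" if "i \<in> idx M" "x \<in> img i" for i x
  proof (rule symmetric_form.intro)
    show "linear (\<lambda>a. s * mc i x a b)" for b
      by (auto intro!: linearI simp: mc_add_left[OF that] mc_scale_left[OF that] distrib_left)
    show "s * mc i x a b = s * mc i x b a" for a b using mc_sym[OF that, of a b] by simp
  qed
  have sg: "s * g p v v = s * mc i (cmap M i p) (v i) (v i)" if "i \<in> charts_at M p" "v \<in> tangent_space M p" for p v i
    using mc_g[OF that(1,2,2)] by simp
  have sgo: "s * g p (of_coords M i p a) (of_coords M i p a) = s * mc i (cmap M i p) a a" if "i \<in> charts_at M p" for p i a
    unfolding sg[OF that of_coords_tangent[OF that]] of_coords_self[OF that] ..
  have compl: "topspace (mtop M) - P = Q"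
  proof
    show "topspace (mtop M) - P \<subseteq> Q"
    proof
      fix p assume "p \<in> topspace (mtop M) - P"
      then obtain v where p: "p \<in> topspace (mtop M)" and v: "v \<in> tangent_space M p" "v \<noteq> 0" "s * g p v v \<le> 0"
        by (auto simp: P_def not_less)
      obtain i where i: "i \<in> charts_at M p" using chart_exists p by blast
      note i' = charts_atD[OF i]
      have x: "cmap M i p \<in> img i" using i' by blast
      interpret symmetric_form "\<lambda>a b. s * mc i (cmap M i p) a b" by (rule form[OF i'(1) x])
      have "\<exists>a. s * mc i (cmap M i p) a a < 0"
      proof (rule indefinite_if_isotropic_semidefinite)
        show "a = 0" if "\<And>b. s * mc i (cmap M i p) a b = 0" for a
          using that s by (intro mc_nondegenerate[OF i'(1) x]) simp
        show "v i \<noteq> 0"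
        proof
          assume "v i = 0"
          then have "v = 0" by (intro tangent_eqI[OF v(1) tangent_0 i]) simp
          with v(2) show False ..
        qed
        show "s * mc i (cmap M i p) (v i) (v i) \<le> 0" using v(3) sg[OF i v(1)] by simp
      qed
      then obtain a where a: "s * mc i (cmap M i p) a a < 0" by blast
      have "s * g p (of_coords M i p a) (of_coords M i p a) < 0"
        unfolding sgo[OF i] by (rule a)
      then show "p \<in> Q" unfolding Q_def using p of_coords_tangent[OF i] by blast
    qed
    show "Q \<subseteq> topspace (mtop M) - P"
    proof
      fix p assume "p \<in> Q"
      then obtain v where p: "p \<in> topspace (mtop M)" and v: "v \<in> tangent_space M p" "s * g p v v < 0" unfolding Q_def by blast
      have "v \<noteq> 0"
      proof
        assume "v = 0"
        then have "v = tscale 0 v" by (simp add: tscale_def fun_eq_iff)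
        then have "g p v v = 0" using g_scale[OF p v(1,1), of 0] by simp
        with v(2) show False by simp
      qed
      with v p show "p \<in> topspace (mtop M) - P" unfolding P_def by (auto simp: not_less intro!: bexI[of _ v])
    qed
  qed
  have "openin (mtop M) Q"
  proof (subst openin_subopen, rule ballI)
    fix p assume "p \<in> Q"
    then obtain v where p: "p \<in> topspace (mtop M)" and v: "v \<in> tangent_space M p" "s * g p v v < 0" unfolding Q_def by blast
    obtain i where i: "i \<in> charts_at M p" using chart_exists p by blast
    note i' = charts_atD[OF i]
    \<comment> \<open>A negative vector is moved to nearby points by keeping its coordinates
      fixed.\<close>
    let ?W = "img i \<inter> (\<lambda>x. s * mc i x (v i) (v i)) -` {..<0}"
    have "continuous_on (img i) (\<lambda>x. s * mc i x (v i) (v i))"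
      by (intro continuous_intros Ck_on_continuous[OF Ck_mc[OF i'(1), of 0]])
    then have "open ?W" by (rule continuous_open_preimage[OF _ open_img[OF i'(1)] open_lessThan])
    from openin_chart_preimage[OF i'(1) this]
    have "openin (mtop M) {q \<in> cdom M i. cmap M i q \<in> ?W}" .
    moreover have "p \<in> {q \<in> cdom M i. cmap M i q \<in> ?W}" using i' v(2) sg[OF i v(1)] by auto
    moreover have "{q \<in> cdom M i. cmap M i q \<in> ?W} \<subseteq> Q"
    proof
      fix q assume "q \<in> {q \<in> cdom M i. cmap M i q \<in> ?W}"
      then have q: "i \<in> charts_at M q" "s * mc i (cmap M i q) (v i) (v i) < 0" using i'(1) by (auto simp: charts_at_def)
      have "s * g q (of_coords M i q (v i)) (of_coords M i q (v i)) < 0"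
        unfolding sgo[OF q(1)] by (rule q(2))
      then show "q \<in> Q" unfolding Q_def using charts_at_topspace[OF q(1)] of_coords_tangent[OF q(1)] by blast
    qed
    ultimately show "\<exists>T. openin (mtop M) T \<and> p \<in> T \<and> T \<subseteq> Q" by blast
  qed
  moreover have "openin (mtop M) P"
  proof (subst openin_subopen, rule ballI)
    fix p assume "p \<in> P"
    then have p: "p \<in> topspace (mtop M)" and pos: "\<And>v. v \<in> tangent_space M p \<Longrightarrow> v \<noteq> 0 \<Longrightarrow> s * g p v v > 0" unfolding P_def by blast+
    obtain i where i: "i \<in> charts_at M p" using chart_exists p by blast
    note i' = charts_atD[OF i]
    have x: "cmap M i p \<in> img i" using i' by blast
    interpret F: symmetric_form "\<lambda>a b. s * mc i (cmap M i p) a b" by (rule form[OF i'(1) x])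
    have "s * mc i (cmap M i p) a a > 0" if a: "a \<noteq> 0" for a
    proof -
      have "of_coords M i p a \<noteq> 0" using of_coords_self[OF i, of a] a by auto
      from pos[OF of_coords_tangent[OF i] this] show ?thesis unfolding sgo[OF i] .
    qed
    then obtain c where c: "c > 0" "\<forall>a. c * (norm a)\<^sup>2 \<le> s * mc i (cmap M i p) a a"
      using F.positive_definite_bound by blast
    \<comment> \<open>Measures how far the form has moved from the one at \<open>p\<close>;
      positivity survives while this stays below the definiteness constant \<open>c\<close>.\<close>
    define h where "h x = (\<Sum>k\<in>Basis. \<Sum>l\<in>Basis. \<bar>s * mc i x k l - s * mc i (cmap M i p) k l\<bar>)" for x
    let ?W = "img i \<inter> h -` {..<c}"
    have "continuous_on (img i) h"
      unfolding h_def by (intro continuous_intros Ck_on_continuous[OF Ck_mc[OF i'(1), of 0]])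
    then have "open ?W" by (rule continuous_open_preimage[OF _ open_img[OF i'(1)] open_lessThan])
    from openin_chart_preimage[OF i'(1) this]
    have "openin (mtop M) {q \<in> cdom M i. cmap M i q \<in> ?W}" .
    moreover have "p \<in> {q \<in> cdom M i. cmap M i q \<in> ?W}" using i' c by (auto simp: h_def)
    moreover have "{q \<in> cdom M i. cmap M i q \<in> ?W} \<subseteq> P"
    proof
      fix q assume "q \<in> {q \<in> cdom M i. cmap M i q \<in> ?W}"
      then have q: "i \<in> charts_at M q" "h (cmap M i q) < c" "cmap M i q \<in> img i" using i'(1) by (auto simp: charts_at_def)
      interpret Fq: symmetric_form "\<lambda>a b. s * mc i (cmap M i q) a b" by (rule form[OF i'(1) q(3)])
      interpret D: symmetric_form "\<lambda>a b. s * mc i (cmap M i q) a b - s * mc i (cmap M i p) a b"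
      proof (rule symmetric_form.intro)
        show "linear (\<lambda>a. s * mc i (cmap M i q) a b - s * mc i (cmap M i p) a b)" for b
          by (rule linear_compose_sub[OF Fq.linear_left F.linear_left])
        show "s * mc i (cmap M i q) a b - s * mc i (cmap M i p) a b = s * mc i (cmap M i q) b a - s * mc i (cmap M i p) b a" for a b
          using Fq.sym[of a b] F.sym[of a b] by (simp only:)
      qed
      have "s * g q v v > 0" if v: "v \<in> tangent_space M q" "v \<noteq> 0" for v
      proof -
        have "v i \<noteq> 0"
        proof
          assume "v i = 0"
          then have "v = 0" by (intro tangent_eqI[OF v(1) tangent_0 q(1)]) simp
          with v(2) show False ..
        qed
        then have n: "(norm (v i))\<^sup>2 > 0" by simp
        have "\<bar>s * mc i (cmap M i q) (v i) (v i) - s * mc i (cmap M i p) (v i) (v i)\<bar> \<le> h (cmap M i q) * (norm (v i))\<^sup>2"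
          unfolding h_def by (rule D.quadratic_bound)
        moreover have "h (cmap M i q) * (norm (v i))\<^sup>2 < c * (norm (v i))\<^sup>2" using q(2) n by (rule mult_strict_right_mono)
        moreover have "c * (norm (v i))\<^sup>2 \<le> s * mc i (cmap M i p) (v i) (v i)" using c(2) by blast
        ultimately show ?thesis unfolding sg[OF q(1) v(1)] by linarith
      qed
      then show "q \<in> P" unfolding P_def using charts_at_topspace[OF q(1)] by blast
    qed
    ultimately show "\<exists>T. openin (mtop M) T \<and> p \<in> T \<and> T \<subseteq> P" by blast
  qed
  moreover have "P \<subseteq> topspace (mtop M)" by (auto simp: P_def)
  ultimately have "openin (mtop M) P \<and> closedin (mtop M) P" unfolding closedin_def compl by blast
  then have "P = {} \<or> P = topspace (mtop M)" using conn unfolding connected_space_clopen_in by blast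
  moreover have "P \<noteq> topspace (mtop M)"
  proof
    assume P: "P = topspace (mtop M)"
    have "riemannian M (\<lambda>p u v. s * g p u v)"
    proof (rule riemannian_if_definite[OF s])
      fix p v assume "p \<in> topspace (mtop M)" "v \<in> tangent_space M p" "v \<noteq> 0"
      moreover from this(1) have "p \<in> P" unfolding P .
      ultimately show "s * g p v v > 0" unfolding P_def by blast
    qed
    then show False using ind unfolding indefinite_def by blast
  qed
  ultimately have "p0 \<in> Q" using p0 compl by blast
  then show ?thesis unfolding Q_def by blast
qed

end

section \<open>Parallel fields along light-like geodesics\<close>

context riemannian_cone
begin

text \<open>The combination of \<xi> - t \<delta>' and \<delta>' with constant coefficients
  \<open>c\<close> and \<open>d\<close>; at radius \<open>r\<close> the field \<xi> has radial
  component \<open>r\<close>.\<close>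

definition light_field :: "(real \<Rightarrow> 'a) \<Rightarrow> real \<Rightarrow> real \<Rightarrow> real \<Rightarrow> real \<Rightarrow> ('i, real \<times> 'e) tvec" where
  "light_field \<delta> r c d t = lift (\<delta> t) (c * r) (tscale (d - c * t) (velocity M \<delta> t))"

text \<open>With \<open>\<xi>\<close> the radial field of the cone, \<open>\<nabla>\<xi>\<close> is the identity; so along a light-like geodesic
  \<open>\<delta>\<close> at constant radius, \<open>\<delta>'\<close> and \<open>\<xi> - t \<delta>'\<close> are parallel.\<close>

lemma light_field_par_on:
  assumes \<delta>: "light_line_geodesic M g UNIV \<delta>" and r: "r > 0"
  shows "N.par_on (\<lambda>t. (r, \<delta> t)) a b (light_field \<delta> r c d)"
proof -
  have geo: "smooth_curve M UNIV \<delta>" "\<And>t. parallel_at M g \<delta> (velocity M \<delta>) t"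
    and null: "\<And>t. g (\<delta> t) (velocity M \<delta> t) (velocity M \<delta> t) = 0"
    using \<delta> unfolding light_line_geodesic_def geodesic_def by auto
  have reg: "regular_at \<delta> t" for t by (rule smooth_curve_open_regular[OF geo(1)]) auto
  have velT: "velocity M \<delta> t \<in> tangent_space M (\<delta> t)" for t by (rule regular_velocity_tangent[OF reg])
  have T: "light_field \<delta> r c d t \<in> tangent_space NM (r, \<delta> t)" for t
    unfolding light_field_def by (rule lift_tangent[OF r tangent_scale[OF velT]])
  have deriv: "((\<lambda>s. light_field \<delta> r c d s i) has_vector_derivative
      - N.Gam i (r, cmap M i (\<delta> t)) (0, velocity M \<delta> t i) (light_field \<delta> r c d t i)) (at t)"
    if i: "i \<in> charts_at M (\<delta> t)" for i t
  proof -
    note i' = charts_atD[OF i]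
    let ?x = "cmap M i (\<delta> t)" and ?v = "velocity M \<delta> t i"
    have x: "?x \<in> img i" using i' by blast
    have dv: "((\<lambda>s. velocity M \<delta> s i) has_vector_derivative - Gam i ?x ?v ?v) (at t)"
      using geo(2)[of t] i unfolding parallel_at_def by blast
    have "((\<lambda>s. d - c * s) has_real_derivative - c) (at t)" by (auto intro!: derivative_eq_intros)
    from has_vector_derivative_scaleR[OF this dv]
    have "((\<lambda>s. (d - c * s) *\<^sub>R velocity M \<delta> s i) has_vector_derivative
        (d - c * t) *\<^sub>R (- Gam i ?x ?v ?v) + (- c) *\<^sub>R ?v) (at t)" .
    from has_vector_derivative_Pair[OF has_vector_derivative_const[of "c * r"] this]
    have D: "((\<lambda>s. (c * r, (d - c * s) *\<^sub>R velocity M \<delta> s i)) has_vector_derivative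
        (0, (d - c * t) *\<^sub>R (- Gam i ?x ?v ?v) + (- c) *\<^sub>R ?v)) (at t)" .
    have "\<forall>\<^sub>F s in nhds t. (c * r, (d - c * s) *\<^sub>R velocity M \<delta> s i) = light_field \<delta> r c d s i"
      by (rule eventually_mono[OF regular_atD(2)[OF reg i]])
        (simp add: light_field_def lift_def charts_at_def i'(1) tscale_def)
    from has_vector_derivative_transform_nhds[OF D this]
    have D': "((\<lambda>s. light_field \<delta> r c d s i) has_vector_derivative
        (0, (d - c * t) *\<^sub>R (- Gam i ?x ?v ?v) + (- c) *\<^sub>R ?v)) (at t)" .
    have m0: "mc i ?x ?v ?v = 0" using null[of t] mc_g[OF i velT velT] by simp
    have "light_field \<delta> r c d t i = (c * r, (d - c * t) *\<^sub>R ?v)"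
      using i by (simp add: light_field_def lift_def tscale_def)
    then have "- N.Gam i (r, ?x) (0, ?v) (light_field \<delta> r c d t i) = (0, (d - c * t) *\<^sub>R (- Gam i ?x ?v ?v) + (- c) *\<^sub>R ?v)"
      using cone_Gam[OF i'(1) r x, of ?v "c * r" "(d - c * t) *\<^sub>R ?v"] r
      by (simp add: mc_scale_right[OF i'(1) x] m0 linear_scale[OF linear_Gam(2)[OF i'(1) x]])
    with D' show ?thesis by simp
  qed
  have par: "parallel_at NM NG (\<lambda>t. (r, \<delta> t)) (light_field \<delta> r c d) t" for t
  proof -
    have "\<delta> t \<in> topspace (mtop M)" using geo(1) unfolding smooth_curve_def by (auto simp: continuous_map_def)
    then obtain i where i: "i \<in> charts_at M (\<delta> t)" using chart_exists by blast
    show ?thesis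
    proof (rule N.parallel_atI)
      show "i \<in> charts_at NM (r, \<delta> t)" using i cone_charts_at[OF r] by simp
      from has_vector_derivative_Pair[OF has_vector_derivative_const[of r] regular_atD(1)[OF reg i]]
      show "((cmap NM i \<circ> (\<lambda>t. (r, \<delta> t))) has_vector_derivative (0, velocity M \<delta> t i)) (at t)"
        by (simp add: o_def)
      show "\<forall>\<^sub>F s in nhds t. (r, \<delta> s) \<in> cdom NM i \<and> light_field \<delta> r c d s \<in> tangent_space NM (r, \<delta> s)"
        by (rule eventually_mono[OF regular_atD(2)[OF reg i]]) (use T r in simp)
      show "((\<lambda>s. light_field \<delta> r c d s i) has_vector_derivative
          - N.Gam i (cmap NM i (r, \<delta> t)) (0, velocity M \<delta> t i) (light_field \<delta> r c d t i)) (at t)"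
        using deriv[OF i] by simp
    qed
  qed
  show ?thesis
    unfolding N.par_on_def
  proof (intro conjI ballI T)
    show "continuous_on {t \<in> {a..b}. (r, \<delta> t) \<in> cdom NM i} (\<lambda>t. light_field \<delta> r c d t i)" if i: "i \<in> idx NM" for i
    proof (rule continuous_at_imp_continuous_on, rule ballI)
      fix t assume "t \<in> {t \<in> {a..b}. (r, \<delta> t) \<in> cdom NM i}"
      then have "i \<in> charts_at M (\<delta> t)" using i by (simp add: charts_at_def)
      from has_vector_derivative_continuous[OF deriv[OF this]]
      show "isCont (\<lambda>t. light_field \<delta> r c d t i) t" .
    qed
    show "\<exists>S. finite S \<and> (\<forall>t\<in>{a<..<b} - S. parallel_at NM NG (\<lambda>t. (r, \<delta> t)) (light_field \<delta> r c d) t)"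
      using par by (intro exI[of _ "{}"]) simp
  qed
qed

lemma light_field_ptrans:
  assumes \<delta>: "light_line_geodesic M g UNIV \<delta>" and r: "r > 0" and \<tau>: "\<tau> > 0"
  shows "N.ptrans (\<lambda>s. (r, \<delta> (\<tau> * s + 0))) (light_field \<delta> r c d 0) (light_field \<delta> r c d \<tau>)"
proof -
  have "smooth_curve M UNIV \<delta>" using \<delta> unfolding light_line_geodesic_def geodesic_def by blast
  from smooth_curve_cone[OF r this] have sm: "smooth_curve NM UNIV (\<lambda>t. (r, \<delta> t))" .
  have reg: "N.regular_at (\<lambda>t. (r, \<delta> t)) t" for t by (rule N.smooth_curve_open_regular[OF sm]) auto
  have "N.par_on (\<lambda>s. (r, \<delta> (\<tau> * s + 0))) 0 1 (\<lambda>s. light_field \<delta> r c d (\<tau> * s + 0))"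
    by (rule N.par_on_affine[OF light_field_par_on[OF \<delta> r, of 0 \<tau>], of "{}"])
      (use \<tau> reg in \<open>auto simp: mult_le_cancel_left1\<close>)
  moreover have "piecewise_smooth_path NM (\<lambda>s. (r, \<delta> (\<tau> * s + 0)))"
    by (rule N.smooth_curve_piecewise[OF N.smooth_curve_affine[OF sm]]) auto
  ultimately show ?thesis
    unfolding N.ptrans_def N.parallel_along_par_on
    by (intro conjI exI[of _ "\<lambda>s. light_field \<delta> r c d (\<tau> * s + 0)"]) simp_all
qed

text \<open>With \<open>d = \<tau>\<close>, comparison with \<open>light_field_end\<close> shows
  that transport back along \<delta> takes the radial vector at parameter \<open>\<tau>\<close> to
  the radial vector at the start plus \<open>\<tau>\<close> times the initial velocity. All
  polynomial dependence on the parameter stems from this.\<close>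

lemma light_field_start:
  assumes "\<delta> 0 = q" "velocity M \<delta> 0 = v"
  shows "light_field \<delta> r 1 d 0 = lift q r 0 + tscale d (lift q 0 v)"
  using lift_add[of q r 0 0 "tscale d v"] lift_scale[of q d 0 v] assms by (simp add: light_field_def)

lemma light_field_end: "light_field \<delta> r 1 \<tau> \<tau> = lift (\<delta> \<tau>) r 0"
proof -
  have "tscale 0 v = 0" for v :: "('i, 'e) tvec" by (simp add: tscale_def fun_eq_iff)
  then show ?thesis by (simp add: light_field_def)
qed

section \<open>Invariant subspaces of the cone\<close>

lemma hol_invariantD:
  assumes "N.hol_invariant z U"
  shows "module.subspace tscale U" "U \<subseteq> tangent_space NM z" "nondegenerate_on (NG z) U"
    "\<And>\<gamma> u w. \<gamma> 0 = z \<Longrightarrow> \<gamma> 1 = z \<Longrightarrow> N.ptrans \<gamma> u w \<Longrightarrow> u \<in> U \<Longrightarrow> w \<in> U"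
  using assms unfolding N.hol_invariant_def by blast+

text \<open>Let \<open>y\<close> be the projection of the radial vector \<open>\<xi>\<close>. Along the light-like geodesic with initial
  velocity \<open>v\<close> the squared length of the projection of the radial vector is a quadratic polynomial of the
  parameter with linear coefficient \<open>2 \<langle>y, v\<rangle>\<close>; by compactness it is bounded at infinitely many
  integers.\<close>

lemma projection_orthogonal_null:
  assumes r: "r > 0" and q: "q \<in> topspace (mtop M)" and complete: "light_line_complete M g"
    and compact: "compact_space (mtop M)" and inv: "N.hol_invariant (r, q) U"
    and v: "v \<in> tangent_space M q" "g q v v = 0"
    and y: "y \<in> U" "\<And>u. u \<in> U \<Longrightarrow> NG (r, q) (lift q r 0) u = NG (r, q) y u"
  shows "NG (r, q) y (lift q 0 v) = 0"
proof -
  note U = hol_invariantD[OF inv]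
  interpret vs: vector_space "tscale :: real \<Rightarrow> ('i, real \<times> 'e) tvec \<Rightarrow> _" by (rule vector_space_tscale)
  have top: "(r, p) \<in> topspace (mtop NM)" if "p \<in> topspace (mtop M)" for p using that r by simp
  obtain \<delta> where \<delta>: "light_line_geodesic M g UNIV \<delta>" "\<delta> 0 = q" "velocity M \<delta> 0 = v"
    using light_line_exists[OF q v complete] by blast
  have sm: "smooth_curve M UNIV \<delta>" using \<delta>(1) unfolding light_line_geodesic_def geodesic_def by blast
  have \<delta>top: "\<delta> t \<in> topspace (mtop M)" for t using sm unfolding smooth_curve_def by (auto simp: continuous_map_def)
  let ?A = "lift q r 0" and ?B = "lift q 0 v"
  have AB: "?A \<in> tangent_space NM (r, q)" "?B \<in> tangent_space NM (r, q)"
    by (rule lift_tangent[OF r tangent_0], rule lift_tangent[OF r v(1)])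
  obtain yB where yB: "yB \<in> U" "\<forall>u\<in>U. NG (r, q) ?B u = NG (r, q) yB u"
    using N.g_projection[OF top[OF q] U(1-3) AB(2)] by blast
  have yT: "y \<in> tangent_space NM (r, q)" "yB \<in> tangent_space NM (r, q)" using y(1) yB(1) U(2) by blast+
  \<comment> \<open>\<open>X n\<close> is the radial vector at \<open>\<delta> n\<close> transported
    back to the start, and \<open>Y n\<close> its projection. Projecting here onto \<open>U\<close>
    amounts to projecting at \<open>\<delta> n\<close> onto the transported subspace, as transport
    is isometric.\<close>
  define X Y where "X n = ?A + tscale (real n) ?B" and "Y n = y + tscale (real n) yB" for n :: nat
  have YU: "Y n \<in> U" for n unfolding Y_def by (intro vs.subspace_add[OF U(1)] vs.subspace_scale[OF U(1)] y yB)
  have XY: "NG (r, q) (X n) u = NG (r, q) (Y n) u" if u: "u \<in> U" for n u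
  proof -
    have uT: "u \<in> tangent_space NM (r, q)" using u U(2) by blast
    show ?thesis
      unfolding X_def Y_def N.g_add[OF top[OF q] AB(1) N.tangent_scale[OF AB(2)] uT]
        N.g_add[OF top[OF q] yT(1) N.tangent_scale[OF yT(2)] uT]
        N.g_scale[OF top[OF q] AB(2) uT] N.g_scale[OF top[OF q] yT(2) uT]
      using y(2)[OF u] yB(2) u by simp
  qed
  \<comment> \<open>\<open>z\<close> packs a chart index and a radius for which the estimate of
    \<open>short_segments\<close> holds; one such pair is then chosen for each point of
    \<open>M\<close>.\<close>
  define good where "good p z \<longleftrightarrow> fst z \<in> charts_at M p \<and> snd z > 0 \<and>
     (\<forall>x y v. x \<in> ball (cmap NM (fst z) (r, p)) (snd z) \<longrightarrow> y \<in> ball (cmap NM (fst z) (r, p)) (snd z) \<longrightarrow>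
       v \<in> tangent_space NM (cinv NM (fst z) x) \<longrightarrow>
       (\<exists>w. N.ptrans (\<lambda>s. cinv NM (fst z) (x + s *\<^sub>R (y - x))) v w \<and> norm (w (fst z)) \<le> 2 * norm (v (fst z))))"
    for p and z :: "'i \<times> real"
  have good_chart: "fst z \<in> charts_at M p" "snd z > 0" if "good p z" for p z
    using that unfolding good_def by blast+
  have good_seg: "\<exists>w. N.ptrans (\<lambda>s. cinv NM (fst z) (x + s *\<^sub>R (y - x))) v w \<and> norm (w (fst z)) \<le> 2 * norm (v (fst z))"
    if "good p z" "x \<in> ball (cmap NM (fst z) (r, p)) (snd z)" "y \<in> ball (cmap NM (fst z) (r, p)) (snd z)"
      "v \<in> tangent_space NM (cinv NM (fst z) x)" for p z x y v
    using that unfolding good_def by blast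
  have good_ex: "\<exists>z. good p z" if p: "p \<in> topspace (mtop M)" for p
  proof -
    obtain i where i: "i \<in> charts_at M p" using chart_exists[OF p] by blast
    then have i': "i \<in> charts_at NM (r, p)" using cone_charts_at[OF r] by simp
    have "\<exists>\<rho>. good p (i, \<rho>)"
      by (rule N.short_segments[OF i']) (use i in \<open>unfold good_def fst_conv snd_conv, blast\<close>)
    then show ?thesis by blast
  qed
  have good: "good p (SOME z. good p z)" if "p \<in> topspace (mtop M)" for p by (rule someI_ex[OF good_ex[OF that]])
  \<comment> \<open>The part of the cone ball at radius \<open>r\<close>, viewed as an open subset
    of \<open>M\<close>, so that compactness of \<open>M\<close> can be used although the cone is
    not compact.\<close>
  define W where "W p = (let (i, \<rho>) = SOME z. good p z in
     {x \<in> cdom M i. cmap M i x \<in> (\<lambda>a. (r, a)) -` ball (cmap NM i (r, p)) \<rho>})" for p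
  have Wopen: "openin (mtop M) (W p) \<and> p \<in> W p" if p: "p \<in> topspace (mtop M)" for p
  proof -
    obtain i \<rho> where z: "(SOME z. good p z) = (i, \<rho>)" by (cases "SOME z. good p z")
    have "good p (i, \<rho>)" using good[OF p] unfolding z .
    from good_chart[OF this] have i: "i \<in> charts_at M p" "\<rho> > 0" by simp_all
    have opn: "open ((\<lambda>a. (r, a)) -` ball (cmap NM i (r, p)) \<rho>)" by (intro open_vimage open_ball continuous_intros)
    show ?thesis unfolding W_def z Let_def prod.case
      using openin_chart_preimage[OF charts_atD(1)[OF i(1)] opn] charts_atD[OF i(1)] i(2) by simp
  qed
  obtain p where p: "p \<in> topspace (mtop M)" and inf: "infinite {n. \<delta> (real n) \<in> W p}"
    using compact_recurrence[where \<delta>=\<delta>, OF compact \<delta>top Wopen] by blast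
  obtain i \<rho> where z: "(SOME z. good p z) = (i, \<rho>)" by (cases "SOME z. good p z")
  \<comment> \<open>Parameter 0 is dropped because \<open>light_field_ptrans\<close> concerns
    positive parameters.\<close>
  define I where "I = {n. \<delta> (real n) \<in> W p} - {0}"
  have I: "infinite I" unfolding I_def using inf by simp
  then obtain m where m: "m \<in> I" by (metis finite.emptyI ex_in_conv)
  define x where "x n = cmap NM i (r, \<delta> (real n))" for n :: nat
  have gz: "good p (i, \<rho>)" using good[OF p] unfolding z .
  have i: "i \<in> charts_at M p" using good_chart(1)[OF gz] by simp
  have In: "real n > 0" "x n \<in> ball (cmap NM i (r, p)) \<rho>" "i \<in> charts_at M (\<delta> (real n))" "cinv NM i (x n) = (r, \<delta> (real n))"
    if n: "n \<in> I" for n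
  proof -
    show "real n > 0" using n by (simp add: I_def)
    have "\<delta> (real n) \<in> W p" using n by (simp add: I_def)
    then have d: "\<delta> (real n) \<in> cdom M i" "(r, cmap M i (\<delta> (real n))) \<in> ball (cmap NM i (r, p)) \<rho>"
      unfolding W_def z Let_def prod.case by auto
    show "x n \<in> ball (cmap NM i (r, p)) \<rho>" using d(2) by (simp add: x_def)
    show "i \<in> charts_at M (\<delta> (real n))" using d(1) charts_atD(1)[OF i] by (simp add: charts_at_def)
    have "i \<in> idx NM" "(r, \<delta> (real n)) \<in> cdom NM i" using charts_atD(1)[OF i] d(1) r by simp_all
    from N.cinv_cmap[OF this] show "cinv NM i (x n) = (r, \<delta> (real n))" unfolding x_def .
  qed
  have seg: "\<exists>w. N.ptrans (\<lambda>s. cinv NM i (x n + s *\<^sub>R (x m - x n))) v w \<and> norm (w i) \<le> 2 * norm (v i)"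
    if n: "n \<in> I" and v: "v \<in> tangent_space NM (r, \<delta> (real n))" for n v
    by (rule good_seg[OF gz, unfolded fst_conv snd_conv, OF In(2)[OF n] In(2)[OF m]]) (use v In(4)[OF n] in simp)
  define \<alpha> where "\<alpha> n = (\<lambda>s. (r, \<delta> (real n * s + 0)))" for n :: nat
  have \<alpha>e: "\<alpha> n 0 = (r, q)" "\<alpha> n 1 = (r, \<delta> (real n))" for n by (simp_all add: \<alpha>_def \<delta>(2))
  have \<alpha>X: "N.ptrans (\<alpha> n) (X n) (lift (\<delta> (real n)) r 0)" if n: "n \<in> I" for n
    using light_field_ptrans[OF \<delta>(1) r In(1)[OF n], of 1 "real n"]
    unfolding light_field_start[OF \<delta>(2,3)] light_field_end \<alpha>_def X_def .
  have \<alpha>psp: "piecewise_smooth_path NM (\<alpha> n)" if n: "n \<in> I" for n using \<alpha>X[OF n] unfolding N.ptrans_def by blast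
  \<comment> \<open>All comparisons are made at the one point \<open>(r, \<delta> m)\<close> with
    the one subspace \<open>V\<close>, so that the projection constant \<open>C\<close> is the same
    for all \<open>n\<close>.\<close>
  define V where "V = {w. \<exists>u\<in>U. N.ptrans (\<alpha> m) u w}"
  have "N.hol_invariant (r, \<delta> (real m)) V"
    unfolding V_def by (rule N.hol_invariant_transfer[OF inv \<alpha>psp[OF m] \<alpha>e])
  note V = hol_invariantD[OF this]
  have im: "i \<in> charts_at NM (r, \<delta> (real m))" using In(3)[OF m] cone_charts_at[OF r] by simp
  obtain C where C: "\<And>z y. z \<in> tangent_space NM (r, \<delta> (real m)) \<Longrightarrow> y \<in> V \<Longrightarrow>
      (\<And>u. u \<in> V \<Longrightarrow> NG (r, \<delta> (real m)) z u = NG (r, \<delta> (real m)) y u) \<Longrightarrow>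
      \<bar>NG (r, \<delta> (real m)) y y\<bar> \<le> C * (norm (z i))\<^sup>2"
    using N.g_projection_bound[OF top[OF \<delta>top] V(1-3) im] by blast
  have bdY: "\<bar>NG (r, q) (Y n) (Y n)\<bar> \<le> max C 0 * (2 * r)\<^sup>2" if n: "n \<in> I" for n
  proof -
    define \<sigma> where "\<sigma> = (\<lambda>s. cinv NM i (x n + s *\<^sub>R (x m - x n)))"
    have \<sigma>e: "\<sigma> 0 = (r, \<delta> (real n))" "\<sigma> 1 = (r, \<delta> (real m))" using In(4)[OF n] In(4)[OF m] by (simp_all add: \<sigma>_def)
    have "lift (\<delta> (real n)) r 0 \<in> tangent_space NM (r, \<delta> (real n))" by (rule lift_tangent[OF r tangent_0])
    from seg[OF n this] obtain w where w: "N.ptrans \<sigma> (lift (\<delta> (real n)) r 0) w"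
      "norm (w i) \<le> 2 * norm (lift (\<delta> (real n)) r 0 i)" unfolding \<sigma>_def by blast
    \<comment> \<open>Radial vectors have the same coordinates at every point of the level set, so
      the bound after doubling is \<open>2 * r\<close>, whatever \<open>n\<close> is.\<close>
    have "lift (\<delta> (real n)) r 0 i = (r, 0)" using In(3)[OF n] by (simp add: lift_def)
    then have wn: "norm (w i) \<le> 2 * r" using w(2) r by (simp add: norm_Pair)
    \<comment> \<open>Along the geodesic to \<open>\<delta> n\<close>, then along the short segment
      to \<open>\<delta> m\<close>.\<close>
    define \<beta> where "\<beta> = pjoin (\<alpha> n) \<sigma>"
    have \<beta>e: "\<beta> 0 = (r, q)" "\<beta> 1 = (r, \<delta> (real m))" by (simp_all add: \<beta>_def \<alpha>e \<sigma>e)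
    have \<beta>X: "N.ptrans \<beta> (X n) w" unfolding \<beta>_def by (rule N.ptrans_pjoin[OF \<alpha>X[OF n] w(1)]) (simp add: \<alpha>e \<sigma>e)
    have \<beta>psp: "piecewise_smooth_path NM \<beta>" using \<beta>X unfolding N.ptrans_def by blast
    have "Y n \<in> tangent_space NM (\<beta> 0)" using YU U(2) \<beta>e by auto
    then obtain z where z: "N.ptrans \<beta> (Y n) z" using N.ptrans_exists[OF \<beta>psp] by blast
    have zT: "z \<in> tangent_space NM (\<alpha> m 1)" "w \<in> tangent_space NM (r, \<delta> (real m))"
      using N.ptrans_tangent(2)[OF z] N.ptrans_tangent(2)[OF \<beta>X] \<beta>e \<alpha>e by simp_all
    \<comment> \<open>Going along \<open>\<beta>\<close> and back along \<open>\<alpha> m\<close> is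
      a loop, so by invariance of \<open>U\<close> both paths carry \<open>U\<close> to the same
      subspace, although they transport single vectors differently.\<close>
    have "z \<in> V"
    proof -
      obtain u where u: "N.ptrans (\<alpha> m) u z" using N.ptrans_exists_back[OF \<alpha>psp[OF m] zT(1)] by blast
      have "N.ptrans (pjoin \<beta> (preverse (\<alpha> m))) (Y n) u"
        by (rule N.ptrans_pjoin[OF z N.ptrans_preverse[OF u]]) (simp add: \<alpha>e \<beta>e)
      then have "u \<in> U" by (rule U(4)[rotated 2]) (simp_all add: \<alpha>e \<beta>e YU)
      with u show ?thesis unfolding V_def by blast
    qed
    moreover have "NG (r, \<delta> (real m)) w u = NG (r, \<delta> (real m)) z u" if u: "u \<in> V" for u
    proof -
      obtain u1 where u1: "u1 \<in> U" "N.ptrans (\<alpha> m) u1 u" using u unfolding V_def by blast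
      have "u \<in> tangent_space NM (\<beta> 1)" using N.ptrans_tangent(2)[OF u1(2)] \<beta>e \<alpha>e by simp
      then obtain u0 where u0: "N.ptrans \<beta> u0 u" using N.ptrans_exists_back[OF \<beta>psp] by blast
      have "N.ptrans (pjoin (\<alpha> m) (preverse \<beta>)) u1 u0"
        by (rule N.ptrans_pjoin[OF u1(2) N.ptrans_preverse[OF u0]]) (simp add: \<alpha>e \<beta>e)
      then have "u0 \<in> U" by (rule U(4)[rotated 2]) (simp_all add: \<alpha>e \<beta>e u1)
      then show ?thesis using N.ptrans_isometry[OF \<beta>X u0] N.ptrans_isometry[OF z u0] XY \<beta>e by simp
    qed
    ultimately have "\<bar>NG (r, \<delta> (real m)) z z\<bar> \<le> C * (norm (w i))\<^sup>2" by (intro C zT)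
    \<comment> \<open>The sign of \<open>C\<close> is unknown; a nonnegative constant is needed
      before the bound on the norm can be inserted.\<close>
    also have "\<dots> \<le> max C 0 * (norm (w i))\<^sup>2" by (intro mult_right_mono) auto
    also have "\<dots> \<le> max C 0 * (2 * r)\<^sup>2" using wn by (intro mult_left_mono power_mono) auto
    finally show ?thesis using N.ptrans_isometry[OF z z] \<beta>e by simp
  qed
  have "\<bar>NG (r, q) y y + 2 * real n * NG (r, q) y yB + (real n)\<^sup>2 * NG (r, q) yB yB\<bar> \<le> max C 0 * (2 * r)\<^sup>2"
    if "n \<in> I" for n
    using bdY[OF that] unfolding Y_def N.g_quadratic[OF top[OF q] yT] .
  from quadratic_bounded_infinite[OF I this] have "NG (r, q) y yB = 0" .
  \<comment> \<open>Because \<open>y\<close> lies in \<open>U\<close>, its product with the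
    projection \<open>yB\<close> is its product with \<open>?B\<close> itself.\<close>
  then have "NG (r, q) yB y = 0" using N.g_sym[OF top[OF q] yT] by simp
  then have "NG (r, q) ?B y = 0" using bspec[OF yB(2) y(1)] by simp
  then show ?thesis using N.g_sym[OF top[OF q] AB(2) yT(1)] by simp
qed

text \<open>Being orthogonal to the lifts of all null vectors, the projection \<open>y\<close> of
  the radial vector has no base component. The two alternatives correspond to its radial component
  \<open>\<sigma>\<close> being nonzero or zero.\<close>

lemma radial_dichotomy:
  assumes r: "r > 0" and q: "q \<in> topspace (mtop M)" and complete: "light_line_complete M g"
    and compact: "compact_space (mtop M)" and inv: "N.hol_invariant (r, q) U"
    and pos: "\<exists>u\<in>tangent_space M q. g q u u > 0" and neg: "\<exists>u\<in>tangent_space M q. g q u u < 0"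
  shows "lift q r 0 \<in> U \<or> (\<forall>u\<in>U. NG (r, q) (lift q r 0) u = 0)"
proof -
  note U = hol_invariantD[OF inv]
  interpret vs: vector_space "tscale :: real \<Rightarrow> ('i, real \<times> 'e) tvec \<Rightarrow> _" by (rule vector_space_tscale)
  have top: "(r, q) \<in> topspace (mtop NM)" using q r by simp
  obtain y where y: "y \<in> U" "\<forall>u\<in>U. NG (r, q) (lift q r 0) u = NG (r, q) y u"
    using N.g_projection[OF top U(1-3) lift_tangent[OF r tangent_0]] by blast
  have yT: "y \<in> tangent_space NM (r, q)" using y(1) U(2) by blast
  define \<sigma> y' where "\<sigma> = dx0 M q y" and "y' = base_part y"
  have y': "y = lift q \<sigma> y'" "y' \<in> tangent_space M q"
    using lift_decompose[OF r yT] cone_base_part[OF r yT] unfolding \<sigma>_def y'_def by blast+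
  have "y' = 0"
  proof (rule null_vectors_separate[OF q pos neg y'(2) tangent_0])
    fix v assume v: "v \<in> tangent_space M q" "g q v v = 0"
    have "NG (r, q) y (lift q 0 v) = 0"
      by (rule projection_orthogonal_null[OF r q complete compact inv v y(1)]) (use y(2) in blast)
    then have "g q y' v = 0" unfolding y'(1) cone_metric_lift[OF q y'(2) v(1)] using r by simp
    moreover have "g q 0 v = 0"
      using g_scale[OF q tangent_0 v(1), of 0] by (simp add: tscale_def zero_fun_def)
    ultimately show "g q y' v = g q 0 v" by simp
  qed
  with y' have y0: "y = lift q \<sigma> 0" by simp
  show ?thesis
  proof (cases "\<sigma> = 0")
    case True
    have "NG (r, q) y u = 0" if u: "u \<in> U" for u
    proof -
      have "y = tscale 0 y" unfolding y0 True by (auto simp: lift_def tscale_def fun_eq_iff zero_prod_def)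
      then have "NG (r, q) y u = NG (r, q) (tscale 0 y) u" by simp
      also have "\<dots> = 0" using N.g_scale[OF top yT, of u 0] u U(2) by auto
      finally show ?thesis .
    qed
    then show ?thesis using y(2) by simp
  next
    case False
    have "tscale (r / \<sigma>) y = lift q r 0"
      unfolding y0 using False by (auto simp: lift_def tscale_def fun_eq_iff)
    then show ?thesis using vs.subspace_scale[OF U(1) y(1), of "r / \<sigma>"] by simp
  qed
qed

end

section \<open>From the radial vector to the whole tangent space\<close>

context riemannian_cone
begin

text \<open>With \<open>A\<close> the radial vector, \<open>A + t B\<close> is the parallel translate of the radial vector at the
  parameter \<open>t\<close>; two of the three parameters \<open>1, 2, 3\<close> fall into the same case of the dichotomy.\<close>

lemma radial_null_dichotomy:
  assumes r: "r > 0" and p: "p \<in> topspace (mtop M)" and complete: "light_line_complete M g"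
    and compact: "compact_space (mtop M)" and inv: "N.hol_invariant (r, p) U"
    and pos: "\<And>q. q \<in> topspace (mtop M) \<Longrightarrow> \<exists>u\<in>tangent_space M q. g q u u > 0"
    and neg: "\<And>q. q \<in> topspace (mtop M) \<Longrightarrow> \<exists>u\<in>tangent_space M q. g q u u < 0"
    and v: "v \<in> tangent_space M p" "g p v v = 0"
  shows "lift p r 0 \<in> U \<and> lift p 0 v \<in> U \<or>
    (\<forall>u\<in>U. NG (r, p) (lift p r 0) u = 0 \<and> NG (r, p) (lift p 0 v) u = 0)"
proof -
  note U = hol_invariantD[OF inv]
  interpret vs: vector_space "tscale :: real \<Rightarrow> ('i, real \<times> 'e) tvec \<Rightarrow> _" by (rule vector_space_tscale)
  have top: "(r, p) \<in> topspace (mtop NM)" using p r by simp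
  obtain \<delta> where \<delta>: "light_line_geodesic M g UNIV \<delta>" "\<delta> 0 = p" "velocity M \<delta> 0 = v"
    using light_line_exists[OF p v complete] by blast
  have sm: "smooth_curve M UNIV \<delta>" using \<delta>(1) unfolding light_line_geodesic_def geodesic_def by blast
  have \<delta>top: "\<delta> t \<in> topspace (mtop M)" for t using sm unfolding smooth_curve_def by (auto simp: continuous_map_def)
  let ?A = "lift p r 0" and ?B = "lift p 0 v"
  have AB: "?A \<in> tangent_space NM (r, p)" "?B \<in> tangent_space NM (r, p)"
    by (rule lift_tangent[OF r tangent_0], rule lift_tangent[OF r v(1)])
  have dich: "?A + tscale t ?B \<in> U \<or> (\<forall>u\<in>U. NG (r, p) ?A u + t * NG (r, p) ?B u = 0)" if t: "t > 0" for t
  proof -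
    define \<alpha> where "\<alpha> = (\<lambda>s. (r, \<delta> (t * s + 0)))"
    have \<alpha>e: "\<alpha> 0 = (r, p)" "\<alpha> 1 = (r, \<delta> t)" by (simp_all add: \<alpha>_def \<delta>(2))
    have \<alpha>X: "N.ptrans \<alpha> (?A + tscale t ?B) (lift (\<delta> t) r 0)"
      using light_field_ptrans[OF \<delta>(1) r t, of 1 t]
      unfolding light_field_start[OF \<delta>(2,3)] light_field_end \<alpha>_def .
    have \<alpha>psp: "piecewise_smooth_path NM \<alpha>" using \<alpha>X unfolding N.ptrans_def by blast
    have "N.hol_invariant (r, \<delta> t) {w. \<exists>u\<in>U. N.ptrans \<alpha> u w}"
      by (rule N.hol_invariant_transfer[OF inv \<alpha>psp \<alpha>e])
    from radial_dichotomy[OF r \<delta>top complete compact this pos[OF \<delta>top] neg[OF \<delta>top]]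
    show ?thesis
    proof
      assume "lift (\<delta> t) r 0 \<in> {w. \<exists>u\<in>U. N.ptrans \<alpha> u w}"
      then obtain u where u: "u \<in> U" "N.ptrans \<alpha> u (lift (\<delta> t) r 0)" by blast
      have "u = ?A + tscale t ?B" by (rule N.ptrans_unique[OF N.ptrans_preverse[OF u(2)] N.ptrans_preverse[OF \<alpha>X]])
      with u(1) show ?thesis by simp
    next
      assume orth: "\<forall>w\<in>{w. \<exists>u\<in>U. N.ptrans \<alpha> u w}. NG (r, \<delta> t) (lift (\<delta> t) r 0) w = 0"
      have "NG (r, p) ?A u + t * NG (r, p) ?B u = 0" if u: "u \<in> U" for u
      proof -
        have uT: "u \<in> tangent_space NM (r, p)" using u U(2) by blast
        then have "u \<in> tangent_space NM (\<alpha> 0)" using \<alpha>e by simp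
        then obtain w where w: "N.ptrans \<alpha> u w" using N.ptrans_exists[OF \<alpha>psp] by blast
        then have "NG (r, \<delta> t) (lift (\<delta> t) r 0) w = 0" using orth u by blast
        then have "NG (r, p) (?A + tscale t ?B) u = 0" using N.ptrans_isometry[OF \<alpha>X w] \<alpha>e by simp
        then show ?thesis
          unfolding N.g_add[OF top AB(1) N.tangent_scale[OF AB(2)] uT] N.g_scale[OF top AB(2) uT] .
      qed
      then show ?thesis by blast
    qed
  qed
  have inU: "?A \<in> U \<and> ?B \<in> U" if st: "s \<noteq> t" "?A + tscale s ?B \<in> U" "?A + tscale t ?B \<in> U" for s t
  proof -
    \<comment> \<open>The difference quotient of two points of the line: if both lie in
      \<open>U\<close>, so does the direction \<open>?B\<close>, and then \<open>?A\<close>.\<close>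
    have "tscale (1 / (s - t)) ((?A + tscale s ?B) + tscale (- 1) (?A + tscale t ?B)) \<in> U"
      by (intro vs.subspace_scale[OF U(1)] vs.subspace_add[OF U(1)] st)
    moreover have "tscale (1 / (s - t)) ((?A + tscale s ?B) + tscale (- 1) (?A + tscale t ?B)) = ?B"
    proof
      fix i
      have "tscale (1 / (s - t)) ((?A + tscale s ?B) + tscale (- 1) (?A + tscale t ?B)) i
          = (1 / (s - t)) *\<^sub>R ((s - t) *\<^sub>R ?B i)"
        by (simp add: tscale_def scaleR_diff_left)
      also have "\<dots> = ?B i" using st(1) by simp
      finally show "tscale (1 / (s - t)) ((?A + tscale s ?B) + tscale (- 1) (?A + tscale t ?B)) i = ?B i" .
    qed
    ultimately have B: "?B \<in> U" by simp
    have "(?A + tscale s ?B) + tscale (- s) ?B \<in> U"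
      by (intro vs.subspace_scale[OF U(1)] vs.subspace_add[OF U(1)] st B)
    moreover have "(?A + tscale s ?B) + tscale (- s) ?B = ?A" by (simp add: tscale_def fun_eq_iff)
    ultimately show ?thesis using B by simp
  qed
  have orthU: "\<forall>u\<in>U. NG (r, p) ?A u = 0 \<and> NG (r, p) ?B u = 0"
    if st: "s \<noteq> t" "\<forall>u\<in>U. NG (r, p) ?A u + s * NG (r, p) ?B u = 0" "\<forall>u\<in>U. NG (r, p) ?A u + t * NG (r, p) ?B u = 0" for s t
  proof
    fix u assume u: "u \<in> U"
    have e: "NG (r, p) ?A u + s * NG (r, p) ?B u = 0" "NG (r, p) ?A u + t * NG (r, p) ?B u = 0" using st(2,3) u by blast+
    have "(s - t) * NG (r, p) ?B u = (NG (r, p) ?A u + s * NG (r, p) ?B u) - (NG (r, p) ?A u + t * NG (r, p) ?B u)"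
      by (simp add: algebra_simps)
    then have "NG (r, p) ?B u = 0" unfolding e using st(1) by simp
    with e show "NG (r, p) ?A u = 0 \<and> NG (r, p) ?B u = 0" by simp
  qed
  consider s t where "s \<noteq> t" "?A + tscale s ?B \<in> U" "?A + tscale t ?B \<in> U"
    | s t where "s \<noteq> t" "\<forall>u\<in>U. NG (r, p) ?A u + s * NG (r, p) ?B u = 0" "\<forall>u\<in>U. NG (r, p) ?A u + t * NG (r, p) ?B u = 0"
  proof -
    have "(1::real) \<noteq> 2" "(1::real) \<noteq> 3" "(2::real) \<noteq> 3" by simp_all
    with dich[of 1] dich[of 2] dich[of 3] that show ?thesis by (metis zero_less_numeral zero_less_one)
  qed
  then show ?thesis
  proof cases
    case (1 s t)
    from inU[OF this] show ?thesis by simp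
  next
    case (2 s t)
    from orthU[OF this] show ?thesis by (rule disjI2)
  qed
qed

text \<open>The radial vector and the lifts of null vectors separate all tangent vectors of the
  cone. If all of them lie in \<open>U\<close>, each vector coincides with its projection to
  \<open>U\<close>; if all are orthogonal to \<open>U\<close>, each vector of \<open>U\<close>
  vanishes. Either way \<open>U\<close> is not proper.\<close>

lemma cone_not_decomposable:
  assumes complete: "light_line_complete M g" and compact: "compact_space (mtop M)"
    and conn: "connected_space (mtop M)" and ind: "indefinite M g"
  shows "\<not> decomposable NM NG"
proof
  assume "decomposable NM NG"
  then obtain z U where z: "z \<in> topspace (mtop NM)"
    and U: "module.subspace tscale U" "U \<subseteq> tangent_space NM z" "U \<noteq> {0}" "U \<noteq> tangent_space NM z"
      "nondegenerate_on (NG z) U" "\<forall>P\<in>holonomy_group NM NG z. P ` U \<subseteq> U"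
    unfolding decomposable_def by blast
  interpret vs: vector_space "tscale :: real \<Rightarrow> ('i, real \<times> 'e) tvec \<Rightarrow> _" by (rule vector_space_tscale)
  obtain r p where rp: "z = (r, p)" "r > 0" "p \<in> topspace (mtop M)" using z by (cases z) auto
  note r = rp(2) and p = rp(3)
  note U = U[unfolded rp(1)]
  have top: "(r, p) \<in> topspace (mtop NM)" using z rp(1) by simp
  have inv: "N.hol_invariant (r, p) U" by (rule N.holonomy_invariantI[OF top U(1,2,5,6)])
  have pos: "\<exists>u\<in>tangent_space M q. g q u u > 0" if "q \<in> topspace (mtop M)" for q
    using not_definite[OF conn ind _ that, of "- 1"] by simp
  have neg: "\<exists>u\<in>tangent_space M q. g q u u < 0" if "q \<in> topspace (mtop M)" for q
    using not_definite[OF conn ind _ that, of 1] by simp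
  let ?A = "lift p r 0"
  have AT: "?A \<in> tangent_space NM (r, p)" by (rule lift_tangent[OF r tangent_0])
  have g0: "g p w 0 = 0" if w: "w \<in> tangent_space M p" for w
    using g_scale_right[OF p tangent_0 w, of 0] by (simp add: tscale_def zero_fun_def)
  have GA: "NG (r, p) (lift p \<sigma> w) ?A = \<sigma> * r" if "w \<in> tangent_space M p" for \<sigma> w
    using cone_metric_lift[OF p that tangent_0] g0[OF that] by simp
  have GB: "NG (r, p) (lift p \<sigma> w) (lift p 0 v) = r\<^sup>2 * g p w v"
    if "w \<in> tangent_space M p" "v \<in> tangent_space M p" for \<sigma> w v
    using cone_metric_lift[OF p that] by simp
  have dec: "\<exists>\<sigma> w. w \<in> tangent_space M p \<and> u = lift p \<sigma> w" if "u \<in> tangent_space NM (r, p)" for u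
    using lift_decompose[OF r that] cone_base_part[OF r that] by blast
  have dich: "?A \<in> U \<and> lift p 0 v \<in> U \<or> (\<forall>u\<in>U. NG (r, p) ?A u = 0 \<and> NG (r, p) (lift p 0 v) u = 0)"
    if v: "v \<in> tangent_space M p" "g p v v = 0" for v
    by (rule radial_null_dichotomy[OF r p complete compact inv _ _ v]) (rule pos neg; assumption)+
  show False
  proof (cases "?A \<in> U")
    case True
    have nullU: "lift p 0 v \<in> U" if v: "v \<in> tangent_space M p" "g p v v = 0" for v
    proof -
      \<comment> \<open>The radial vector has square \<open>r * r\<close>, so when it lies in
        \<open>U\<close> it cannot be orthogonal to \<open>U\<close>; this forces the first
        alternative for all null \<open>v\<close> simultaneously.\<close>
      have "NG (r, p) ?A ?A \<noteq> 0" using GA[OF tangent_0, of r] r by simp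
      with dich[OF v] True show ?thesis by blast
    qed
    have "tangent_space NM (r, p) \<subseteq> U"
    proof
      fix w assume w: "w \<in> tangent_space NM (r, p)"
      obtain y where y: "y \<in> U" "\<forall>u\<in>U. NG (r, p) w u = NG (r, p) y u"
        using N.g_projection[OF top U(1,2,5) w] by blast
      have yT: "y \<in> tangent_space NM (r, p)" using y(1) U(2) by blast
      obtain \<sigma> w' where w': "w' \<in> tangent_space M p" "w = lift p \<sigma> w'" using dec[OF w] by blast
      obtain \<tau> y' where y': "y' \<in> tangent_space M p" "y = lift p \<tau> y'" using dec[OF yT] by blast
      have "\<sigma> * r = \<tau> * r" using bspec[OF y(2) True] unfolding w'(2) y'(2) GA[OF w'(1)] GA[OF y'(1)] .
      then have "\<sigma> = \<tau>" using r by simp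
      moreover have "w' = y'"
      proof (rule null_vectors_separate[OF p pos[OF p] neg[OF p] w'(1) y'(1)])
        fix v assume v: "v \<in> tangent_space M p" "g p v v = 0"
        have "r\<^sup>2 * g p w' v = r\<^sup>2 * g p y' v"
          using bspec[OF y(2) nullU[OF v]] unfolding w'(2) y'(2) GB[OF w'(1) v(1)] GB[OF y'(1) v(1)] .
        then show "g p w' v = g p y' v" using r by simp
      qed
      ultimately have "w = y" unfolding w'(2) y'(2) by simp
      with y(1) show "w \<in> U" by simp
    qed
    with U(2,4) show False by blast
  next
    case False
    have "u = 0" if u: "u \<in> U" for u
    proof -
      have uT: "u \<in> tangent_space NM (r, p)" using u U(2) by blast
      obtain \<sigma> u' where u': "u' \<in> tangent_space M p" "u = lift p \<sigma> u'" using dec[OF uT] by blast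
      have orth: "NG (r, p) u ?A = 0" "NG (r, p) u (lift p 0 v) = 0" if v: "v \<in> tangent_space M p" "g p v v = 0" for v
        using dich[OF v] False u N.g_sym[OF top uT AT] N.g_sym[OF top uT lift_tangent[OF r v(1)]] by auto
      \<comment> \<open>The zero vector serves as the null vector in \<open>orth\<close>.\<close>
      have "\<sigma> * r = 0" using orth(1)[OF tangent_0 g0[OF tangent_0]] unfolding u'(2) GA[OF u'(1)] .
      then have "\<sigma> = 0" using r by simp
      moreover have "u' = 0"
      proof (rule null_vectors_separate[OF p pos[OF p] neg[OF p] u'(1) tangent_0])
        fix v assume v: "v \<in> tangent_space M p" "g p v v = 0"
        have "r\<^sup>2 * g p u' v = 0" using orth(2)[OF v] unfolding u'(2) GB[OF u'(1) v(1)] .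
        then show "g p u' v = g p 0 v" using r g0[OF v(1)] g_sym[OF p tangent_0 v(1)] by simp
      qed
      ultimately show ?thesis unfolding u'(2) by (auto simp: lift_def fun_eq_iff zero_prod_def)
    qed
    then have "U = {0}" using vs.subspace_0[OF U(1)] by blast
    with U(3) show False by blast
  qed
qed

end

theorem corollary1:
  fixes M :: "('a, 'i, 'e::euclidean_space) atlas"
    and g :: "('a, 'i, 'e) metric"
  assumes "smooth_manifold M"
    and "compact_space (mtop M)"
    and "connected_space (mtop M)"
    and "pseudo_riemannian M g"
    and "indefinite M g"
    and "light_line_complete M g"
  shows "\<not> decomposable (cone_manifold M) (cone_metric M g)"
proof -
  interpret riemannian_cone M g
    by unfold_locales (use assms(1,4) in \<open>auto simp: smooth_manifold_def\<close>)
  show ?thesis by (rule cone_not_decomposable[OF assms(6,2,3,5)])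
qed

end
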